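(* Let $G$ be a simplicial monoid acting from the right on a simplicial set $W$. The category $\mathcal{R}(W,G)$ is equivalent to $\mathrm{Fun}(\mathrm{Simp}_G(W)^{\mathrm{op}},\mathrm{Set}_* )$, the category of (pointed-)set-valued presheaves on $\mathrm{Simp}_G(W)$. The functor corresponding to $(Y,r,s)\in\mathcal{R}(W,G)$ sends $(n,w)\in\mathrm{Simp}_G(W)$ to the fibre $r^{-1}(w)$ over $w\in W_n$. In particular, the category $\mathcal{R}(W,G)$ is complete and cocomplete; limits and colimits are computed fibrewise.
   Context: $\mathcal{R}(W,G)$ is the category of $G$-equivariant retractive spaces over $W$: objects are triples $(Y,r,s)$ where $Y$ is a simplicial set with a right $G$-action, $r\colon Y\to W$ is a $G$-equivariant map, and $s$ is a $G$-equivariant section of $r$; morphisms are $G$-equivariant maps compatible with the retractions and sections. The fibre $r^{-1}(w)$ is pointed by $s(w)$. The equivariant simplex category $\mathrm{Simp}_G(W)$ has as objects the pairs $(n,w)$ with $n$ a natural number and $w\in W_n$; a morphism $(m,v)\to(n,w)$ is a pair $(\alpha,g)$ with $\alpha\colon[m]\to[n]$ a morphism in $\Delta$ and $g\in G_m$ such that $v=W(\alpha)(w)\cdot g$. Composition is $(\beta,h)\circ(\alpha,g):=(\beta\circ\alpha,\ G(\alpha)(h)\cdot g)$. $\mathrm{Set}_*$ is the category of pointed sets. *)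

theory Defs
  imports "HOL-Algebra.Group"
begin

unbundle cardinal_syntax

section \<open>Categories and functors\<close>

record ('o, 'a) cat =
  Ob :: "'o set"
  Arr :: "'a set"
  Dom :: "'a \<Rightarrow> 'o"
  Cod :: "'a \<Rightarrow> 'o"
  Ident :: "'o \<Rightarrow> 'a"
  Comp :: "'a \<Rightarrow> 'a \<Rightarrow> 'a"

text \<open>\<open>Comp C g f\<close> is \<open>g\<close> after \<open>f\<close>; it is only meaningful when \<open>Dom C g = Cod C f\<close>.\<close>

locale category =
  fixes C :: "('o, 'a) cat"
  assumes Dom_in: "f \<in> Arr C \<Longrightarrow> Dom C f \<in> Ob C"
    and Cod_in: "f \<in> Arr C \<Longrightarrow> Cod C f \<in> Ob C"
    and Ident_in: "x \<in> Ob C \<Longrightarrow> Ident C x \<in> Arr C"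
    and Dom_Ident: "x \<in> Ob C \<Longrightarrow> Dom C (Ident C x) = x"
    and Cod_Ident: "x \<in> Ob C \<Longrightarrow> Cod C (Ident C x) = x"
    and Comp_in: "\<lbrakk>f \<in> Arr C; g \<in> Arr C; Dom C g = Cod C f\<rbrakk> \<Longrightarrow> Comp C g f \<in> Arr C"
    and Dom_Comp: "\<lbrakk>f \<in> Arr C; g \<in> Arr C; Dom C g = Cod C f\<rbrakk> \<Longrightarrow> Dom C (Comp C g f) = Dom C f"
    and Cod_Comp: "\<lbrakk>f \<in> Arr C; g \<in> Arr C; Dom C g = Cod C f\<rbrakk> \<Longrightarrow> Cod C (Comp C g f) = Cod C g"
    and Comp_Ident_right: "f \<in> Arr C \<Longrightarrow> Comp C f (Ident C (Dom C f)) = f"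
    and Comp_Ident_left: "f \<in> Arr C \<Longrightarrow> Comp C (Ident C (Cod C f)) f = f"
    and Comp_assoc: "\<lbrakk>f \<in> Arr C; g \<in> Arr C; h \<in> Arr C; Dom C g = Cod C f; Dom C h = Cod C g\<rbrakk>
      \<Longrightarrow> Comp C h (Comp C g f) = Comp C (Comp C h g) f"

definition Hom :: "('o, 'a) cat \<Rightarrow> 'o \<Rightarrow> 'o \<Rightarrow> 'a set" where
  "Hom C x y = {f \<in> Arr C. Dom C f = x \<and> Cod C f = y}"

definition is_iso :: "('o, 'a) cat \<Rightarrow> 'a \<Rightarrow> bool" where
  "is_iso C f \<longleftrightarrow> f \<in> Arr C \<and>
     (\<exists>g \<in> Hom C (Cod C f) (Dom C f).
        Comp C g f = Ident C (Dom C f) \<and> Comp C f g = Ident C (Cod C f))"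

definition op :: "('o, 'a) cat \<Rightarrow> ('o, 'a) cat" where
  "op C = \<lparr>Ob = Ob C, Arr = Arr C, Dom = Cod C, Cod = Dom C,
           Ident = Ident C, Comp = (\<lambda>g f. Comp C f g)\<rparr>"

record ('o, 'a, 'p, 'b) cfun =
  fo :: "'o \<Rightarrow> 'p"
  fa :: "'a \<Rightarrow> 'b"

text \<open>Functors are extensional (undefined outside \<open>Ob C\<close> and \<open>Arr C\<close>), so that equality in HOL
  is equality of functors. The same data are a functor from \<open>C\<close> to \<open>D\<close> and from \<open>op C\<close> to \<open>op D\<close>.\<close>

locale is_functor = dom: category C + cod: category D
  for C :: "('o, 'a) cat" and D :: "('p, 'b) cat" +
  fixes F :: "('o, 'a, 'p, 'b) cfun"
  assumes fo_in: "fo F \<in> Ob C \<rightarrow>\<^sub>E Ob D"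
    and fa_ext: "fa F \<in> extensional (Arr C)"
    and fa_in: "f \<in> Arr C \<Longrightarrow> fa F f \<in> Hom D (fo F (Dom C f)) (fo F (Cod C f))"
    and fa_Ident: "x \<in> Ob C \<Longrightarrow> fa F (Ident C x) = Ident D (fo F x)"
    and fa_Comp: "\<lbrakk>f \<in> Arr C; g \<in> Arr C; Dom C g = Cod C f\<rbrakk>
      \<Longrightarrow> fa F (Comp C g f) = Comp D (fa F g) (fa F f)"

definition id_functor :: "('o, 'a) cat \<Rightarrow> ('o, 'a, 'o, 'a) cfun" where
  "id_functor C = \<lparr>fo = \<lambda>x\<in>Ob C. x, fa = \<lambda>f\<in>Arr C. f\<rparr>"

text \<open>\<open>comp_functor C K F\<close> is \<open>K\<close> after \<open>F\<close>, where \<open>C\<close> is the source of \<open>F\<close>.\<close>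

definition comp_functor ::
  "('o, 'a) cat \<Rightarrow> ('p, 'b, 'q, 'c) cfun \<Rightarrow> ('o, 'a, 'p, 'b) cfun \<Rightarrow> ('o, 'a, 'q, 'c) cfun" where
  "comp_functor C K F = \<lparr>fo = \<lambda>x\<in>Ob C. fo K (fo F x), fa = \<lambda>f\<in>Arr C. fa K (fa F f)\<rparr>"

definition nat_trans ::
  "('o, 'a) cat \<Rightarrow> ('p, 'b) cat \<Rightarrow> ('o, 'a, 'p, 'b) cfun \<Rightarrow> ('o, 'a, 'p, 'b) cfun
    \<Rightarrow> ('o \<Rightarrow> 'b) \<Rightarrow> bool" where
  "nat_trans C D F H \<tau> \<longleftrightarrow>
     is_functor C D F \<and> is_functor C D H \<and> \<tau> \<in> extensional (Ob C) \<and>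
     (\<forall>x \<in> Ob C. \<tau> x \<in> Hom D (fo F x) (fo H x)) \<and>
     (\<forall>f \<in> Arr C. Comp D (\<tau> (Cod C f)) (fa F f) = Comp D (fa H f) (\<tau> (Dom C f)))"

definition nat_iso ::
  "('o, 'a) cat \<Rightarrow> ('p, 'b) cat \<Rightarrow> ('o, 'a, 'p, 'b) cfun \<Rightarrow> ('o, 'a, 'p, 'b) cfun
    \<Rightarrow> ('o \<Rightarrow> 'b) \<Rightarrow> bool" where
  "nat_iso C D F H \<tau> \<longleftrightarrow> nat_trans C D F H \<tau> \<and> (\<forall>x \<in> Ob C. is_iso D (\<tau> x))"

definition fun_cat ::
  "('o, 'a) cat \<Rightarrow> ('p, 'b) cat \<Rightarrow>
    (('o, 'a, 'p, 'b) cfun,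
     ('o, 'a, 'p, 'b) cfun \<times> ('o \<Rightarrow> 'b) \<times> ('o, 'a, 'p, 'b) cfun) cat" where
  "fun_cat C D =
     \<lparr>Ob = {F. is_functor C D F},
      Arr = {(F, \<tau>, H). nat_trans C D F H \<tau>},
      Dom = (\<lambda>(F, \<tau>, H). F),
      Cod = (\<lambda>(F, \<tau>, H). H),
      Ident = (\<lambda>F. (F, \<lambda>x\<in>Ob C. Ident D (fo F x), F)),
      Comp = (\<lambda>(_, \<sigma>, K) (F, \<tau>, _). (F, \<lambda>x\<in>Ob C. Comp D (\<sigma> x) (\<tau> x), K))\<rparr>"

definition is_equivalence ::
  "('o, 'a) cat \<Rightarrow> ('p, 'b) cat \<Rightarrow> ('o, 'a, 'p, 'b) cfun \<Rightarrow> bool" where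
  "is_equivalence C D F \<longleftrightarrow> is_functor C D F \<and>
     (\<exists>H \<eta> \<epsilon>. is_functor D C H \<and>
        nat_iso C C (id_functor C) (comp_functor C H F) \<eta> \<and>
        nat_iso D D (comp_functor D F H) (id_functor D) \<epsilon>)"

section \<open>Limits and colimits\<close>

definition is_cone ::
  "('i, 'j) cat \<Rightarrow> ('o, 'a) cat \<Rightarrow> ('i, 'j, 'o, 'a) cfun \<Rightarrow> 'o \<Rightarrow> ('i \<Rightarrow> 'a) \<Rightarrow> bool" where
  "is_cone J C D X \<pi> \<longleftrightarrow>
     X \<in> Ob C \<and> \<pi> \<in> extensional (Ob J) \<and>
     (\<forall>j \<in> Ob J. \<pi> j \<in> Hom C X (fo D j)) \<and>
     (\<forall>u \<in> Arr J. Comp C (fa D u) (\<pi> (Dom J u)) = \<pi> (Cod J u))"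

definition is_limit ::
  "('i, 'j) cat \<Rightarrow> ('o, 'a) cat \<Rightarrow> ('i, 'j, 'o, 'a) cfun \<Rightarrow> 'o \<Rightarrow> ('i \<Rightarrow> 'a) \<Rightarrow> bool" where
  "is_limit J C D X \<pi> \<longleftrightarrow> is_cone J C D X \<pi> \<and>
     (\<forall>Y \<rho>. is_cone J C D Y \<rho> \<longrightarrow>
        (\<exists>!h. h \<in> Hom C Y X \<and> (\<forall>j \<in> Ob J. Comp C (\<pi> j) h = \<rho> j)))"

definition is_cocone ::
  "('i, 'j) cat \<Rightarrow> ('o, 'a) cat \<Rightarrow> ('i, 'j, 'o, 'a) cfun \<Rightarrow> 'o \<Rightarrow> ('i \<Rightarrow> 'a) \<Rightarrow> bool" where
  "is_cocone J C D X \<iota> \<longleftrightarrow> is_cone (op J) (op C) D X \<iota>"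

definition is_colimit ::
  "('i, 'j) cat \<Rightarrow> ('o, 'a) cat \<Rightarrow> ('i, 'j, 'o, 'a) cfun \<Rightarrow> 'o \<Rightarrow> ('i \<Rightarrow> 'a) \<Rightarrow> bool" where
  "is_colimit J C D X \<iota> \<longleftrightarrow> is_limit (op J) (op C) D X \<iota>"

text \<open>Using one type \<open>'j\<close> for both objects and arrows of index categories loses nothing: objects
  can be replaced by their identity arrows.\<close>

definition small_diagram ::
  "'j rel \<Rightarrow> ('j, 'j) cat \<Rightarrow> ('o, 'a) cat \<Rightarrow> ('j, 'j, 'o, 'a) cfun \<Rightarrow> bool" where
  "small_diagram \<mu> J C D \<longleftrightarrow> |Ob J| <o \<mu> \<and> |Arr J| <o \<mu> \<and> is_functor J C D"

definition complete :: "'j rel \<Rightarrow> ('o, 'a) cat \<Rightarrow> bool" where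
  "complete \<mu> C \<longleftrightarrow> (\<forall>J D. small_diagram \<mu> J C D \<longrightarrow> (\<exists>X \<pi>. is_limit J C D X \<pi>))"

definition cocomplete :: "'j rel \<Rightarrow> ('o, 'a) cat \<Rightarrow> bool" where
  "cocomplete \<mu> C \<longleftrightarrow> (\<forall>J D. small_diagram \<mu> J C D \<longrightarrow> (\<exists>X \<iota>. is_colimit J C D X \<iota>))"

text \<open>Limits in \<open>C\<close> are computed by a family of functors \<open>E i\<close> from \<open>C\<close> to \<open>A\<close>: a cone is a limit
  cone if and only if all its images are.\<close>

definition limits_computed_by ::
  "'j rel \<Rightarrow> ('o, 'a) cat \<Rightarrow> ('p, 'b) cat \<Rightarrow> 'i set \<Rightarrow> ('i \<Rightarrow> ('o, 'a, 'p, 'b) cfun) \<Rightarrow> bool" where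
  "limits_computed_by \<mu> C A I E \<longleftrightarrow>
     (\<forall>i \<in> I. is_functor C A (E i)) \<and>
     (\<forall>J D X \<pi>. small_diagram \<mu> J C D \<and> is_cone J C D X \<pi> \<longrightarrow>
        (is_limit J C D X \<pi> \<longleftrightarrow>
          (\<forall>i \<in> I. is_limit J A (comp_functor J (E i) D) (fo (E i) X) (\<lambda>j\<in>Ob J. fa (E i) (\<pi> j)))))"

definition colimits_computed_by ::
  "'j rel \<Rightarrow> ('o, 'a) cat \<Rightarrow> ('p, 'b) cat \<Rightarrow> 'i set \<Rightarrow> ('i \<Rightarrow> ('o, 'a, 'p, 'b) cfun) \<Rightarrow> bool" where
  "colimits_computed_by \<mu> C A I E \<longleftrightarrow>
     (\<forall>i \<in> I. is_functor C A (E i)) \<and>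
     (\<forall>J D X \<iota>. small_diagram \<mu> J C D \<and> is_cocone J C D X \<iota> \<longrightarrow>
        (is_colimit J C D X \<iota> \<longleftrightarrow>
          (\<forall>i \<in> I. is_colimit J A (comp_functor J (E i) D) (fo (E i) X) (\<lambda>j\<in>Ob J. fa (E i) (\<iota> j)))))"

section \<open>Sets, pointed sets and monoids\<close>

text \<open>Size convention: a set is small if its cardinality is below \<open>\<kappa>\<close>, and an index category is
  small if it has fewer than \<open>\<mu>\<close> arrows; \<open>\<kappa>\<close> must be closed under the exponentials that bound the
  \<open>\<mu>\<close>-small limits of small sets. If \<open>\<kappa> = \<mu>\<close> is strongly inaccessible, small sets form a
  Grothendieck universe and \<open>\<mu>\<close>-completeness is completeness in the usual sense. HOL does not prove
  that uncountable inaccessibles exist, whereas it does provide pairs \<open>\<kappa>\<close>, \<open>\<mu>\<close> with \<open>\<mu>\<close>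
  arbitrarily large and \<open>\<kappa>\<close> arbitrarily large relative to \<open>\<mu>\<close>, e.g. the cardinal successors of
  the cardinals of \<open>('j \<times> nat + 'x) \<Rightarrow> bool\<close> and \<open>'j\<close>. Since \<open>\<kappa>\<close> is a cardinal on \<open>'u\<close>, every small
  set has an isomorphic copy among the subsets of \<open>'u\<close>.\<close>

definition universe :: "'u rel \<Rightarrow> 'j rel \<Rightarrow> bool" where
  "universe \<kappa> \<mu> \<longleftrightarrow> Cinfinite \<kappa> \<and> regularCard \<kappa> \<and> Card_order \<mu> \<and>
     (\<forall>(A :: 'u set) (I :: 'j set). |A| <o \<kappa> \<and> |I| <o \<mu> \<longrightarrow> |A| ^c |I| <o \<kappa>)"

definition set_cat :: "'u rel \<Rightarrow> ('a set, 'a set \<times> ('a \<Rightarrow> 'a) \<times> 'a set) cat" where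
  "set_cat \<kappa> =
     \<lparr>Ob = {A. |A| <o \<kappa>},
      Arr = {(A, f, B). |A| <o \<kappa> \<and> |B| <o \<kappa> \<and> f \<in> A \<rightarrow>\<^sub>E B},
      Dom = (\<lambda>(A, f, B). A),
      Cod = (\<lambda>(A, f, B). B),
      Ident = (\<lambda>A. (A, \<lambda>x\<in>A. x, A)),
      Comp = (\<lambda>(_, g, C) (A, f, _). (A, compose A g f, C))\<rparr>"

definition pset_cat ::
  "'u rel \<Rightarrow> ('a set \<times> 'a, ('a set \<times> 'a) \<times> ('a \<Rightarrow> 'a) \<times> ('a set \<times> 'a)) cat" where
  "pset_cat \<kappa> =
     \<lparr>Ob = {(A, a). |A| <o \<kappa> \<and> a \<in> A},
      Arr = {((A, a), f, (B, b)). |A| <o \<kappa> \<and> a \<in> A \<and> |B| <o \<kappa> \<and> b \<in> B \<and> f \<in> A \<rightarrow>\<^sub>E B \<and> f a = b},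
      Dom = (\<lambda>(P, f, Q). P),
      Cod = (\<lambda>(P, f, Q). Q),
      Ident = (\<lambda>(A, a). ((A, a), \<lambda>x\<in>A. x, (A, a))),
      Comp = (\<lambda>(_, g, Q) ((A, a), f, _). ((A, a), compose A g f, Q))\<rparr>"

definition mon_cat :: "'u rel \<Rightarrow> ('g monoid, 'g monoid \<times> ('g \<Rightarrow> 'g) \<times> 'g monoid) cat" where
  "mon_cat \<kappa> =
     \<lparr>Ob = {M. monoid M \<and> |carrier M| <o \<kappa>},
      Arr = {(M, f, N). monoid M \<and> |carrier M| <o \<kappa> \<and> monoid N \<and> |carrier N| <o \<kappa> \<and>
               f \<in> hom M N \<inter> extensional (carrier M) \<and> f \<one>\<^bsub>M\<^esub> = \<one>\<^bsub>N\<^esub>},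
      Dom = (\<lambda>(M, f, N). M),
      Cod = (\<lambda>(M, f, N). N),
      Ident = (\<lambda>M. (M, \<lambda>x\<in>carrier M. x, M)),
      Comp = (\<lambda>(_, g, N) (M, f, _). (M, compose (carrier M) g f, N))\<rparr>"

section \<open>Simplicial objects\<close>

text \<open>The object \<open>n\<close> of the simplex category stands for the ordinal \<open>{0..n}\<close>.\<close>

type_synonym op_arr = "nat \<times> (nat \<Rightarrow> nat) \<times> nat"

definition Delta :: "(nat, op_arr) cat" where
  "Delta =
     \<lparr>Ob = UNIV,
      Arr = {(m, \<alpha>, n). \<alpha> \<in> {0..m} \<rightarrow>\<^sub>E {0..n} \<and> mono_on {0..m} \<alpha>},
      Dom = (\<lambda>(m, \<alpha>, n). m),
      Cod = (\<lambda>(m, \<alpha>, n). n),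
      Ident = (\<lambda>n. (n, \<lambda>i\<in>{0..n}. i, n)),
      Comp = (\<lambda>(_, \<beta>, p) (m, \<alpha>, _). (m, compose {0..m} \<beta> \<alpha>, p))\<rparr>"

type_synonym 'a sset = "(nat, op_arr, 'a set, 'a set \<times> ('a \<Rightarrow> 'a) \<times> 'a set) cfun"

type_synonym 'g smonoid = "(nat, op_arr, 'g monoid, 'g monoid \<times> ('g \<Rightarrow> 'g) \<times> 'g monoid) cfun"

definition simplicial_set :: "'u rel \<Rightarrow> 'a sset \<Rightarrow> bool" where
  "simplicial_set \<kappa> X \<longleftrightarrow> is_functor (op Delta) (set_cat \<kappa>) X"

definition simplicial_monoid :: "'u rel \<Rightarrow> 'g smonoid \<Rightarrow> bool" where
  "simplicial_monoid \<kappa> G \<longleftrightarrow> is_functor (op Delta) (mon_cat \<kappa>) G"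

text \<open>\<open>smap X a\<close> is the underlying map of the structure map \<open>X(a)\<close> of a simplicial set or monoid.\<close>

definition smap ::
  "(nat, op_arr, 'o, 'o \<times> ('a \<Rightarrow> 'a) \<times> 'o) cfun \<Rightarrow> op_arr \<Rightarrow> 'a \<Rightarrow> 'a" where
  "smap X a = fst (snd (fa X a))"

record ('a, 'g) gsset =
  sset :: "'a sset"
  act :: "nat \<Rightarrow> 'a \<times> 'g \<Rightarrow> 'a"

abbreviation splx :: "('a, 'g) gsset \<Rightarrow> nat \<Rightarrow> 'a set" where
  "splx Y n \<equiv> fo (sset Y) n"

definition G_simplicial_set :: "'u rel \<Rightarrow> 'g smonoid \<Rightarrow> ('a, 'g) gsset \<Rightarrow> bool" where
  "G_simplicial_set \<kappa> G Y \<longleftrightarrow>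
     simplicial_set \<kappa> (sset Y) \<and>
     (\<forall>n. act Y n \<in> splx Y n \<times> carrier (fo G n) \<rightarrow>\<^sub>E splx Y n) \<and>
     (\<forall>n. \<forall>y \<in> splx Y n. act Y n (y, \<one>\<^bsub>fo G n\<^esub>) = y) \<and>
     (\<forall>n. \<forall>y \<in> splx Y n. \<forall>g \<in> carrier (fo G n). \<forall>h \<in> carrier (fo G n).
        act Y n (act Y n (y, g), h) = act Y n (y, g \<otimes>\<^bsub>fo G n\<^esub> h)) \<and>
     (\<forall>(m, \<alpha>, n) \<in> Arr Delta. \<forall>y \<in> splx Y n. \<forall>g \<in> carrier (fo G n).
        smap (sset Y) (m, \<alpha>, n) (act Y n (y, g)) =
        act Y m (smap (sset Y) (m, \<alpha>, n) y, smap G (m, \<alpha>, n) g))"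

definition G_map ::
  "'g smonoid \<Rightarrow> ('a, 'g) gsset \<Rightarrow> ('b, 'g) gsset \<Rightarrow> (nat \<Rightarrow> 'a \<Rightarrow> 'b) \<Rightarrow> bool" where
  "G_map G Y Z f \<longleftrightarrow>
     (\<forall>n. f n \<in> splx Y n \<rightarrow>\<^sub>E splx Z n) \<and>
     (\<forall>(m, \<alpha>, n) \<in> Arr Delta. \<forall>y \<in> splx Y n.
        f m (smap (sset Y) (m, \<alpha>, n) y) = smap (sset Z) (m, \<alpha>, n) (f n y)) \<and>
     (\<forall>n. \<forall>y \<in> splx Y n. \<forall>g \<in> carrier (fo G n). f n (act Y n (y, g)) = act Z n (f n y, g))"

section \<open>Equivariant retractive spaces\<close>

record ('u, 'g, 'w) retr =
  tot :: "('u, 'g) gsset"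
  ret :: "nat \<Rightarrow> 'u \<Rightarrow> 'w"
  sec :: "nat \<Rightarrow> 'w \<Rightarrow> 'u"

definition retractive_space ::
  "'u rel \<Rightarrow> 'g smonoid \<Rightarrow> ('w, 'g) gsset \<Rightarrow> ('u, 'g, 'w) retr \<Rightarrow> bool" where
  "retractive_space \<kappa> G W X \<longleftrightarrow>
     G_simplicial_set \<kappa> G (tot X) \<and> G_map G (tot X) W (ret X) \<and> G_map G W (tot X) (sec X) \<and>
     (\<forall>n. \<forall>w \<in> splx W n. ret X n (sec X n w) = w)"

definition retractive_map ::
  "'g smonoid \<Rightarrow> ('w, 'g) gsset \<Rightarrow> ('u, 'g, 'w) retr \<Rightarrow> (nat \<Rightarrow> 'u \<Rightarrow> 'u) \<Rightarrow> ('u, 'g, 'w) retr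
    \<Rightarrow> bool" where
  "retractive_map G W X f Z \<longleftrightarrow>
     G_map G (tot X) (tot Z) f \<and>
     (\<forall>n. \<forall>y \<in> splx (tot X) n. ret Z n (f n y) = ret X n y) \<and>
     (\<forall>n. \<forall>w \<in> splx W n. f n (sec X n w) = sec Z n w)"

definition retr_cat ::
  "'u rel \<Rightarrow> 'g smonoid \<Rightarrow> ('w, 'g) gsset \<Rightarrow>
    (('u, 'g, 'w) retr, ('u, 'g, 'w) retr \<times> (nat \<Rightarrow> 'u \<Rightarrow> 'u) \<times> ('u, 'g, 'w) retr) cat" where
  "retr_cat \<kappa> G W =
     \<lparr>Ob = {X. retractive_space \<kappa> G W X},
      Arr = {(X, f, Z). retractive_space \<kappa> G W X \<and> retractive_space \<kappa> G W Z \<and>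
               retractive_map G W X f Z},
      Dom = (\<lambda>(X, f, Z). X),
      Cod = (\<lambda>(X, f, Z). Z),
      Ident = (\<lambda>X. (X, \<lambda>n. \<lambda>y\<in>splx (tot X) n. y, X)),
      Comp = (\<lambda>(_, f', Z) (X, f, _). (X, \<lambda>n. compose (splx (tot X) n) (f' n) (f n), Z))\<rparr>"

section \<open>The equivariant simplex category and the fibre functor\<close>

type_synonym ('w, 'g) simp_arr = "(nat \<times> 'w) \<times> ((nat \<Rightarrow> nat) \<times> 'g) \<times> (nat \<times> 'w)"

definition Simp_cat ::
  "'g smonoid \<Rightarrow> ('w, 'g) gsset \<Rightarrow> (nat \<times> 'w, ('w, 'g) simp_arr) cat" where
  "Simp_cat G W =
     \<lparr>Ob = {(n, w). w \<in> splx W n},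
      Arr = {((m, v), (\<alpha>, g), (n, w)).
               v \<in> splx W m \<and> w \<in> splx W n \<and> (m, \<alpha>, n) \<in> Arr Delta \<and> g \<in> carrier (fo G m) \<and>
               v = act W m (smap (sset W) (m, \<alpha>, n) w, g)},
      Dom = (\<lambda>(x, a, y). x),
      Cod = (\<lambda>(x, a, y). y),
      Ident = (\<lambda>(n, w). ((n, w), (\<lambda>i\<in>{0..n}. i, \<one>\<^bsub>fo G n\<^esub>), (n, w))),
      Comp = (\<lambda>(_, (\<beta>, h), z) ((m, v), (\<alpha>, g), (n, _)).
               ((m, v), (compose {0..m} \<beta> \<alpha>, smap G (m, \<alpha>, n) h \<otimes>\<^bsub>fo G m\<^esub> g), z))\<rparr>"

definition fibre :: "('u, 'g, 'w) retr \<Rightarrow> nat \<times> 'w \<Rightarrow> 'u set \<times> 'u" where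
  "fibre X = (\<lambda>(n, w). ({y \<in> splx (tot X) n. ret X n y = w}, sec X n w))"

type_synonym ('u, 'g, 'w) ppresheaf =
  "(nat \<times> 'w, ('w, 'g) simp_arr, 'u set \<times> 'u, ('u set \<times> 'u) \<times> ('u \<Rightarrow> 'u) \<times> ('u set \<times> 'u)) cfun"

text \<open>A morphism \<open>(\<alpha>, g)\<close> from \<open>(m, v)\<close> to \<open>(n, w)\<close> sends \<open>y\<close> in the fibre over \<open>w\<close> to
  \<open>Y(\<alpha>)(y) \<cdot> g\<close> in the fibre over \<open>v\<close>.\<close>

definition fibre_presheaf ::
  "'g smonoid \<Rightarrow> ('w, 'g) gsset \<Rightarrow> ('u, 'g, 'w) retr \<Rightarrow> ('u, 'g, 'w) ppresheaf" where
  "fibre_presheaf G W X =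
     \<lparr>fo = \<lambda>c\<in>Ob (Simp_cat G W). fibre X c,
      fa = \<lambda>((m, v), (\<alpha>, g), (n, w))\<in>Arr (Simp_cat G W).
        (fibre X (n, w),
         \<lambda>y\<in>fst (fibre X (n, w)). act (tot X) m (smap (sset (tot X)) (m, \<alpha>, n) y, g),
         fibre X (m, v))\<rparr>"

definition fibre_functor ::
  "'u rel \<Rightarrow> 'g smonoid \<Rightarrow> ('w, 'g) gsset \<Rightarrow>
    (('u, 'g, 'w) retr, ('u, 'g, 'w) retr \<times> (nat \<Rightarrow> 'u \<Rightarrow> 'u) \<times> ('u, 'g, 'w) retr,
     ('u, 'g, 'w) ppresheaf,
     ('u, 'g, 'w) ppresheaf \<times>
       (nat \<times> 'w \<Rightarrow> ('u set \<times> 'u) \<times> ('u \<Rightarrow> 'u) \<times> ('u set \<times> 'u)) \<times>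
       ('u, 'g, 'w) ppresheaf) cfun" where
  "fibre_functor \<kappa> G W =
     \<lparr>fo = \<lambda>X\<in>Ob (retr_cat \<kappa> G W). fibre_presheaf G W X,
      fa = \<lambda>(X, f, Z)\<in>Arr (retr_cat \<kappa> G W).
        (fibre_presheaf G W X,
         \<lambda>(n, w)\<in>Ob (Simp_cat G W).
           (fibre X (n, w), \<lambda>y\<in>fst (fibre X (n, w)). f n y, fibre Z (n, w)),
         fibre_presheaf G W Z)\<rparr>"

definition eval_functor ::
  "('o, 'a) cat \<Rightarrow> ('p, 'b) cat \<Rightarrow> 'o \<Rightarrow>
    (('o, 'a, 'p, 'b) cfun,
     ('o, 'a, 'p, 'b) cfun \<times> ('o \<Rightarrow> 'b) \<times> ('o, 'a, 'p, 'b) cfun, 'p, 'b) cfun" where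
  "eval_functor C D c =
     \<lparr>fo = \<lambda>F\<in>Ob (fun_cat C D). fo F c, fa = \<lambda>(F, \<tau>, H)\<in>Arr (fun_cat C D). \<tau> c\<rparr>"

definition fibre_at ::
  "'u rel \<Rightarrow> 'g smonoid \<Rightarrow> ('w, 'g) gsset \<Rightarrow> nat \<times> 'w \<Rightarrow>
    (('u, 'g, 'w) retr, ('u, 'g, 'w) retr \<times> (nat \<Rightarrow> 'u \<Rightarrow> 'u) \<times> ('u, 'g, 'w) retr,
     'u set \<times> 'u, ('u set \<times> 'u) \<times> ('u \<Rightarrow> 'u) \<times> ('u set \<times> 'u)) cfun" where
  "fibre_at \<kappa> G W c =
     comp_functor (retr_cat \<kappa> G W) (eval_functor (op (Simp_cat G W)) (pset_cat \<kappa>) c)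
       (fibre_functor \<kappa> G W)"

end

(* A retractive space is the disjoint union of its fibres, and its simplicial structure and action
   are recorded by the maps y |-> Y(alpha)(y) g between fibres, i.e. by a presheaf on the equivariant
   simplex category; conversely, the disjoint union of the values of a pointed presheaf is a retractive
   space, small because kappa is regular. Hence the fibre functor is fully faithful and essentially
   surjective. Limits and colimits of presheaves are computed objectwise from those of pointed sets, and
   the property that a family of functors jointly creates limits transports along equivalences. *)

theory Submission
  imports Defs
begin

section \<open>Categories and functors\<close>

text \<open>Two constraints shape the proof. First, all pointed sets and total spaces have to be
  carried by subsets of the one type \<open>'u\<close>, whereas products, quotients and disjoint
  unions live on other types. So each construction is made where it naturally lives, shown to be
  small and copied back, and its legs and structure maps encode and decode along a bijection.
  Second, a presheaf sees an operator and a monoid element only together, as one arrow (a, g). The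
  two structures on a space Y are therefore merged into the single family y |-> Y(a)(y) g, whose one
  composition law replaces simpliciality, the action laws and their compatibility. Joint creation is
  taken in a form that yields existence and fibrewise computation together: some cone has limits as
  all its images, and every such cone is a limit. As limits are unique up to isomorphism, every
  limit cone then has this property. The condition makes sense for opposite categories too, so
  cocompleteness of pointed sets is the only fact about colimits that needs its own
  construction.\<close>

lemma op_sel [simp]:
  "Ob (op C) = Ob C" "Arr (op C) = Arr C" "Dom (op C) = Cod C" "Cod (op C) = Dom C"
  "Ident (op C) = Ident C" "Comp (op C) g f = Comp C f g" "op (op C) = C"
  by (simp_all add: op_def)

lemma Hom_op [simp]: "Hom (op C) x y = Hom C y x"
  by (auto simp: Hom_def)

lemma is_iso_op [simp]: "is_iso (op C) f = is_iso C f"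
  by (auto simp: is_iso_def)

lemma category_op: "category C \<Longrightarrow> category (op C)"
  by (rule category.intro) (auto intro: category.intro category.Dom_in category.Cod_in category.Ident_in
    category.Dom_Ident category.Cod_Ident category.Comp_in category.Dom_Comp category.Cod_Comp
    category.Comp_Ident_right category.Comp_Ident_left category.Comp_assoc[symmetric])

lemma category_op_iff [simp]: "category (op C) = category C"
  by (metis category_op op_sel(7))

context category
begin

lemma comp_Hom: "\<lbrakk>f \<in> Hom C x y; g \<in> Hom C y z\<rbrakk> \<Longrightarrow> Comp C g f \<in> Hom C x z"
  by (auto simp: Hom_def Comp_in Dom_Comp Cod_Comp)

lemma assoc_Hom: "\<lbrakk>f \<in> Hom C w x; g \<in> Hom C x y; h \<in> Hom C y z\<rbrakk>
    \<Longrightarrow> Comp C h (Comp C g f) = Comp C (Comp C h g) f"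
  by (auto simp: Hom_def Comp_assoc)

lemma id_Hom: "x \<in> Ob C \<Longrightarrow> Ident C x \<in> Hom C x x"
  by (auto simp: Hom_def Ident_in Dom_Ident Cod_Ident)

lemma id_left: "f \<in> Hom C x y \<Longrightarrow> Comp C (Ident C y) f = f"
  using Comp_Ident_left by (auto simp: Hom_def)

lemma id_right: "f \<in> Hom C x y \<Longrightarrow> Comp C f (Ident C x) = f"
  using Comp_Ident_right by (auto simp: Hom_def)

lemma Hom_Ob: "f \<in> Hom C x y \<Longrightarrow> x \<in> Ob C \<and> y \<in> Ob C"
  by (auto simp: Hom_def Dom_in Cod_in)

lemma iso_inverse:
  assumes "is_iso C u" "u \<in> Hom C x y"
  obtains v where "v \<in> Hom C y x" "Comp C v u = Ident C x" "Comp C u v = Ident C y" "is_iso C v"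
  using assms by (force simp: is_iso_def Hom_def)

lemma is_isoI:
  "\<lbrakk>u \<in> Hom C x y; v \<in> Hom C y x; Comp C v u = Ident C x; Comp C u v = Ident C y\<rbrakk> \<Longrightarrow> is_iso C u"
  by (auto simp: is_iso_def Hom_def)

end

lemma Arr_Hom: "f \<in> Arr C \<Longrightarrow> f \<in> Hom C (Dom C f) (Cod C f)"
  by (simp add: Hom_def)

context is_functor
begin

lemma fo_Ob: "x \<in> Ob C \<Longrightarrow> fo F x \<in> Ob D"
  using fo_in by auto

lemma fa_Hom: "f \<in> Hom C x y \<Longrightarrow> fa F f \<in> Hom D (fo F x) (fo F y)"
  using fa_in by (auto simp: Hom_def)

lemma fa_Comp_Hom: "\<lbrakk>f \<in> Hom C x y; g \<in> Hom C y z\<rbrakk> \<Longrightarrow> fa F (Comp C g f) = Comp D (fa F g) (fa F f)"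
  by (auto simp: Hom_def intro: fa_Comp)

end

lemma is_functor_op: "is_functor C D F \<Longrightarrow> is_functor (op C) (op D) F"
  unfolding is_functor_def is_functor_axioms_def by (auto simp: Pi_iff)

lemma is_functor_op_iff [simp]: "is_functor (op C) (op D) F = is_functor C D F"
  by (metis is_functor_op op_sel(7))

lemma is_functor_id: "category C \<Longrightarrow> is_functor C C (id_functor C)"
  by (auto simp: is_functor_def is_functor_axioms_def id_functor_def Arr_Hom category.Dom_in category.Cod_in
    category.Ident_in category.Comp_in)

lemma is_functor_comp:
  assumes "is_functor C D F" "is_functor D E K"
  shows "is_functor C E (comp_functor C K F)"
proof -
  interpret F: is_functor C D F by fact
  interpret K: is_functor D E K by fact
  show ?thesis
    unfolding is_functor_def is_functor_axioms_def comp_functor_def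
    using F.dom.category_axioms K.cod.category_axioms
    by (auto simp: F.fo_Ob K.fo_Ob F.dom.Dom_in F.dom.Cod_in F.dom.Ident_in F.dom.Comp_in
      F.fa_Ident K.fa_Ident F.fa_Comp_Hom[OF Arr_Hom] intro!: K.fa_Hom F.fa_in)
      (metis Arr_Hom F.fa_Comp F.fa_in K.fa_Comp_Hom)
qed

lemma comp_functor_sel [simp]:
  "x \<in> Ob C \<Longrightarrow> fo (comp_functor C K F) x = fo K (fo F x)"
  "f \<in> Arr C \<Longrightarrow> fa (comp_functor C K F) f = fa K (fa F f)"
  by (simp_all add: comp_functor_def)

lemma comp_functor_op [simp]: "comp_functor (op C) K F = comp_functor C K F"
  by (simp add: comp_functor_def)

text \<open>Holds on the nose: \<open>F\<close> lands in \<open>C\<close>, so the restriction built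
  into \<open>comp_functor C L K\<close> is invisible on its values.\<close>

lemma comp_functor_assoc:
  assumes "is_functor B C F"
  shows "comp_functor B (comp_functor C L K) F = comp_functor B L (comp_functor B K F)"
proof -
  interpret F: is_functor B C F by fact
  have "x \<in> Arr B \<Longrightarrow> fa F x \<in> Arr C" for x using F.fa_in by (auto simp: Hom_def)
  then show ?thesis
    by (auto simp: comp_functor_def F.fo_Ob restrict_def fun_eq_iff)
qed

subsection \<open>Functor categories\<close>

lemma fun_cat_sel [simp]:
  "F \<in> Ob (fun_cat C D) \<longleftrightarrow> is_functor C D F"
  "(F, \<tau>, H) \<in> Arr (fun_cat C D) \<longleftrightarrow> nat_trans C D F H \<tau>"
  "Dom (fun_cat C D) = fst" "Cod (fun_cat C D) t = snd (snd t)"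
  "Ident (fun_cat C D) F = (F, \<lambda>x\<in>Ob C. Ident D (fo F x), F)"
  "Comp (fun_cat C D) (H, \<sigma>, K) (F, \<tau>, H') = (F, \<lambda>x\<in>Ob C. Comp D (\<sigma> x) (\<tau> x), K)"
  by (auto simp: fun_cat_def split: prod.split)

lemma nat_trans_Hom: "nat_trans C D F H \<tau> \<Longrightarrow> x \<in> Ob C \<Longrightarrow> \<tau> x \<in> Hom D (fo F x) (fo H x)"
  by (simp add: nat_trans_def)

lemma nat_trans_nat:
  "nat_trans C D F H \<tau> \<Longrightarrow> f \<in> Hom C x y \<Longrightarrow> Comp D (\<tau> y) (fa F f) = Comp D (fa H f) (\<tau> x)"
  by (auto simp: nat_trans_def Hom_def)

lemma nat_transI:
  assumes "is_functor C D F" "is_functor C D H" "\<tau> \<in> extensional (Ob C)"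
    "\<And>x. x \<in> Ob C \<Longrightarrow> \<tau> x \<in> Hom D (fo F x) (fo H x)"
    "\<And>f x y. f \<in> Hom C x y \<Longrightarrow> x \<in> Ob C \<Longrightarrow> y \<in> Ob C \<Longrightarrow> Comp D (\<tau> y) (fa F f) = Comp D (fa H f) (\<tau> x)"
  shows "nat_trans C D F H \<tau>"
  unfolding nat_trans_def using assms
  by (auto simp: Arr_Hom is_functor_def category.Dom_in category.Cod_in)

lemma nat_trans_comp:
  assumes "nat_trans C D F H \<tau>" "nat_trans C D H K \<sigma>"
  shows "nat_trans C D F K (\<lambda>x\<in>Ob C. Comp D (\<sigma> x) (\<tau> x))"
proof (rule nat_transI)
  interpret F: is_functor C D F using assms by (simp add: nat_trans_def)
  interpret H: is_functor C D H using assms by (simp add: nat_trans_def)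
  interpret K: is_functor C D K using assms by (simp add: nat_trans_def)
  show "is_functor C D F" "is_functor C D K" ..
  note * = nat_trans_Hom[OF assms(1)] nat_trans_Hom[OF assms(2)]
  show "(\<lambda>x\<in>Ob C. Comp D (\<sigma> x) (\<tau> x)) x \<in> Hom D (fo F x) (fo K x)" if "x \<in> Ob C" for x
    using that by (auto intro: F.cod.comp_Hom *)
  fix f x y assume f: "f \<in> Hom C x y" and xy: "x \<in> Ob C" "y \<in> Ob C"
  have "Comp D (Comp D (\<sigma> y) (\<tau> y)) (fa F f) = Comp D (\<sigma> y) (Comp D (fa H f) (\<tau> x))"
    using F.cod.assoc_Hom[OF F.fa_Hom[OF f] *(1)[OF xy(2)] *(2)[OF xy(2)]]
    by (simp add: nat_trans_nat[OF assms(1) f])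
  also have "\<dots> = Comp D (Comp D (fa K f) (\<sigma> x)) (\<tau> x)"
    using F.cod.assoc_Hom[OF *(1)[OF xy(1)] H.fa_Hom[OF f] *(2)[OF xy(2)]]
    by (simp add: nat_trans_nat[OF assms(2) f])
  also have "\<dots> = Comp D (fa K f) (Comp D (\<sigma> x) (\<tau> x))"
    using F.cod.assoc_Hom[OF *(1)[OF xy(1)] *(2)[OF xy(1)] K.fa_Hom[OF f]] by simp
  finally show "Comp D ((\<lambda>x\<in>Ob C. Comp D (\<sigma> x) (\<tau> x)) y) (fa F f)
      = Comp D (fa K f) ((\<lambda>x\<in>Ob C. Comp D (\<sigma> x) (\<tau> x)) x)" using xy by simp
qed simp

lemma nat_trans_id:
  assumes "is_functor C D F"
  shows "nat_trans C D F F (\<lambda>x\<in>Ob C. Ident D (fo F x))"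
proof -
  interpret F: is_functor C D F by fact
  show ?thesis
    by (rule nat_transI) (auto simp: assms F.cod.id_Hom F.fo_Ob
        F.cod.id_left[OF F.fa_Hom] F.cod.id_right[OF F.fa_Hom])
qed

text \<open>Composites are restricted to \<open>Ob C\<close>; the unit laws are equalities of
  functions because natural transformations are extensional.\<close>

lemma category_fun_cat:
  assumes "category D"
  shows "category (fun_cat C D)"
proof -
  interpret D: category D by fact
  show ?thesis
  proof
    fix t assume "t \<in> Arr (fun_cat C D)"
    then obtain F \<tau> H where t: "t = (F, \<tau>, H)" "nat_trans C D F H \<tau>" by (cases t) auto
    then have ex: "\<tau> \<in> extensional (Ob C)" by (simp add: nat_trans_def)
    show "Dom (fun_cat C D) t \<in> Ob (fun_cat C D)" "Cod (fun_cat C D) t \<in> Ob (fun_cat C D)"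
      using t by (auto simp: nat_trans_def)
    show "Comp (fun_cat C D) t (Ident (fun_cat C D) (Dom (fun_cat C D) t)) = t"
      "Comp (fun_cat C D) (Ident (fun_cat C D) (Cod (fun_cat C D) t)) t = t"
      using t ex by (auto simp: D.id_left[OF nat_trans_Hom[OF t(2)]] D.id_right[OF nat_trans_Hom[OF t(2)]]
        intro!: extensionalityI[OF _ ex])
    fix s assume "s \<in> Arr (fun_cat C D)" "Dom (fun_cat C D) s = Cod (fun_cat C D) t"
    then obtain \<sigma> K where s: "s = (H, \<sigma>, K)" "nat_trans C D H K \<sigma>" using t by (cases s) auto
    show "Comp (fun_cat C D) s t \<in> Arr (fun_cat C D)" 
      "Dom (fun_cat C D) (Comp (fun_cat C D) s t) = Dom (fun_cat C D) t"
      "Cod (fun_cat C D) (Comp (fun_cat C D) s t) = Cod (fun_cat C D) s"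
      using s t by (auto intro: nat_trans_comp)
    fix r assume "r \<in> Arr (fun_cat C D)" "Dom (fun_cat C D) r = Cod (fun_cat C D) s"
    then obtain \<rho> L where r: "r = (K, \<rho>, L)" "nat_trans C D K L \<rho>" using s by (cases r) auto
    show "Comp (fun_cat C D) r (Comp (fun_cat C D) s t) = Comp (fun_cat C D) (Comp (fun_cat C D) r s) t"
      using t s r by (auto simp: restrict_def fun_eq_iff intro!: D.assoc_Hom dest: nat_trans_Hom)
  qed (auto simp: nat_trans_id)
qed

text \<open>Objectwise inverses are automatically natural. This turns an objectwise isomorphism of
  presheaves into an isomorphism of the functor category, as essential surjectivity
  requires.\<close>

lemma nat_iso_is_iso:
  assumes "nat_iso C D F H \<tau>"
  shows "is_iso (fun_cat C D) (F, \<tau>, H)"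
proof -
  have \<tau>: "nat_trans C D F H \<tau>" and iso: "\<And>x. x \<in> Ob C \<Longrightarrow> is_iso D (\<tau> x)"
    using assms by (auto simp: nat_iso_def)
  interpret F: is_functor C D F using \<tau> by (simp add: nat_trans_def)
  interpret H: is_functor C D H using \<tau> by (simp add: nat_trans_def)
  have "\<exists>v. v \<in> Hom D (fo H x) (fo F x) \<and> Comp D v (\<tau> x) = Ident D (fo F x) \<and>
      Comp D (\<tau> x) v = Ident D (fo H x)" if "x \<in> Ob C" for x
    using F.cod.iso_inverse[OF iso nat_trans_Hom[OF \<tau>]] that by metis
  then obtain v where v: "\<And>x. x \<in> Ob C \<Longrightarrow> v x \<in> Hom D (fo H x) (fo F x)"
      "\<And>x. x \<in> Ob C \<Longrightarrow> Comp D (v x) (\<tau> x) = Ident D (fo F x)"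
      "\<And>x. x \<in> Ob C \<Longrightarrow> Comp D (\<tau> x) (v x) = Ident D (fo H x)" by metis
  note hom = nat_trans_Hom[OF \<tau>] v(1) F.fa_Hom H.fa_Hom F.cod.comp_Hom
  let ?v = "\<lambda>x\<in>Ob C. v x"
  have inv: "nat_trans C D H F ?v"
  proof (rule nat_transI)
    fix f x y assume f: "f \<in> Hom C x y" and xy: "x \<in> Ob C" "y \<in> Ob C"
    \<comment> \<open>Insert the identity \<open>\<tau> x\<close> after \<open>v x\<close>, apply
      naturality of \<open>\<tau>\<close>, and cancel \<open>v y\<close> against
      \<open>\<tau> y\<close>.\<close>
    have "Comp D (v y) (fa H f) = Comp D (v y) (Comp D (fa H f) (Comp D (\<tau> x) (v x)))"
      by (simp add: v(3) xy F.cod.id_right[OF H.fa_Hom[OF f]])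
    also have "\<dots> = Comp D (v y) (Comp D (Comp D (\<tau> y) (fa F f)) (v x))"
      by (subst F.cod.assoc_Hom) (use xy f in \<open>auto intro: hom simp: nat_trans_nat[OF \<tau> f]\<close>)
    also have "\<dots> = Comp D (Comp D (Comp D (v y) (\<tau> y)) (fa F f)) (v x)"
      using F.cod.assoc_Hom[OF F.fa_Hom[OF f] hom(1) v(1)] xy
        F.cod.assoc_Hom[OF v(1) F.cod.comp_Hom[OF F.fa_Hom[OF f] hom(1)] v(1)] by simp
    also have "\<dots> = Comp D (fa F f) (v x)"
      by (simp add: v(2) xy F.cod.id_left[OF F.fa_Hom[OF f]])
    finally show "Comp D (?v y) (fa H f) = Comp D (fa F f) (?v x)" using xy by simp
  qed (use v(1) in \<open>auto simp: F.is_functor_axioms H.is_functor_axioms\<close>)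
  interpret FC: category "fun_cat C D" by (rule category_fun_cat) unfold_locales
  show ?thesis
    by (rule FC.is_isoI[where v="(H, ?v, F)"])
      (use \<tau> inv v in \<open>auto simp: Hom_def intro!: restrict_ext\<close>)
qed

subsection \<open>Fully faithful and essentially surjective functors\<close>

definition fully_faithful :: "('o, 'a) cat \<Rightarrow> ('p, 'b) cat \<Rightarrow> ('o, 'a, 'p, 'b) cfun \<Rightarrow> bool" where
  "fully_faithful C D F \<longleftrightarrow>
     (\<forall>x \<in> Ob C. \<forall>y \<in> Ob C. bij_betw (fa F) (Hom C x y) (Hom D (fo F x) (fo F y)))"

definition ess_surjective :: "('o, 'a) cat \<Rightarrow> ('p, 'b) cat \<Rightarrow> ('o, 'a, 'p, 'b) cfun \<Rightarrow> bool" where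
  "ess_surjective C D F \<longleftrightarrow>
     (\<forall>d \<in> Ob D. \<exists>c \<in> Ob C. \<exists>u \<in> Hom D (fo F c) d. is_iso D u)"

text \<open>Both conditions are checked without a quasi-inverse and pass to opposite categories, so
  the equivalence and the transport of limits and of colimits all start from this
  characterization.\<close>

locale ff_eso_functor = is_functor +
  assumes ff: "fully_faithful C D F" and eso: "ess_surjective C D F"
begin

lemma faithful:
  "\<lbrakk>f \<in> Hom C x y; g \<in> Hom C x y; fa F f = fa F g\<rbrakk> \<Longrightarrow> f = g"
  using ff dom.Hom_Ob[of f x y] by (auto simp: fully_faithful_def bij_betw_def dest: inj_onD)

lemma full:
  assumes "k \<in> Hom D (fo F x) (fo F y)" "x \<in> Ob C" "y \<in> Ob C"
  obtains f where "f \<in> Hom C x y" "fa F f = k"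
proof -
  have "k \<in> fa F ` Hom C x y"
    using assms(1-3) ff by (simp add: fully_faithful_def bij_betw_def)
  then show thesis using that by blast
qed

lemma equivalence: "is_equivalence C D F"
proof -
  obtain c where c': "\<forall>d\<in>Ob D. c d \<in> Ob C \<and> (\<exists>u\<in>Hom D (fo F (c d)) d. is_iso D u)"
    using eso bchoice[of "Ob D" "\<lambda>d c. c \<in> Ob C \<and> (\<exists>u\<in>Hom D (fo F c) d. is_iso D u)"]
    unfolding ess_surjective_def Bex_def by blast
  then obtain u where u': "\<forall>d\<in>Ob D. u d \<in> Hom D (fo F (c d)) d \<and> is_iso D (u d)"
    using bchoice[of "Ob D" "\<lambda>d u. u \<in> Hom D (fo F (c d)) d \<and> is_iso D u"] by blast
  have "\<forall>d\<in>Ob D. \<exists>v. v \<in> Hom D d (fo F (c d)) \<and>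
      Comp D v (u d) = Ident D (fo F (c d)) \<and> Comp D (u d) v = Ident D d"
    using u' cod.iso_inverse by metis
  then obtain v where v': "\<forall>d\<in>Ob D. v d \<in> Hom D d (fo F (c d)) \<and>
      Comp D (v d) (u d) = Ident D (fo F (c d)) \<and> Comp D (u d) (v d) = Ident D d"
    using bchoice[of "Ob D" "\<lambda>d v. v \<in> Hom D d (fo F (c d)) \<and>
      Comp D v (u d) = Ident D (fo F (c d)) \<and> Comp D (u d) v = Ident D d"] by blast
  have c: "\<And>d. d \<in> Ob D \<Longrightarrow> c d \<in> Ob C"
    and u: "\<And>d. d \<in> Ob D \<Longrightarrow> u d \<in> Hom D (fo F (c d)) d"
    and v: "\<And>d. d \<in> Ob D \<Longrightarrow> v d \<in> Hom D d (fo F (c d))"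
    and vu: "\<And>d. d \<in> Ob D \<Longrightarrow> Comp D (v d) (u d) = Ident D (fo F (c d))"
    and uv: "\<And>d. d \<in> Ob D \<Longrightarrow> Comp D (u d) (v d) = Ident D d"
    and iso: "\<And>d. d \<in> Ob D \<Longrightarrow> is_iso D (u d)"
    using c' u' v' by blast+
  \<comment> \<open>\<open>P\<close> picks preimages by fullness. \<open>B k\<close> is
    \<open>k\<close> conjugated by the chosen isomorphisms \<open>u\<close>, so a quasi-inverse has
    to send \<open>k\<close> to a preimage of \<open>B k\<close>.\<close>
  define P where "P x y k = inv_into (Hom C x y) (fa F) k" for x y k
  have P: "P x y k \<in> Hom C x y \<and> fa F (P x y k) = k"
    if "k \<in> Hom D (fo F x) (fo F y)" "x \<in> Ob C" "y \<in> Ob C" for x y k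
    using full[OF that] unfolding P_def by (metis f_inv_into_f imageI inv_into_into)
  define B where "B k = Comp D (v (Cod D k)) (Comp D k (u (Dom D k)))" for k
  define H where "H = \<lparr>fo = \<lambda>d\<in>Ob D. c d, fa = \<lambda>k\<in>Arr D. P (c (Dom D k)) (c (Cod D k)) (B k)\<rparr>"
  have Hc: "fo H d = c d" if "d \<in> Ob D" for d using that by (simp add: H_def)
  have B: "B k \<in> Hom D (fo F (c x)) (fo F (c y))" "Comp D (u y) (B k) = Comp D k (u x)"
    if k: "k \<in> Hom D x y" for k x y
  proof -
    have xy: "x \<in> Ob D" "y \<in> Ob D" using cod.Hom_Ob[OF k] by auto
    have Bk: "B k = Comp D (v y) (Comp D k (u x))" using k by (simp add: B_def Hom_def)
    show "B k \<in> Hom D (fo F (c x)) (fo F (c y))"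
      unfolding Bk using k xy u v by (blast intro: cod.comp_Hom)
    have ku: "Comp D k (u x) \<in> Hom D (fo F (c x)) y" using k xy u by (blast intro: cod.comp_Hom)
    show "Comp D (u y) (B k) = Comp D k (u x)"
      unfolding Bk using cod.assoc_Hom[OF ku v[OF xy(2)] u[OF xy(2)]] uv[OF xy(2)] cod.id_left[OF ku]
      by simp
  qed
  have Ha: "fa H k \<in> Hom C (c x) (c y)" "fa F (fa H k) = B k" if "k \<in> Hom D x y" for k x y
    using P[OF B(1)[OF that]] cod.Hom_Ob[OF that] c that by (auto simp: H_def Hom_def)
  \<comment> \<open>\<open>u y\<close> has the left inverse \<open>v y\<close>, hence is monic:
    equations between arrows into its source are tested after composing with it.\<close>
  have cancel: "k = l" if "k \<in> Hom D z (fo F (c y))" "l \<in> Hom D z (fo F (c y))"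
      "Comp D (u y) k = Comp D (u y) l" "y \<in> Ob D" for k l y z
    using that cod.assoc_Hom[OF that(1) u v] cod.assoc_Hom[OF that(2) u v] vu cod.id_left
    by metis
  \<comment> \<open>By faithfulness, \<open>fa H k\<close> is the only arrow whose image makes the
    square with the two \<open>u\<close> commute. Both functor laws for \<open>H\<close> follow by
    verifying this square.\<close>
  have Heq: "fa H k = m" if k: "k \<in> Hom D x y" and m: "m \<in> Hom C (c x) (c y)"
    "Comp D (u y) (fa F m) = Comp D k (u x)" for k m x y
    using cancel[of "fa F m" "fo F (c x)" y "B k"] B[OF k] Ha[OF k] fa_Hom[OF m(1)] m cod.Hom_Ob[OF k] faithful
    by metis
  have H: "is_functor D C H"
  proof
    show "fo H \<in> Ob D \<rightarrow>\<^sub>E Ob C" using c by (auto simp: H_def)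
    show "fa H \<in> extensional (Arr D)" by (simp add: H_def)
    show "fa H f \<in> Hom C (fo H (Dom D f)) (fo H (Cod D f))" if "f \<in> Arr D" for f
      using Ha(1)[OF Arr_Hom[OF that]] that by (simp add: Hc cod.Dom_in cod.Cod_in)
    show "fa H (Ident D x) = Ident C (fo H x)" if x: "x \<in> Ob D" for x
      using Heq[OF cod.id_Hom[OF x] dom.id_Hom[OF c[OF x]]] u[OF x]
      by (simp add: Hc x fa_Ident c cod.id_left cod.id_right)
    show "fa H (Comp D g f) = Comp C (fa H g) (fa H f)"
      if gf: "f \<in> Arr D" "g \<in> Arr D" "Dom D g = Cod D f" for f g
    proof -
      obtain x y z where f: "f \<in> Hom D x y" and g: "g \<in> Hom D y z"
        using gf unfolding Hom_def by blast
      have ob: "x \<in> Ob D" "y \<in> Ob D" "z \<in> Ob D" using f g cod.Hom_Ob by auto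
      have "Comp D (u z) (Comp D (B g) (B f)) = Comp D (Comp D g f) (u x)"
        using cod.assoc_Hom[OF B(1)[OF f] B(1)[OF g] u[OF ob(3)]] B(2)[OF f] B(2)[OF g]
          cod.assoc_Hom[OF B(1)[OF f] u[OF ob(2)] g] cod.assoc_Hom[OF u[OF ob(1)] f g] by simp
      then show ?thesis
        using Heq[OF cod.comp_Hom[OF f g] dom.comp_Hom[OF Ha(1)[OF f] Ha(1)[OF g]]]
          fa_Comp_Hom[OF Ha(1)[OF f] Ha(1)[OF g]] Ha(2)[OF f] Ha(2)[OF g] by simp
    qed
  qed
  \<comment> \<open>The unit at \<open>x\<close> is a preimage of the inverse \<open>v\<close> of
    the counit at \<open>F x\<close>; its own inverse is then a preimage of
    \<open>u\<close>.\<close>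
  define \<eta> where "\<eta> = (\<lambda>x\<in>Ob C. P x (c (fo F x)) (v (fo F x)))"
  have \<eta>: "\<eta> x \<in> Hom C x (c (fo F x))" "fa F (\<eta> x) = v (fo F x)" if "x \<in> Ob C" for x
    using P[OF v] that c fo_Ob by (auto simp: \<eta>_def)
  have \<eta>_iso: "is_iso C (\<eta> x)" if x: "x \<in> Ob C" for x
  proof -
    have x': "fo F x \<in> Ob D" "c (fo F x) \<in> Ob C" using x fo_Ob c by auto
    obtain m where m: "m \<in> Hom C (c (fo F x)) x" "fa F m = u (fo F x)"
      using full[OF u[OF x'(1)] x'(2) x] .
    have "Comp C m (\<eta> x) = Ident C x"
      using faithful[OF dom.comp_Hom[OF \<eta>(1)[OF x] m(1)] dom.id_Hom[OF x]]
      by (simp add: fa_Comp_Hom[OF \<eta>(1)[OF x] m(1)] m(2) \<eta>(2)[OF x] uv x' fa_Ident x)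
    moreover have "Comp C (\<eta> x) m = Ident C (c (fo F x))"
      using faithful[OF dom.comp_Hom[OF m(1) \<eta>(1)[OF x]] dom.id_Hom[OF x'(2)]]
      by (simp add: fa_Comp_Hom[OF m(1) \<eta>(1)[OF x]] m(2) \<eta>(2)[OF x] vu x' fa_Ident)
    ultimately show ?thesis using dom.is_isoI \<eta>(1)[OF x] m(1) by metis
  qed
  have "nat_iso C C (id_functor C) (comp_functor C H F) \<eta>"
    unfolding nat_iso_def
  proof (intro conjI ballI \<eta>_iso nat_transI)
    fix f x y assume f: "f \<in> Hom C x y" and xy: "x \<in> Ob C" "y \<in> Ob C"
    note Ff = fa_Hom[OF f] and ob = fo_Ob[OF xy(1)] fo_Ob[OF xy(2)]
    \<comment> \<open>The image of the naturality square is tested after the monic \<open>u\<close>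
      at \<open>F y\<close>, and faithfulness then pulls it back to \<open>C\<close>.\<close>
    have "Comp D (v (fo F y)) (fa F f) = Comp D (B (fa F f)) (v (fo F x))"
    proof (rule cancel[where z="fo F x" and y="fo F y"])
      have "Comp D (u (fo F y)) (Comp D (B (fa F f)) (v (fo F x))) = fa F f"
        using cod.assoc_Hom[OF v[OF ob(1)] B(1)[OF Ff] u[OF ob(2)]] B(2)[OF Ff]
          cod.assoc_Hom[OF v[OF ob(1)] u[OF ob(1)] Ff] uv[OF ob(1)] cod.id_right[OF Ff] by simp
      then show "Comp D (u (fo F y)) (Comp D (v (fo F y)) (fa F f)) =
          Comp D (u (fo F y)) (Comp D (B (fa F f)) (v (fo F x)))"
        using cod.assoc_Hom[OF Ff v[OF ob(2)] u[OF ob(2)]] uv[OF ob(2)] cod.id_left[OF Ff] by simp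
    qed (use Ff ob v B(1)[OF Ff] in \<open>blast intro: cod.comp_Hom\<close>)+
    then have "Comp C (\<eta> y) f = Comp C (fa H (fa F f)) (\<eta> x)"
      using faithful[OF dom.comp_Hom[OF f \<eta>(1)[OF xy(2)]] dom.comp_Hom[OF \<eta>(1)[OF xy(1)] Ha(1)[OF Ff]]]
      by (simp add: fa_Comp_Hom[OF f \<eta>(1)[OF xy(2)]] fa_Comp_Hom[OF \<eta>(1)[OF xy(1)] Ha(1)[OF Ff]]
          \<eta>(2) xy Ha(2)[OF Ff])
    then show "Comp C (\<eta> y) (fa (id_functor C) f) = Comp C (fa (comp_functor C H F) f) (\<eta> x)"
      using f by (simp add: id_functor_def Hom_def)
  next
    show "\<eta> \<in> extensional (Ob C)" by (simp add: \<eta>_def)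
    show "is_functor C C (id_functor C)" by (rule is_functor_id) unfold_locales
    show "is_functor C C (comp_functor C H F)" by (rule is_functor_comp[OF is_functor_axioms H])
    show "\<eta> x \<in> Hom C (fo (id_functor C) x) (fo (comp_functor C H F) x)" if "x \<in> Ob C" for x
      using \<eta>(1)[OF that] that fo_Ob by (simp add: id_functor_def Hc)
  qed
  moreover have "nat_iso D D (comp_functor D F H) (id_functor D) (\<lambda>d\<in>Ob D. u d)"
    unfolding nat_iso_def
  proof (intro conjI ballI nat_transI)
    show "is_functor D D (id_functor D)" by (rule is_functor_id) unfold_locales
    show "is_functor D D (comp_functor D F H)" by (rule is_functor_comp[OF H is_functor_axioms])
    show "is_iso D (restrict u (Ob D) x)" if "x \<in> Ob D" for x using that iso by simp
    show "restrict u (Ob D) x \<in> Hom D (fo (comp_functor D F H) x) (fo (id_functor D) x)"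
      if "x \<in> Ob D" for x
      using u[OF that] that by (simp add: id_functor_def Hc)
    fix f x y assume f: "f \<in> Hom D x y" and xy: "x \<in> Ob D" "y \<in> Ob D"
    have fA: "f \<in> Arr D" using f by (simp add: Hom_def)
    show "Comp D (restrict u (Ob D) y) (fa (comp_functor D F H) f) =
          Comp D (fa (id_functor D) f) (restrict u (Ob D) x)"
      using B(2)[OF f] fA xy Ha(2)[OF f] by (simp add: id_functor_def)
  qed simp
  ultimately show ?thesis unfolding is_equivalence_def using H is_functor_axioms by blast
qed

end

section \<open>Limits\<close>

lemma is_cone_Hom: "is_cone J C D X \<pi> \<Longrightarrow> j \<in> Ob J \<Longrightarrow> \<pi> j \<in> Hom C X (fo D j)"
  by (simp add: is_cone_def)

lemma is_cone_commute: "is_cone J C D X \<pi> \<Longrightarrow> u \<in> Hom J j k \<Longrightarrow> Comp C (fa D u) (\<pi> j) = \<pi> k"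
  by (auto simp: is_cone_def Hom_def)

lemma is_coneI:
  assumes "X \<in> Ob C" "\<pi> \<in> extensional (Ob J)" "category J"
    and "\<And>j. j \<in> Ob J \<Longrightarrow> \<pi> j \<in> Hom C X (fo D j)"
    and "\<And>u j k. \<lbrakk>u \<in> Hom J j k; j \<in> Ob J; k \<in> Ob J\<rbrakk> \<Longrightarrow> Comp C (fa D u) (\<pi> j) = \<pi> k"
  shows "is_cone J C D X \<pi>"
  using assms by (auto simp: is_cone_def Arr_Hom category.Dom_in category.Cod_in)

lemma is_cone_comp:
  assumes "is_cone J C D X \<pi>" "u \<in> Hom C Y X" "is_functor J C D"
  shows "is_cone J C D Y (\<lambda>j\<in>Ob J. Comp C (\<pi> j) u)"
proof -
  interpret D: is_functor J C D by fact
  show ?thesis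
  proof (rule is_coneI)
    show "Y \<in> Ob C" using D.cod.Hom_Ob assms(2) by blast
    fix j assume "j \<in> Ob J"
    then show "(\<lambda>j\<in>Ob J. Comp C (\<pi> j) u) j \<in> Hom C Y (fo D j)"
      using D.cod.comp_Hom[OF assms(2) is_cone_Hom[OF assms(1)]] by simp
  next
    fix v j k assume v: "v \<in> Hom J j k" and jk: "j \<in> Ob J" "k \<in> Ob J"
    then show "Comp C (fa D v) ((\<lambda>j\<in>Ob J. Comp C (\<pi> j) u) j) = (\<lambda>j\<in>Ob J. Comp C (\<pi> j) u) k"
      using D.cod.assoc_Hom[OF assms(2) is_cone_Hom[OF assms(1)] D.fa_Hom[OF v]]
      by (simp add: is_cone_commute[OF assms(1) v])
  qed (auto simp: D.dom.category_axioms)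
qed

lemma is_limit_cone: "is_limit J C D X \<pi> \<Longrightarrow> is_cone J C D X \<pi>"
  by (simp add: is_limit_def)

lemma is_limit_lift:
  assumes "is_limit J C D X \<pi>" "is_cone J C D Y \<rho>"
  obtains h where "h \<in> Hom C Y X" "\<And>j. j \<in> Ob J \<Longrightarrow> Comp C (\<pi> j) h = \<rho> j"
  using assms unfolding is_limit_def by metis

text \<open>The legs of a limit are jointly monic, since both arrows lift the cone obtained by
  composing the legs with \<open>h\<close>. Functoriality and naturality of arrows into limits are
  reduced to this below.\<close>

lemma is_limit_eq:
  assumes "is_limit J C D X \<pi>" "is_functor J C D" "h \<in> Hom C Y X" "k \<in> Hom C Y X"
    "\<And>j. j \<in> Ob J \<Longrightarrow> Comp C (\<pi> j) h = Comp C (\<pi> j) k"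
  shows "h = k"
proof -
  have "is_cone J C D Y (\<lambda>j\<in>Ob J. Comp C (\<pi> j) h)"
    by (rule is_cone_comp[OF is_limit_cone[OF assms(1)] assms(3,2)])
  then have "\<exists>!l. l \<in> Hom C Y X \<and> (\<forall>j \<in> Ob J. Comp C (\<pi> j) l = (\<lambda>j\<in>Ob J. Comp C (\<pi> j) h) j)"
    using assms(1) unfolding is_limit_def by blast
  then show ?thesis using assms(3-5) by (metis restrict_apply')
qed

text \<open>Uniqueness appears as joint monicity of the legs, which can be verified without a cone
  at hand.\<close>

lemma is_limitI:
  assumes "is_cone J C D X \<pi>"
    and "\<And>Y \<rho>. is_cone J C D Y \<rho> \<Longrightarrow> \<exists>h \<in> Hom C Y X. \<forall>j \<in> Ob J. Comp C (\<pi> j) h = \<rho> j"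
    and "\<And>Y h k. \<lbrakk>h \<in> Hom C Y X; k \<in> Hom C Y X; \<And>j. j \<in> Ob J \<Longrightarrow> Comp C (\<pi> j) h = Comp C (\<pi> j) k\<rbrakk>
      \<Longrightarrow> h = k"
  shows "is_limit J C D X \<pi>"
  unfolding is_limit_def
proof (intro conjI allI impI)
  fix Y \<rho> assume "is_cone J C D Y \<rho>"
  then obtain h where "h \<in> Hom C Y X \<and> (\<forall>j \<in> Ob J. Comp C (\<pi> j) h = \<rho> j)" using assms(2) by blast
  then show "\<exists>!h. h \<in> Hom C Y X \<and> (\<forall>j \<in> Ob J. Comp C (\<pi> j) h = \<rho> j)"
    using assms(3) by metis
qed (rule assms(1))

text \<open>Lifts to \<open>Y\<close> are lifts to \<open>X\<close> followed by the inverse of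
  \<open>u\<close>. Through this, an arbitrary limit is compared with a constructed one.\<close>

lemma is_limit_comp_iso:
  assumes lim: "is_limit J C D X \<pi>" and D: "is_functor J C D"
    and u: "u \<in> Hom C Y X" "is_iso C u"
  shows "is_limit J C D Y (\<lambda>j\<in>Ob J. Comp C (\<pi> j) u)"
proof (rule is_limitI)
  interpret D: is_functor J C D by fact
  note \<pi> = is_cone_Hom[OF is_limit_cone[OF lim]]
  obtain v where v: "v \<in> Hom C X Y" "Comp C v u = Ident C Y" "Comp C u v = Ident C X"
    using D.cod.iso_inverse[OF u(2,1)] .
  show "is_cone J C D Y (\<lambda>j\<in>Ob J. Comp C (\<pi> j) u)"
    by (rule is_cone_comp[OF is_limit_cone[OF lim] u(1) D])
  show "\<exists>h\<in>Hom C Z Y. \<forall>j\<in>Ob J. Comp C ((\<lambda>j\<in>Ob J. Comp C (\<pi> j) u) j) h = \<rho> j"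
    if \<rho>: "is_cone J C D Z \<rho>" for Z \<rho>
  proof -
    obtain h where h: "h \<in> Hom C Z X" "\<And>j. j \<in> Ob J \<Longrightarrow> Comp C (\<pi> j) h = \<rho> j"
      using is_limit_lift[OF lim \<rho>] by metis
    have "Comp C (Comp C (\<pi> j) u) (Comp C v h) = \<rho> j" if j: "j \<in> Ob J" for j
      using D.cod.assoc_Hom[OF D.cod.comp_Hom[OF h(1) v(1)] u(1) \<pi>[OF j]]
        D.cod.assoc_Hom[OF h(1) v(1) u(1)] v(3) D.cod.id_left[OF h(1)] h(2)[OF j] by simp
    then show ?thesis using D.cod.comp_Hom[OF h(1) v(1)] by auto
  qed
  fix Z h k assume h: "h \<in> Hom C Z Y" and k: "k \<in> Hom C Z Y"
    and eq: "\<And>j. j \<in> Ob J \<Longrightarrow>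
      Comp C ((\<lambda>j\<in>Ob J. Comp C (\<pi> j) u) j) h = Comp C ((\<lambda>j\<in>Ob J. Comp C (\<pi> j) u) j) k"
  have "Comp C u h = Comp C u k"
    by (rule is_limit_eq[OF lim D D.cod.comp_Hom[OF h u(1)] D.cod.comp_Hom[OF k u(1)]])
      (use eq D.cod.assoc_Hom[OF h u(1) \<pi>] D.cod.assoc_Hom[OF k u(1) \<pi>] in auto)
  then show "h = k"
    by (metis D.cod.assoc_Hom[OF h u(1) v(1)] D.cod.assoc_Hom[OF k u(1) v(1)] v(2)
      D.cod.id_left[OF h] D.cod.id_left[OF k])
qed

text \<open>The two mutual lifts are inverse to each other by joint monicity. The last equation
  describes the whole family \<open>\<rho>\<close>, which is possible because cones are
  extensional.\<close>

lemma is_limit_iso: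
  assumes X: "is_limit J C D X \<pi>" and Y: "is_limit J C D Y \<rho>" and D: "is_functor J C D"
  obtains u where "u \<in> Hom C Y X" "is_iso C u" "\<rho> = (\<lambda>j\<in>Ob J. Comp C (\<pi> j) u)"
proof -
  interpret D: is_functor J C D by fact
  note cone = is_limit_cone[OF X] is_limit_cone[OF Y]
  note \<pi> = is_cone_Hom[OF cone(1)] and \<rho> = is_cone_Hom[OF cone(2)]
  obtain u where u: "u \<in> Hom C Y X" "\<And>j. j \<in> Ob J \<Longrightarrow> Comp C (\<pi> j) u = \<rho> j"
    using is_limit_lift[OF X cone(2)] by metis
  obtain v where v: "v \<in> Hom C X Y" "\<And>j. j \<in> Ob J \<Longrightarrow> Comp C (\<rho> j) v = \<pi> j"
    using is_limit_lift[OF Y cone(1)] by metis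
  have ob: "X \<in> Ob C" "Y \<in> Ob C" using D.cod.Hom_Ob[OF u(1)] by auto
  have "Comp C v u = Ident C Y"
    by (rule is_limit_eq[OF Y D D.cod.comp_Hom[OF u(1) v(1)] D.cod.id_Hom[OF ob(2)]])
      (use D.cod.assoc_Hom[OF u(1) v(1) \<rho>] u v D.cod.id_right[OF \<rho>] in auto)
  moreover have "Comp C u v = Ident C X"
    by (rule is_limit_eq[OF X D D.cod.comp_Hom[OF v(1) u(1)] D.cod.id_Hom[OF ob(1)]])
      (use D.cod.assoc_Hom[OF v(1) u(1) \<pi>] u v D.cod.id_right[OF \<pi>] in auto)
  ultimately have "is_iso C u" using D.cod.is_isoI u(1) v(1) by metis
  moreover have "\<rho> = (\<lambda>j\<in>Ob J. Comp C (\<pi> j) u)"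
    using cone(2) u(2) by (auto simp: is_cone_def intro!: extensionalityI[where A="Ob J"])
  ultimately show thesis using that u(1) by blast
qed

section \<open>Images of cones and reflection of limits\<close>

context is_functor
begin

lemma fa_iso: "u \<in> Hom C x y \<Longrightarrow> is_iso C u \<Longrightarrow> is_iso D (fa F u)"
  by (metis cod.is_isoI dom.iso_inverse dom.Hom_Ob fa_Comp_Hom fa_Hom fa_Ident)

lemma is_cone_image:
  assumes "is_cone J C K X \<pi>" "is_functor J C K"
  shows "is_cone J D (comp_functor J F K) (fo F X) (\<lambda>j\<in>Ob J. fa F (\<pi> j))"
proof (rule is_coneI)
  interpret K: is_functor J C K by fact
  show "category J" ..
  show "fo F X \<in> Ob D" using assms(1) by (simp add: is_cone_def fo_Ob)
  show "(\<lambda>j\<in>Ob J. fa F (\<pi> j)) j \<in> Hom D (fo F X) (fo (comp_functor J F K) j)" if "j \<in> Ob J" for j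
    using fa_Hom[OF is_cone_Hom[OF assms(1) that]] that by simp
  show "Comp D (fa (comp_functor J F K) u) ((\<lambda>j\<in>Ob J. fa F (\<pi> j)) j) = (\<lambda>j\<in>Ob J. fa F (\<pi> j)) k"
    if u: "u \<in> Hom J j k" and jk: "j \<in> Ob J" "k \<in> Ob J" for u j k
    using fa_Comp_Hom[OF is_cone_Hom[OF assms(1) jk(1)] K.fa_Hom[OF u]] is_cone_commute[OF assms(1) u] u jk
    by (simp add: Hom_def)
qed simp

end

text \<open>Fullness pulls the lift in \<open>D\<close> back to \<open>C\<close>; faithfulness shows
  that the arrow obtained commutes with the legs and is unique.\<close>

lemma (in ff_eso_functor) reflects_limits:
  assumes lim: "is_limit J D (comp_functor J F K) (fo F X) (\<lambda>j\<in>Ob J. fa F (\<pi> j))"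
    and cone: "is_cone J C K X \<pi>" and K: "is_functor J C K"
  shows "is_limit J C K X \<pi>"
proof (rule is_limitI[OF cone])
  interpret K: is_functor J C K by fact
  have X: "X \<in> Ob C" using cone by (simp add: is_cone_def)
  note \<pi> = is_cone_Hom[OF cone]
  fix Y \<rho> assume \<rho>: "is_cone J C K Y \<rho>"
  then have Y: "Y \<in> Ob C" by (simp add: is_cone_def)
  obtain h where h: "h \<in> Hom D (fo F Y) (fo F X)"
    "\<And>j. j \<in> Ob J \<Longrightarrow> Comp D ((\<lambda>j\<in>Ob J. fa F (\<pi> j)) j) h = (\<lambda>j\<in>Ob J. fa F (\<rho> j)) j"
    using is_limit_lift[OF lim is_cone_image[OF \<rho> K]] by metis
  obtain m where m: "m \<in> Hom C Y X" "fa F m = h" using full[OF h(1) Y X] .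
  have "Comp C (\<pi> j) m = \<rho> j" if j: "j \<in> Ob J" for j
    using faithful[OF dom.comp_Hom[OF m(1) \<pi>[OF j]] is_cone_Hom[OF \<rho> j]] h(2)[OF j] j m(2)
    by (simp add: fa_Comp_Hom[OF m(1) \<pi>[OF j]])
  then show "\<exists>h\<in>Hom C Y X. \<forall>j\<in>Ob J. Comp C (\<pi> j) h = \<rho> j" using m(1) by blast
next
  interpret K: is_functor J C K by fact
  note \<pi> = is_cone_Hom[OF cone]
  fix Y h k assume h: "h \<in> Hom C Y X" and k: "k \<in> Hom C Y X"
    and eq: "\<And>j. j \<in> Ob J \<Longrightarrow> Comp C (\<pi> j) h = Comp C (\<pi> j) k"
  have "fa F h = fa F k"
    by (rule is_limit_eq[OF lim is_functor_comp[OF K is_functor_axioms] fa_Hom[OF h] fa_Hom[OF k]])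
      (use eq fa_Comp_Hom[OF h \<pi>] fa_Comp_Hom[OF k \<pi>] in auto)
  then show "h = k" by (rule faithful[OF h k])
qed

subsection \<open>Families of functors that jointly create limits\<close>

abbreviation image_is_limit ::
  "('i, 'j) cat \<Rightarrow> ('p, 'b) cat \<Rightarrow> ('o, 'a, 'p, 'b) cfun \<Rightarrow> ('i, 'j, 'o, 'a) cfun \<Rightarrow> 'o \<Rightarrow> ('i \<Rightarrow> 'a) \<Rightarrow> bool"
  where "image_is_limit J A E D X \<pi> \<equiv>
    is_limit J A (comp_functor J E D) (fo E X) (\<lambda>j\<in>Ob J. fa E (\<pi> j))"

text \<open>A weak form of creation: a cone with limits as images exists and all such cones are
  limits, but nothing is lifted uniquely or on the nose. Strict creation would not be invariant
  under equivalence.\<close>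

definition jointly_create_limits ::
  "'j rel \<Rightarrow> ('o, 'a) cat \<Rightarrow> ('p, 'b) cat \<Rightarrow> 'i set \<Rightarrow> ('i \<Rightarrow> ('o, 'a, 'p, 'b) cfun) \<Rightarrow> bool" where
  "jointly_create_limits \<mu> C A I E \<longleftrightarrow>
     (\<forall>i \<in> I. is_functor C A (E i)) \<and>
     (\<forall>J D. small_diagram \<mu> J C D \<longrightarrow>
        (\<exists>X \<pi>. is_cone J C D X \<pi> \<and> (\<forall>i \<in> I. image_is_limit J A (E i) D X \<pi>)) \<and>
        (\<forall>X \<pi>. is_cone J C D X \<pi> \<and> (\<forall>i \<in> I. image_is_limit J A (E i) D X \<pi>) \<longrightarrow> is_limit J C D X \<pi>))"

lemma jointly_create_limits_complete: "jointly_create_limits \<mu> C A I E \<Longrightarrow> complete \<mu> C"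
  unfolding jointly_create_limits_def complete_def by blast

text \<open>Only the direction from limits to images needs an argument: any limit cone differs by an
  isomorphism from a cone with limits as images, and each \<open>E i\<close> preserves
  isomorphisms.\<close>

lemma jointly_create_limits_computed:
  assumes "jointly_create_limits \<mu> C A I E"
  shows "limits_computed_by \<mu> C A I E"
  unfolding limits_computed_by_def
proof (intro conjI allI impI iffI)
  show "\<forall>i\<in>I. is_functor C A (E i)" using assms by (simp add: jointly_create_limits_def)
  fix J D X \<pi> assume *: "small_diagram \<mu> J C D \<and> is_cone J C D X \<pi>"
  then have D: "is_functor J C D" by (simp add: small_diagram_def)
  interpret D: is_functor J C D by fact
  show "is_limit J C D X \<pi>" if "\<forall>i\<in>I. image_is_limit J A (E i) D X \<pi>"
    using assms * that unfolding jointly_create_limits_def by blast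
  assume lim: "is_limit J C D X \<pi>"
  obtain Y \<rho> where Y: "is_cone J C D Y \<rho>" "\<And>i. i \<in> I \<Longrightarrow> image_is_limit J A (E i) D Y \<rho>"
    "is_limit J C D Y \<rho>"
    using assms * unfolding jointly_create_limits_def by metis
  obtain u where u: "u \<in> Hom C X Y" "is_iso C u" "\<pi> = (\<lambda>j\<in>Ob J. Comp C (\<rho> j) u)"
    using is_limit_iso[OF Y(3) lim D] .
  show "\<forall>i\<in>I. image_is_limit J A (E i) D X \<pi>"
  proof
    fix i assume i: "i \<in> I"
    interpret E: is_functor C A "E i" using assms i by (simp add: jointly_create_limits_def)
    have "is_limit J A (comp_functor J (E i) D) (fo (E i) X)
        (\<lambda>j\<in>Ob J. Comp A ((\<lambda>j\<in>Ob J. fa (E i) (\<rho> j)) j) (fa (E i) u))"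
      by (rule is_limit_comp_iso[OF Y(2)[OF i] is_functor_comp[OF D E.is_functor_axioms]
            E.fa_Hom[OF u(1)] E.fa_iso[OF u(1,2)]])
    moreover have "(\<lambda>j\<in>Ob J. Comp A ((\<lambda>j\<in>Ob J. fa (E i) (\<rho> j)) j) (fa (E i) u)) =
        (\<lambda>j\<in>Ob J. fa (E i) (\<pi> j))"
      using E.fa_Comp_Hom[OF u(1) is_cone_Hom[OF Y(1)]] u(3) by (auto intro!: restrict_ext)
    ultimately show "image_is_limit J A (E i) D X \<pi>" by simp
  qed
qed

text \<open>A diagram in \<open>C\<close> indexed by \<open>J\<close> is the same data as a diagram
  in \<open>op C\<close> indexed by \<open>op J\<close>, and \<open>op J\<close> is as small as
  \<open>J\<close>.\<close>

lemma complete_op: "complete \<mu> (op C) \<Longrightarrow> cocomplete \<mu> C"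
  unfolding complete_def cocomplete_def is_colimit_def small_diagram_def
  by (metis is_functor_op op_sel(1,2))

lemma limits_computed_by_op:
  assumes "limits_computed_by \<mu> (op C) (op A) I E"
  shows "colimits_computed_by \<mu> C A I E"
  unfolding colimits_computed_by_def is_cocone_def is_colimit_def
proof (intro conjI allI impI)
  show "\<forall>i\<in>I. is_functor C A (E i)" using assms by (simp add: limits_computed_by_def)
  fix J D X \<iota> assume *: "small_diagram \<mu> J C D \<and> is_cone (op J) (op C) D X \<iota>"
  then have "small_diagram \<mu> (op J) (op C) D" by (simp add: small_diagram_def)
  with assms * have "is_limit (op J) (op C) D X \<iota> \<longleftrightarrow>
      (\<forall>i\<in>I. image_is_limit (op J) (op A) (E i) D X \<iota>)"
    unfolding limits_computed_by_def by blast
  then show "is_limit (op J) (op C) D X \<iota> \<longleftrightarrow> (\<forall>i\<in>I. is_limit (op J) (op A) (comp_functor J (E i) D)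
      (fo (E i) X) (\<lambda>j\<in>Ob J. fa (E i) (\<iota> j)))" by simp
qed

text \<open>A limit cone in \<open>D\<close> can be moved to a vertex in the image of
  \<open>F\<close> and then lifted to \<open>C\<close>, and \<open>F\<close> reflects
  limits.\<close>

lemma (in ff_eso_functor) jointly_create_limits:
  assumes E: "jointly_create_limits \<mu> D A I E"
  shows "jointly_create_limits \<mu> C A I (\<lambda>i. comp_functor C (E i) F)"
  unfolding jointly_create_limits_def
proof (intro conjI ballI allI impI)
  show "is_functor C A (comp_functor C (E i) F)" if "i \<in> I" for i
    using is_functor_comp[OF is_functor_axioms, of A "E i"] that E
    unfolding jointly_create_limits_def by blast
  fix J K assume small: "small_diagram \<mu> J C K"
  then have K: "is_functor J C K" by (simp add: small_diagram_def)
  interpret K: is_functor J C K by fact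
  have small': "small_diagram \<mu> J D (comp_functor J F K)"
    using small is_functor_comp[OF K is_functor_axioms] by (simp add: small_diagram_def)
  \<comment> \<open>The image of a cone under the composite is the image of its image. The cone
    hypothesis places vertex and legs in \<open>C\<close>, where the restrictions have no
    effect.\<close>
  have image: "image_is_limit J A (comp_functor C (E i) F) K X \<pi> \<longleftrightarrow>
      image_is_limit J A (E i) (comp_functor J F K) (fo F X) (\<lambda>j\<in>Ob J. fa F (\<pi> j))"
    if "is_cone J C K X \<pi>" for X \<pi> i
  proof -
    have "X \<in> Ob C" "\<And>j. j \<in> Ob J \<Longrightarrow> \<pi> j \<in> Arr C"
      using that by (auto simp: is_cone_def Hom_def)
    then show ?thesis by (simp add: comp_functor_assoc[OF K] cong: restrict_cong)
  qed
  show "is_limit J C K X \<pi>"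
    if "is_cone J C K X \<pi> \<and> (\<forall>i\<in>I. image_is_limit J A (comp_functor C (E i) F) K X \<pi>)" for X \<pi>
  proof (rule reflects_limits[OF _ _ K])
    show cone: "is_cone J C K X \<pi>" using that by blast
    show "is_limit J D (comp_functor J F K) (fo F X) (\<lambda>j\<in>Ob J. fa F (\<pi> j))"
      using E small' is_cone_image[OF cone K] that image[OF cone]
      unfolding jointly_create_limits_def by blast
  qed
  obtain X \<pi> where X: "is_cone J D (comp_functor J F K) X \<pi>"
      "\<And>i. i \<in> I \<Longrightarrow> image_is_limit J A (E i) (comp_functor J F K) X \<pi>"
    using E small' unfolding jointly_create_limits_def by metis
  have "X \<in> Ob D" using X(1) by (simp add: is_cone_def)
  then obtain Y u where Y: "Y \<in> Ob C" and u: "u \<in> Hom D (fo F Y) X" "is_iso D u"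
    using eso unfolding ess_surjective_def by blast
  \<comment> \<open>The vertex \<open>X\<close> need not be a value of \<open>F\<close>. Composing
    with \<open>u\<close> moves the cone to \<open>F Y\<close>, where fullness lifts each leg and
    faithfulness lifts the cone equations.\<close>
  have \<pi>u: "Comp D (\<pi> j) u \<in> Hom D (fo F Y) (fo F (fo K j))" if "j \<in> Ob J" for j
    using cod.comp_Hom[OF u(1) is_cone_Hom[OF X(1) that]] that by simp
  have "\<forall>j\<in>Ob J. \<exists>r. r \<in> Hom C Y (fo K j) \<and> fa F r = Comp D (\<pi> j) u"
    using full[OF \<pi>u Y K.fo_Ob] by metis
  then obtain \<rho>' where \<rho>': "\<forall>j\<in>Ob J. \<rho>' j \<in> Hom C Y (fo K j) \<and> fa F (\<rho>' j) = Comp D (\<pi> j) u"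
    by (rule bchoice[THEN exE])
  define \<rho> where "\<rho> = restrict \<rho>' (Ob J)"
  have \<rho>: "\<rho> j \<in> Hom C Y (fo K j)" "fa F (\<rho> j) = Comp D (\<pi> j) u" if "j \<in> Ob J" for j
    using \<rho>' that by (simp_all add: \<rho>_def)
  have F\<rho>: "(\<lambda>j\<in>Ob J. fa F (\<rho> j)) = (\<lambda>j\<in>Ob J. Comp D (\<pi> j) u)"
    using \<rho>(2) by (auto intro!: restrict_ext)
  have cone: "is_cone J C K Y \<rho>"
  proof (rule is_coneI)
    fix v j k assume v: "v \<in> Hom J j k" and jk: "j \<in> Ob J" "k \<in> Ob J"
    have "is_cone J D (comp_functor J F K) (fo F Y) (\<lambda>j\<in>Ob J. Comp D (\<pi> j) u)"
      by (rule is_cone_comp[OF X(1) u(1) is_functor_comp[OF K is_functor_axioms]])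
    from is_cone_commute[OF this v] have "Comp D (fa F (fa K v)) (Comp D (\<pi> j) u) = Comp D (\<pi> k) u"
      using v jk by (simp add: Hom_def)
    then show "Comp C (fa K v) (\<rho> j) = \<rho> k"
      using faithful[OF dom.comp_Hom[OF \<rho>(1)[OF jk(1)] K.fa_Hom[OF v]] \<rho>(1)[OF jk(2)]]
      by (simp add: fa_Comp_Hom[OF \<rho>(1)[OF jk(1)] K.fa_Hom[OF v]] \<rho>(2) jk)
  qed (use Y \<rho>(1) in \<open>auto simp: \<rho>_def K.dom.category_axioms\<close>)
  moreover have "image_is_limit J A (comp_functor C (E i) F) K Y \<rho>" if i: "i \<in> I" for i
  proof -
    interpret E: is_functor D A "E i" using E i by (simp add: jointly_create_limits_def)
    have FK: "is_functor J D (comp_functor J F K)" by (rule is_functor_comp[OF K is_functor_axioms])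
    have "is_limit J A (comp_functor J (E i) (comp_functor J F K)) (fo (E i) (fo F Y))
        (\<lambda>j\<in>Ob J. Comp A ((\<lambda>j\<in>Ob J. fa (E i) (\<pi> j)) j) (fa (E i) u))"
      by (rule is_limit_comp_iso[OF X(2)[OF i] is_functor_comp[OF FK E.is_functor_axioms]
            E.fa_Hom[OF u(1)] E.fa_iso[OF u(1,2)]])
    moreover have "(\<lambda>j\<in>Ob J. Comp A ((\<lambda>j\<in>Ob J. fa (E i) (\<pi> j)) j) (fa (E i) u)) =
        (\<lambda>j\<in>Ob J. fa (E i) ((\<lambda>j\<in>Ob J. fa F (\<rho> j)) j))"
      using E.fa_Comp_Hom[OF u(1) is_cone_Hom[OF X(1)]] \<rho>(2) by (auto intro!: restrict_ext)
    ultimately show ?thesis unfolding image[OF cone] by simp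
  qed
  ultimately show "\<exists>X \<pi>. is_cone J C K X \<pi> \<and>
      (\<forall>i\<in>I. image_is_limit J A (comp_functor C (E i) F) K X \<pi>)" by blast
qed

text \<open>Full faithfulness is symmetric in the two objects, so only essential surjectivity
  changes: the isomorphism to \<open>d\<close> is replaced by its inverse.\<close>

lemma ff_eso_functor_op:
  assumes "ff_eso_functor C D F"
  shows "ff_eso_functor (op C) (op D) F"
proof -
  interpret ff_eso_functor C D F by fact
  have "\<exists>c\<in>Ob C. \<exists>u\<in>Hom D d (fo F c). is_iso D u" if "d \<in> Ob D" for d
    using eso that cod.iso_inverse unfolding ess_surjective_def by metis
  then show ?thesis
    using ff is_functor_op[OF is_functor_axioms]
    by (auto simp: ff_eso_functor_def ff_eso_functor_axioms_def fully_faithful_def ess_surjective_def)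
qed

subsection \<open>Limits in functor categories\<close>

lemma eval_functor_sel [simp]:
  "is_functor C D F \<Longrightarrow> fo (eval_functor C D c) F = fo F c"
  "nat_trans C D F H \<tau> \<Longrightarrow> fa (eval_functor C D c) (F, \<tau>, H) = \<tau> c"
  by (simp_all add: eval_functor_def)

lemma is_functor_eval:
  assumes "category D" "c \<in> Ob C"
  shows "is_functor (fun_cat C D) D (eval_functor C D c)"
proof -
  interpret FC: category "fun_cat C D" by (rule category_fun_cat[OF assms(1)])
  interpret D: category D by fact
  show ?thesis
  proof
    show "fo (eval_functor C D c) \<in> Ob (fun_cat C D) \<rightarrow>\<^sub>E Ob D"
      using assms(2) by (auto simp: eval_functor_def is_functor.fo_Ob)
    show "fa (eval_functor C D c) \<in> extensional (Arr (fun_cat C D))" by (simp add: eval_functor_def)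
    show "fa (eval_functor C D c) (Ident (fun_cat C D) F) = Ident D (fo (eval_functor C D c) F)"
      if "F \<in> Ob (fun_cat C D)" for F
      using that assms(2) nat_trans_id[of C D F] by simp
    fix t assume "t \<in> Arr (fun_cat C D)"
    then obtain F \<tau> H where t: "t = (F, \<tau>, H)" "nat_trans C D F H \<tau>" by (cases t) auto
    then have FH: "is_functor C D F" "is_functor C D H" by (simp_all add: nat_trans_def)
    show "fa (eval_functor C D c) t \<in> Hom D (fo (eval_functor C D c) (Dom (fun_cat C D) t))
        (fo (eval_functor C D c) (Cod (fun_cat C D) t))"
      using t FH nat_trans_Hom[OF t(2) assms(2)] by simp
    fix s assume "s \<in> Arr (fun_cat C D)" "Dom (fun_cat C D) s = Cod (fun_cat C D) t"
    then obtain \<sigma> K where s: "s = (H, \<sigma>, K)" "nat_trans C D H K \<sigma>" using t by (cases s) auto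
    show "fa (eval_functor C D c) (Comp (fun_cat C D) s t) =
        Comp D (fa (eval_functor C D c) s) (fa (eval_functor C D c) t)"
      using s t assms(2) nat_trans_comp[OF t(2) s(2)] by simp
  qed
qed

lemma Hom_fun_cat:
  "t \<in> Hom (fun_cat C D) F H \<longleftrightarrow> (\<exists>\<tau>. t = (F, \<tau>, H) \<and> nat_trans C D F H \<tau>)"
  by (cases t) (auto simp: Hom_def)

lemma nat_trans_eqI:
  "\<lbrakk>nat_trans C D F H \<tau>; nat_trans C D F H \<sigma>; \<And>x. x \<in> Ob C \<Longrightarrow> \<tau> x = \<sigma> x\<rbrakk> \<Longrightarrow> \<tau> = \<sigma>"
  by (auto simp: nat_trans_def intro: extensionalityI)

text \<open>A cone of functors has a lift at each object of \<open>B\<close>. The lifts form a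
  natural transformation because naturality can be tested after the legs at the target object, which
  are jointly monic there.\<close>

lemma fun_cat_reflects_limits:
  assumes B: "category B" and A: "category A" and D: "is_functor J (fun_cat B A) D"
    and cone: "is_cone J (fun_cat B A) D X \<pi>"
    and lim: "\<And>b. b \<in> Ob B \<Longrightarrow> image_is_limit J A (eval_functor B A b) D X \<pi>"
  shows "is_limit J (fun_cat B A) D X \<pi>"
proof -
  interpret A: category A by fact
  interpret B: category B by fact
  interpret D: is_functor J "fun_cat B A" D by fact
  have X: "is_functor B A X" using cone by (simp add: is_cone_def)
  interpret X: is_functor B A X by fact
  define p where "p j = fst (snd (\<pi> j))" for j
  have p: "\<pi> j = (X, p j, fo D j)" "nat_trans B A X (fo D j) (p j)" if "j \<in> Ob J" for j
    using is_cone_Hom[OF cone that] by (auto simp: Hom_fun_cat p_def)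
  have Dj: "is_functor B A (fo D j)" if "j \<in> Ob J" for j using D.fo_Ob[OF that] by simp
  have lim': "is_limit J A (comp_functor J (eval_functor B A b) D) (fo X b) (\<lambda>j\<in>Ob J. p j b)"
    if "b \<in> Ob B" for b
    using lim[OF that] X by (simp add: p cong: restrict_cong)
  have Db: "is_functor J A (comp_functor J (eval_functor B A b) D)" if "b \<in> Ob B" for b
    by (rule is_functor_comp[OF D is_functor_eval[OF A that]])
  have eq: "h = k" if "b \<in> Ob B" "h \<in> Hom A y (fo X b)" "k \<in> Hom A y (fo X b)"
    "\<And>j. j \<in> Ob J \<Longrightarrow> Comp A (p j b) h = Comp A (p j b) k" for h k b y
    using is_limit_eq[OF lim'[OF that(1)] Db[OF that(1)] that(2,3)] that(4) by simp
  show ?thesis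
  proof (rule is_limitI[OF cone])
    fix Y \<rho> assume Y\<rho>: "is_cone J (fun_cat B A) D Y \<rho>"
    then have Y: "is_functor B A Y" by (simp add: is_cone_def)
    interpret Y: is_functor B A Y by fact
    define r where "r j = fst (snd (\<rho> j))" for j
    have r: "\<rho> j = (Y, r j, fo D j)" "nat_trans B A Y (fo D j) (r j)" if "j \<in> Ob J" for j
      using is_cone_Hom[OF Y\<rho> that] by (auto simp: Hom_fun_cat r_def)
    have "\<forall>b\<in>Ob B. \<exists>h. h \<in> Hom A (fo Y b) (fo X b) \<and> (\<forall>j\<in>Ob J. Comp A (p j b) h = r j b)"
    proof
      fix b assume b: "b \<in> Ob B"
      have "is_cone J A (comp_functor J (eval_functor B A b) D) (fo Y b) (\<lambda>j\<in>Ob J. r j b)"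
        using is_functor.is_cone_image[OF is_functor_eval[OF A b] Y\<rho> D] Y by (simp add: r cong: restrict_cong)
      from is_limit_lift[OF lim'[OF b] this]
      obtain h where "h \<in> Hom A (fo Y b) (fo X b)"
        "\<And>j. j \<in> Ob J \<Longrightarrow> Comp A ((\<lambda>j\<in>Ob J. p j b) j) h = (\<lambda>j\<in>Ob J. r j b) j" by metis
      then show "\<exists>h. h \<in> Hom A (fo Y b) (fo X b) \<and> (\<forall>j\<in>Ob J. Comp A (p j b) h = r j b)" by auto
    qed
    then obtain h where h: "\<forall>b\<in>Ob B. h b \<in> Hom A (fo Y b) (fo X b) \<and> (\<forall>j\<in>Ob J. Comp A (p j b) (h b) = r j b)"
      by (rule bchoice[THEN exE])
    have hH: "h b \<in> Hom A (fo Y b) (fo X b)" if "b \<in> Ob B" for b using h that by blast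
    have ph: "Comp A (p j b) (h b) = r j b" if "b \<in> Ob B" "j \<in> Ob J" for b j using h that by blast
    have nt: "nat_trans B A Y X (restrict h (Ob B))"
    proof (rule nat_transI)
      fix f b c assume f: "f \<in> Hom B b c" and bc: "b \<in> Ob B" "c \<in> Ob B"
      have "Comp A (h c) (fa Y f) = Comp A (fa X f) (h b)"
      proof (rule eq[OF bc(2) A.comp_Hom[OF Y.fa_Hom[OF f] hH[OF bc(2)]] A.comp_Hom[OF hH[OF bc(1)] X.fa_Hom[OF f]]])
        fix j assume j: "j \<in> Ob J"
        interpret Dj: is_functor B A "fo D j" by (rule Dj[OF j])
        note pj = nat_trans_Hom[OF p(2)[OF j]]
        have "Comp A (p j c) (Comp A (h c) (fa Y f)) = Comp A (r j c) (fa Y f)"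
          using A.assoc_Hom[OF Y.fa_Hom[OF f] hH[OF bc(2)] pj[OF bc(2)]] by (simp add: ph bc j)
        also have "\<dots> = Comp A (fa (fo D j) f) (Comp A (p j b) (h b))"
          by (simp add: ph bc j nat_trans_nat[OF r(2)[OF j] f])
        also have "\<dots> = Comp A (Comp A (p j c) (fa X f)) (h b)"
          using A.assoc_Hom[OF hH[OF bc(1)] pj[OF bc(1)] Dj.fa_Hom[OF f]] nat_trans_nat[OF p(2)[OF j] f] by simp
        also have "\<dots> = Comp A (p j c) (Comp A (fa X f) (h b))"
          using A.assoc_Hom[OF hH[OF bc(1)] X.fa_Hom[OF f] pj[OF bc(2)]] by simp
        finally show "Comp A (p j c) (Comp A (h c) (fa Y f)) = Comp A (p j c) (Comp A (fa X f) (h b))" .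
      qed
      then show "Comp A (restrict h (Ob B) c) (fa Y f) = Comp A (fa X f) (restrict h (Ob B) b)"
        using bc by simp
    qed (use X Y hH in auto)
    have "Comp (fun_cat B A) (\<pi> j) (Y, restrict h (Ob B), X) = \<rho> j" if j: "j \<in> Ob J" for j
      using nat_trans_comp[OF nt p(2)[OF j]] r(2)[OF j]
      by (auto simp: p(1)[OF j] r(1)[OF j] ph j intro!: nat_trans_eqI)
    moreover have "(Y, restrict h (Ob B), X) \<in> Hom (fun_cat B A) Y X"
      using nt by (simp add: Hom_fun_cat)
    ultimately show "\<exists>h\<in>Hom (fun_cat B A) Y X. \<forall>j\<in>Ob J. Comp (fun_cat B A) (\<pi> j) h = \<rho> j" by blast
  next
    fix Y h k assume "h \<in> Hom (fun_cat B A) Y X" "k \<in> Hom (fun_cat B A) Y X"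
      and hk: "\<And>j. j \<in> Ob J \<Longrightarrow> Comp (fun_cat B A) (\<pi> j) h = Comp (fun_cat B A) (\<pi> j) k"
    then obtain \<sigma> \<tau> where h: "h = (Y, \<sigma>, X)" "nat_trans B A Y X \<sigma>" and k: "k = (Y, \<tau>, X)" "nat_trans B A Y X \<tau>"
      by (auto simp: Hom_fun_cat)
    have "\<sigma> = \<tau>"
    proof (rule nat_trans_eqI[OF h(2) k(2)], rule eq)
      fix b j assume "b \<in> Ob B" "j \<in> Ob J"
      then show "Comp A (p j b) (\<sigma> b) = Comp A (p j b) (\<tau> b)"
        using hk[of j] by (auto simp: p(1) h(1) k(1) dest: fun_cong[where x=b])
    qed (use nat_trans_Hom[OF h(2)] nat_trans_Hom[OF k(2)] in auto)
    then show "h = k" by (simp add: h k)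
  qed
qed

text \<open>Limits chosen at the objects of \<open>B\<close> assemble to a functor, since an arrow
  of \<open>B\<close> turns the limit cone at its source into a cone over the diagram at its
  target.\<close>

lemma fun_cat_pointwise_limit:
  assumes B: "category B" and A: "category A" and D: "is_functor J (fun_cat B A) D"
    and lim: "\<And>b. b \<in> Ob B \<Longrightarrow> \<exists>x \<pi>. is_limit J A (comp_functor J (eval_functor B A b) D) x \<pi>"
  shows "\<exists>X \<pi>. is_cone J (fun_cat B A) D X \<pi> \<and> (\<forall>b \<in> Ob B. image_is_limit J A (eval_functor B A b) D X \<pi>)"
proof -
  interpret A: category A by fact
  interpret B: category B by fact
  interpret D: is_functor J "fun_cat B A" D by fact
  let ?D = "\<lambda>b. comp_functor J (eval_functor B A b) D"
  have "\<forall>b\<in>Ob B. \<exists>t. is_limit J A (?D b) (fst t) (snd t)" using lim by simp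
  then obtain t where t: "\<forall>b\<in>Ob B. is_limit J A (?D b) (fst (t b)) (snd (t b))"
    by (rule bchoice[THEN exE])
  define L where "L b = fst (t b)" for b
  define p where "p b = snd (t b)" for b
  have L: "is_limit J A (?D b) (L b) (p b)" if "b \<in> Ob B" for b using t that by (simp add: L_def p_def)
  have Db: "is_functor J A (?D b)" if "b \<in> Ob B" for b
    by (rule is_functor_comp[OF D is_functor_eval[OF A that]])
  note L_eq = is_limit_eq[OF L Db]
  have Dj: "is_functor B A (fo D j)" if "j \<in> Ob J" for j using D.fo_Ob[OF that] by simp
  define T where "T u = fst (snd (fa D u))" for u
  have T: "fa D u = (fo D j, T u, fo D k)" "nat_trans B A (fo D j) (fo D k) (T u)" if "u \<in> Hom J j k" for u j k
    using D.fa_Hom[OF that] by (auto simp: Hom_fun_cat T_def)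
  have T': "fa (?D b) u = T u b" if "u \<in> Hom J j k" "b \<in> Ob B" for u j k b
    using that T[OF that(1)] by (simp add: Hom_def)
  have pH: "p b j \<in> Hom A (L b) (fo (fo D j) b)" if "b \<in> Ob B" "j \<in> Ob J" for b j
    using is_cone_Hom[OF is_limit_cone[OF L[OF that(1)]] that(2)] that Dj by simp
  have pc: "Comp A (T u b) (p b j) = p b k" if "u \<in> Hom J j k" "b \<in> Ob B" for u j k b
    using is_cone_commute[OF is_limit_cone[OF L[OF that(2)]] that(1)] T'[OF that] by simp
  have DH: "fa (fo D j) f \<in> Hom A (fo (fo D j) b) (fo (fo D j) c)" if "f \<in> Hom B b c" "j \<in> Ob J" for f b c j
    using is_functor.fa_Hom[OF Dj that(1)] that(2) .
  \<comment> \<open>The value at \<open>f\<close> lifts the legs at the source followed by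
    \<open>fa (fo D j) f\<close>; naturality of the transformations \<open>T u\<close> makes these
    composites a cone.\<close>
  have "\<forall>f\<in>Arr B. \<exists>h. h \<in> Hom A (L (Dom B f)) (L (Cod B f)) \<and>
      (\<forall>j\<in>Ob J. Comp A (p (Cod B f) j) h = Comp A (fa (fo D j) f) (p (Dom B f) j))"
  proof
    fix f assume "f \<in> Arr B"
    define b where "b = Dom B f" define c where "c = Cod B f"
    have f: "f \<in> Hom B b c" and bc: "b \<in> Ob B" "c \<in> Ob B"
      using \<open>f \<in> Arr B\<close> by (auto simp: b_def c_def Hom_def B.Dom_in B.Cod_in)
    have "is_cone J A (?D c) (L b) (\<lambda>j\<in>Ob J. Comp A (fa (fo D j) f) (p b j))"
    proof (rule is_coneI)
      show "L b \<in> Ob A" using is_limit_cone[OF L[OF bc(1)]] by (simp add: is_cone_def)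
      show "category J" ..
      show "(\<lambda>j\<in>Ob J. Comp A (fa (fo D j) f) (p b j)) j \<in> Hom A (L b) (fo (?D c) j)" if "j \<in> Ob J" for j
        using A.comp_Hom[OF pH[OF bc(1) that] DH[OF f that]] that Dj by simp
      fix u j k assume u: "u \<in> Hom J j k" and jk: "j \<in> Ob J" "k \<in> Ob J"
      note Tu = nat_trans_Hom[OF T(2)[OF u]]
      have "Comp A (T u c) (Comp A (fa (fo D j) f) (p b j)) = Comp A (fa (fo D k) f) (p b k)"
        using A.assoc_Hom[OF pH[OF bc(1) jk(1)] DH[OF f jk(1)] Tu[OF bc(2)]]
          A.assoc_Hom[OF pH[OF bc(1) jk(1)] Tu[OF bc(1)] DH[OF f jk(2)]]
        by (simp add: pc[OF u bc(1)] nat_trans_nat[OF T(2)[OF u] f])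
      then show "Comp A (fa (?D c) u) ((\<lambda>j\<in>Ob J. Comp A (fa (fo D j) f) (p b j)) j) =
          (\<lambda>j\<in>Ob J. Comp A (fa (fo D j) f) (p b j)) k"
        using jk T'[OF u bc(2)] by simp
    qed simp
    from is_limit_lift[OF L[OF bc(2)] this] obtain h where
      "h \<in> Hom A (L b) (L c)" "\<And>j. j \<in> Ob J \<Longrightarrow> Comp A (p c j) h = (\<lambda>j\<in>Ob J. Comp A (fa (fo D j) f) (p b j)) j"
      by metis
    then show "\<exists>h. h \<in> Hom A (L (Dom B f)) (L (Cod B f)) \<and>
        (\<forall>j\<in>Ob J. Comp A (p (Cod B f) j) h = Comp A (fa (fo D j) f) (p (Dom B f) j))"
      by (auto simp: b_def c_def)
  qed
  then obtain l where l: "\<forall>f\<in>Arr B. l f \<in> Hom A (L (Dom B f)) (L (Cod B f)) \<and>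
      (\<forall>j\<in>Ob J. Comp A (p (Cod B f) j) (l f) = Comp A (fa (fo D j) f) (p (Dom B f) j))"
    by (rule bchoice[THEN exE])
  have lH: "l f \<in> Hom A (L b) (L c)" if "f \<in> Hom B b c" for f b c
    using l that by (auto simp: Hom_def)
  have pl: "Comp A (p c j) (l f) = Comp A (fa (fo D j) f) (p b j)" if "f \<in> Hom B b c" "j \<in> Ob J" for f b c j
    using l that by (auto simp: Hom_def)
  have LO: "L b \<in> Ob A" if "b \<in> Ob B" for b
    using is_limit_cone[OF L[OF that]] by (simp add: is_cone_def)
  define X where "X = \<lparr>fo = restrict L (Ob B), fa = restrict l (Arr B)\<rparr>"
  have X: "is_functor B A X"
  proof
    show "fo X \<in> Ob B \<rightarrow>\<^sub>E Ob A" using LO by (auto simp: X_def)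
    show "fa X \<in> extensional (Arr B)" by (simp add: X_def)
    show "fa X f \<in> Hom A (fo X (Dom B f)) (fo X (Cod B f))" if "f \<in> Arr B" for f
      using lH[OF Arr_Hom[OF that]] that by (simp add: X_def B.Dom_in B.Cod_in)
    show "fa X (Ident B b) = Ident A (fo X b)" if b: "b \<in> Ob B" for b
    proof -
      \<comment> \<open>The chosen lifts are functorial by uniqueness alone: both sides agree after
        every leg.\<close>
      have "l (Ident B b) = Ident A (L b)"
      proof (rule L_eq[OF b b lH[OF B.id_Hom[OF b]] A.id_Hom[OF LO[OF b]]])
        fix j assume j: "j \<in> Ob J"
        interpret Dj: is_functor B A "fo D j" by (rule Dj[OF j])
        show "Comp A (p b j) (l (Ident B b)) = Comp A (p b j) (Ident A (L b))"
          using A.id_left[OF pH[OF b j]] A.id_right[OF pH[OF b j]]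
          by (simp add: pl[OF B.id_Hom[OF b] j] Dj.fa_Ident b)
      qed
      then show ?thesis using b by (simp add: X_def B.Ident_in)
    qed
    show "fa X (Comp B g f) = Comp A (fa X g) (fa X f)"
      if gf: "f \<in> Arr B" "g \<in> Arr B" "Dom B g = Cod B f" for f g
    proof -
      obtain b c d where f: "f \<in> Hom B b c" and g: "g \<in> Hom B c d"
        using gf unfolding Hom_def by blast
      have ob: "b \<in> Ob B" "c \<in> Ob B" "d \<in> Ob B" using f g B.Hom_Ob by auto
      note gf' = B.comp_Hom[OF f g]
      have "l (Comp B g f) = Comp A (l g) (l f)"
      proof (rule L_eq[OF ob(3) ob(3) lH[OF gf'] A.comp_Hom[OF lH[OF f] lH[OF g]]])
        fix j assume j: "j \<in> Ob J"
        interpret Dj: is_functor B A "fo D j" by (rule Dj[OF j])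
        show "Comp A (p d j) (l (Comp B g f)) = Comp A (p d j) (Comp A (l g) (l f))"
          using A.assoc_Hom[OF lH[OF f] lH[OF g] pH[OF ob(3) j]]
            A.assoc_Hom[OF lH[OF f] pH[OF ob(2) j] DH[OF g j]]
            A.assoc_Hom[OF pH[OF ob(1) j] DH[OF f j] DH[OF g j]]
          by (simp add: pl[OF gf' j] pl[OF f j] pl[OF g j] Dj.fa_Comp_Hom[OF f g])
      qed
      then show ?thesis using gf gf' by (simp add: X_def Hom_def)
    qed
  qed
  define q where "q j = (\<lambda>b\<in>Ob B. p b j)" for j
  have q: "nat_trans B A X (fo D j) (q j)" if j: "j \<in> Ob J" for j
  proof (rule nat_transI[OF X Dj[OF j]])
    fix f b c assume "f \<in> Hom B b c" "b \<in> Ob B" "c \<in> Ob B"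
    then show "Comp A (q j c) (fa X f) = Comp A (fa (fo D j) f) (q j b)"
      using pl[of f b c j] j by (simp add: q_def X_def Hom_def)
  qed (use pH j in \<open>auto simp: q_def X_def\<close>)
  define \<pi> where "\<pi> = (\<lambda>j\<in>Ob J. (X, q j, fo D j))"
  have "is_cone J (fun_cat B A) D X \<pi>"
  proof (rule is_coneI)
    fix u j k assume u: "u \<in> Hom J j k" and jk: "j \<in> Ob J" "k \<in> Ob J"
    show "Comp (fun_cat B A) (fa D u) (\<pi> j) = \<pi> k"
      using jk by (auto simp: T(1)[OF u] \<pi>_def q_def pc[OF u] intro!: restrict_ext)
  qed (use X q in \<open>auto simp: \<pi>_def Hom_fun_cat D.dom.category_axioms\<close>)
  moreover have "image_is_limit J A (eval_functor B A b) D X \<pi>" if b: "b \<in> Ob B" for b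
  proof -
    have "(\<lambda>j\<in>Ob J. fa (eval_functor B A b) (\<pi> j)) = p b"
      using is_limit_cone[OF L[OF b]] b
      by (auto simp: \<pi>_def q q_def is_cone_def intro!: extensionalityI[where A="Ob J"])
        (metis (no_types, lifting) b eval_functor_sel(2) q q_def restrict_apply')
    then show ?thesis using L[OF b] X b by (simp add: X_def)
  qed
  ultimately show ?thesis by blast
qed

lemma fun_cat_creates_limits:
  assumes "category B" "category A" "complete \<mu> A"
  shows "jointly_create_limits \<mu> (fun_cat B A) A (Ob B) (eval_functor B A)"
  unfolding jointly_create_limits_def
proof (intro conjI ballI allI impI)
  show "is_functor (fun_cat B A) A (eval_functor B A b)" if "b \<in> Ob B" for b
    by (rule is_functor_eval[OF assms(2) that])
  fix J D assume small: "small_diagram \<mu> J (fun_cat B A) D"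
  then have D: "is_functor J (fun_cat B A) D" by (simp add: small_diagram_def)
  show "\<exists>X \<pi>. is_cone J (fun_cat B A) D X \<pi> \<and> (\<forall>b \<in> Ob B. image_is_limit J A (eval_functor B A b) D X \<pi>)"
  proof (rule fun_cat_pointwise_limit[OF assms(1,2) D])
    fix b assume "b \<in> Ob B"
    then have "small_diagram \<mu> J A (comp_functor J (eval_functor B A b) D)"
      using small is_functor_comp[OF D is_functor_eval[OF assms(2)]] by (simp add: small_diagram_def)
    then show "\<exists>x \<pi>. is_limit J A (comp_functor J (eval_functor B A b) D) x \<pi>"
      using assms(3) unfolding complete_def by blast
  qed
  fix X \<pi> assume "is_cone J (fun_cat B A) D X \<pi> \<and> (\<forall>b \<in> Ob B. image_is_limit J A (eval_functor B A b) D X \<pi>)"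
  then show "is_limit J (fun_cat B A) D X \<pi>"
    using fun_cat_reflects_limits[OF assms(1,2) D] by blast
qed

text \<open>Reversing the triples that represent natural transformations identifies the opposite of a
  functor category with a functor category of opposites, so that colimits need no separate treatment.\<close>

definition op_fun_cat_functor ::
  "('o, 'a) cat \<Rightarrow> ('p, 'b) cat \<Rightarrow>
    (('o, 'a, 'p, 'b) cfun, ('o, 'a, 'p, 'b) cfun \<times> ('o \<Rightarrow> 'b) \<times> ('o, 'a, 'p, 'b) cfun,
     ('o, 'a, 'p, 'b) cfun, ('o, 'a, 'p, 'b) cfun \<times> ('o \<Rightarrow> 'b) \<times> ('o, 'a, 'p, 'b) cfun) cfun" where
  "op_fun_cat_functor B A =
     \<lparr>fo = \<lambda>F\<in>Ob (fun_cat B A). F, fa = \<lambda>(F, \<tau>, H)\<in>Arr (fun_cat B A). (H, \<tau>, F)\<rparr>"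

lemma nat_trans_op: "nat_trans (op B) (op A) F H \<tau> \<longleftrightarrow> nat_trans B A H F \<tau>"
  by (auto simp: nat_trans_def)

lemma op_fun_cat_functor_sel [simp]:
  "is_functor B A F \<Longrightarrow> fo (op_fun_cat_functor B A) F = F"
  "nat_trans B A F H \<tau> \<Longrightarrow> fa (op_fun_cat_functor B A) (F, \<tau>, H) = (H, \<tau>, F)"
  by (simp_all add: op_fun_cat_functor_def)

text \<open>On objects the functor is the identity, so identity arrows witness essential
  surjectivity; on arrows, reversing triples is its own inverse.\<close>

lemma ff_eso_op_fun_cat_functor:
  assumes A: "category A"
  shows "ff_eso_functor (op (fun_cat B A)) (fun_cat (op B) (op A)) (op_fun_cat_functor B A)"
proof -
  interpret C: category "op (fun_cat B A)" using category_fun_cat[OF A] by simp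
  interpret D: category "fun_cat (op B) (op A)" by (rule category_fun_cat) (simp add: A)
  have "is_functor (op (fun_cat B A)) (fun_cat (op B) (op A)) (op_fun_cat_functor B A)"
  proof
    show "fo (op_fun_cat_functor B A) \<in> Ob (op (fun_cat B A)) \<rightarrow>\<^sub>E Ob (fun_cat (op B) (op A))"
      by (auto simp: op_fun_cat_functor_def)
    show "fa (op_fun_cat_functor B A) \<in> extensional (Arr (op (fun_cat B A)))"
      by (simp add: op_fun_cat_functor_def)
    show "fa (op_fun_cat_functor B A) (Ident (op (fun_cat B A)) F) =
        Ident (fun_cat (op B) (op A)) (fo (op_fun_cat_functor B A) F)" if "F \<in> Ob (op (fun_cat B A))" for F
      using that nat_trans_id[of B A F] by simp
    fix t assume "t \<in> Arr (op (fun_cat B A))"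
    then obtain F \<tau> H where t: "t = (F, \<tau>, H)" "nat_trans B A F H \<tau>" by (cases t) auto
    then have FH: "is_functor B A F" "is_functor B A H" by (simp_all add: nat_trans_def)
    show "fa (op_fun_cat_functor B A) t \<in> Hom (fun_cat (op B) (op A))
        (fo (op_fun_cat_functor B A) (Dom (op (fun_cat B A)) t))
        (fo (op_fun_cat_functor B A) (Cod (op (fun_cat B A)) t))"
      using t FH by (simp add: Hom_fun_cat nat_trans_op)
    fix s assume "s \<in> Arr (op (fun_cat B A))" "Dom (op (fun_cat B A)) s = Cod (op (fun_cat B A)) t"
    then obtain \<sigma> K where s: "s = (K, \<sigma>, F)" "nat_trans B A K F \<sigma>" using t by (cases s) auto
    show "fa (op_fun_cat_functor B A) (Comp (op (fun_cat B A)) s t) =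
        Comp (fun_cat (op B) (op A)) (fa (op_fun_cat_functor B A) s) (fa (op_fun_cat_functor B A) t)"
      using s t nat_trans_comp[OF s(2) t(2)] by simp
  qed
  moreover have "fully_faithful (op (fun_cat B A)) (fun_cat (op B) (op A)) (op_fun_cat_functor B A)"
    unfolding fully_faithful_def
    by (auto intro!: bij_betwI[where g="\<lambda>(H, \<tau>, F). (F, \<tau>, H)"] simp: Hom_fun_cat nat_trans_op)
  moreover have "ess_surjective (op (fun_cat B A)) (fun_cat (op B) (op A)) (op_fun_cat_functor B A)"
    unfolding ess_surjective_def
  proof
    fix F assume F: "F \<in> Ob (fun_cat (op B) (op A))"
    note id = D.id_Hom[OF F]
    have "is_iso (fun_cat (op B) (op A)) (Ident (fun_cat (op B) (op A)) F)"
      by (rule D.is_isoI[OF id id]) (use D.id_left[OF id] in auto)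
    then show "\<exists>c\<in>Ob (op (fun_cat B A)). \<exists>u\<in>Hom (fun_cat (op B) (op A)) (fo (op_fun_cat_functor B A) c) F.
        is_iso (fun_cat (op B) (op A)) u"
      using F id by (auto intro!: bexI[of _ F])
  qed
  ultimately show ?thesis by (simp add: ff_eso_functor_def ff_eso_functor_axioms_def)
qed

lemma fun_cat_creates_colimits:
  assumes B: "category B" and A: "category A" and co: "complete \<mu> (op A)"
  shows "jointly_create_limits \<mu> (op (fun_cat B A)) (op A) (Ob B) (eval_functor B A)"
proof -
  interpret ff_eso_functor "op (fun_cat B A)" "fun_cat (op B) (op A)" "op_fun_cat_functor B A"
    by (rule ff_eso_op_fun_cat_functor[OF A])
  have "jointly_create_limits \<mu> (fun_cat (op B) (op A)) (op A) (Ob (op B)) (eval_functor (op B) (op A))"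
    by (rule fun_cat_creates_limits) (simp_all add: A B co)
  then have *: "jointly_create_limits \<mu> (op (fun_cat B A)) (op A) (Ob B)
      (\<lambda>b. comp_functor (op (fun_cat B A)) (eval_functor (op B) (op A) b) (op_fun_cat_functor B A))"
    using jointly_create_limits by simp
  \<comment> \<open>Reversal keeps the middle entry of a triple, so evaluation at \<open>b\<close>
    corresponds to evaluation at \<open>b\<close>.\<close>
  have "comp_functor (op (fun_cat B A)) (eval_functor (op B) (op A) b) (op_fun_cat_functor B A) =
      eval_functor B A b" for b
    by (auto simp: comp_functor_def eval_functor_def restrict_def fun_eq_iff nat_trans_op)
  then show ?thesis using * by simp
qed

section \<open>Small sets\<close>

lemma universe_Cinfinite: "universe \<kappa> \<mu> \<Longrightarrow> Cinfinite \<kappa>"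
  by (simp add: universe_def)

lemma small_subset: "|B| <o \<kappa> \<Longrightarrow> A \<subseteq> B \<Longrightarrow> |A| <o \<kappa>"
  using card_of_mono1 ordLeq_ordLess_trans by blast

lemma small_image: "|A| <o \<kappa> \<Longrightarrow> |f ` A| <o \<kappa>"
  using card_of_image ordLeq_ordLess_trans by blast

lemma small_finite: "Cinfinite \<kappa> \<Longrightarrow> finite A \<Longrightarrow> |A| <o \<kappa>"
  by (rule Cfinite_ordLess_Cinfinite) (simp_all add: cfinite_def Field_card_of card_of_card_order_on)

text \<open>Regularity of \<open>\<kappa>\<close> enters here: regular infinite cardinals are stable
  under small sums of small sets.\<close>

lemma small_Sigma:
  assumes "universe \<kappa> \<mu>" "|I| <o \<kappa>" "\<And>i. i \<in> I \<Longrightarrow> |F i| <o \<kappa>"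
  shows "|SIGMA i:I. F i| <o \<kappa>"
  using assms by (auto simp: universe_def cinfinite_def intro: stable_elim regularCard_stable)

text \<open>Brings a small set of any type back into \<open>'u\<close>, the only type on which
  limits, colimits and total spaces may live.\<close>

lemma small_copy:
  assumes "|A| <o (\<kappa> :: 'u rel)"
  obtains e and B :: "'u set" where "bij_betw e A B" "|B| <o \<kappa>"
proof -
  obtain B :: "'u set" where "|A| =o |B|" "|B| <o \<kappa>"
    using assms internalize_card_of_ordLess[of A \<kappa>] by blast
  then show thesis using that card_of_ordIso[of A B] by blast
qed

text \<open>No order between \<open>\<mu>\<close> and \<open>\<kappa>\<close> is postulated; it is
  extracted from the exponential condition, because a set has no more elements than its set of
  two-valued functions.\<close>

lemma small_index:
  fixes \<kappa> :: "'u rel" and \<mu> :: "'j rel" and I :: "'j set"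
  assumes U: "universe \<kappa> \<mu>" and I: "|I| <o \<mu>"
  shows "|I| <o \<kappa>"
proof -
  note inf = universe_Cinfinite[OF U]
  \<comment> \<open>The exponential condition speaks about subsets of \<open>'u\<close>, so the base
    2 is realized by a two-element set there; one exists because \<open>\<kappa>\<close> is
    infinite.\<close>
  obtain e and B :: "'u set" where B: "bij_betw e (UNIV :: bool set) B" "|B| <o \<kappa>"
    using small_copy[OF small_finite[OF inf, of "UNIV :: bool set"]] by auto
  then have "ctwo \<le>o |B|"
    unfolding ctwo_def using card_of_ordIso ordIso_iff_ordLeq by blast
  then have "|I| \<le>o |B| ^c |I|" by (rule ordLeq_cexp2) (rule card_of_Card_order)
  moreover have "|B| ^c |I| <o \<kappa>" using U B(2) I by (simp add: universe_def)
  ultimately show ?thesis by (rule ordLeq_ordLess_trans)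
qed

text \<open>The product embeds in the functions from \<open>I\<close> to the union of the factors.
  Regularity bounds the union, the exponential condition bounds the functions.\<close>

lemma small_PiE:
  fixes \<kappa> :: "'u rel" and \<mu> :: "'j rel" and I :: "'j set" and F :: "'j \<Rightarrow> 'u set"
  assumes U: "universe \<kappa> \<mu>" and I: "|I| <o \<mu>" and F: "\<And>i. i \<in> I \<Longrightarrow> |F i| <o \<kappa>"
  shows "|PiE I F| <o \<kappa>"
proof -
  let ?A = "\<Union>i\<in>I. F i"
  have "|?A| <o \<kappa>"
    using card_of_UNION_Sigma small_Sigma[OF U small_index[OF U I], of F] F ordLeq_ordLess_trans by blast
  then have "|Func I ?A| <o \<kappa>"
    using U I by (simp add: universe_def cexp_def Field_card_of)
  moreover have "PiE I F \<subseteq> Func I ?A"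
    by (auto simp: Func_def PiE_def extensional_def)
  ultimately show ?thesis by (rule small_subset)
qed

section \<open>Pointed sets\<close>

lemma pset_cat_sel [simp]:
  "P \<in> Ob (pset_cat \<kappa>) \<longleftrightarrow> |fst P| <o \<kappa> \<and> snd P \<in> fst P"
  "Dom (pset_cat \<kappa>) = fst" "Cod (pset_cat \<kappa>) t = snd (snd t)"
  "Ident (pset_cat \<kappa>) P = (P, \<lambda>x\<in>fst P. x, P)"
  "Comp (pset_cat \<kappa>) (Q', g, R) (P, f, Q) = (P, compose (fst P) g f, R)"
  "(P, f, Q) \<in> Arr (pset_cat \<kappa>) \<longleftrightarrow> |fst P| <o \<kappa> \<and> snd P \<in> fst P \<and> |fst Q| <o \<kappa> \<and> snd Q \<in> fst Q \<and>
     f \<in> fst P \<rightarrow>\<^sub>E fst Q \<and> f (snd P) = snd Q"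
  by (auto simp: pset_cat_def split: prod.split)

lemma Hom_pset:
  "t \<in> Hom (pset_cat \<kappa>) P Q \<longleftrightarrow> P \<in> Ob (pset_cat \<kappa>) \<and> Q \<in> Ob (pset_cat \<kappa>) \<and>
     (\<exists>f. t = (P, f, Q) \<and> f \<in> fst P \<rightarrow>\<^sub>E fst Q \<and> f (snd P) = snd Q)"
  by (cases t) (auto simp: Hom_def)

lemma category_pset_cat: "category (pset_cat \<kappa>)"
proof
  fix t :: "('a set \<times> 'a) \<times> ('a \<Rightarrow> 'a) \<times> ('a set \<times> 'a)"
  assume t: "t \<in> Arr (pset_cat \<kappa>)"
  obtain P f Q where f: "t = (P, f, Q)" by (cases t) auto
  show "Dom (pset_cat \<kappa>) t \<in> Ob (pset_cat \<kappa>)" "Cod (pset_cat \<kappa>) t \<in> Ob (pset_cat \<kappa>)"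
    using t f by auto
  show "Comp (pset_cat \<kappa>) t (Ident (pset_cat \<kappa>) (Dom (pset_cat \<kappa>) t)) = t"
    "Comp (pset_cat \<kappa>) (Ident (pset_cat \<kappa>) (Cod (pset_cat \<kappa>) t)) t = t"
    using t f by (auto simp: compose_Id Id_compose PiE_def)
  fix s :: "('a set \<times> 'a) \<times> ('a \<Rightarrow> 'a) \<times> ('a set \<times> 'a)"
  assume s: "s \<in> Arr (pset_cat \<kappa>)" "Dom (pset_cat \<kappa>) s = Cod (pset_cat \<kappa>) t"
  then obtain g R where g: "s = (Q, g, R)" using f by (cases s) auto
  show "Comp (pset_cat \<kappa>) s t \<in> Arr (pset_cat \<kappa>)"
    "Dom (pset_cat \<kappa>) (Comp (pset_cat \<kappa>) s t) = Dom (pset_cat \<kappa>) t"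
    "Cod (pset_cat \<kappa>) (Comp (pset_cat \<kappa>) s t) = Cod (pset_cat \<kappa>) s"
    using t s f g by (auto simp: compose_eq PiE_iff)
  fix r :: "('a set \<times> 'a) \<times> ('a \<Rightarrow> 'a) \<times> ('a set \<times> 'a)"
  assume r: "r \<in> Arr (pset_cat \<kappa>)" "Dom (pset_cat \<kappa>) r = Cod (pset_cat \<kappa>) s"
  then obtain h V where h: "r = (R, h, V)" using g by (cases r) auto
  show "Comp (pset_cat \<kappa>) r (Comp (pset_cat \<kappa>) s t) = Comp (pset_cat \<kappa>) (Comp (pset_cat \<kappa>) r s) t"
    using t f g h by (auto simp: compose_def restrict_def fun_eq_iff PiE_iff)
qed auto

text \<open>The inverse bijection is again pointed, since \<open>f\<close> matches the two base
  points.\<close>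

lemma pset_isoI:
  assumes "(P, f, Q) \<in> Hom (pset_cat \<kappa>) P Q" "bij_betw f (fst P) (fst Q)"
  shows "is_iso (pset_cat \<kappa>) (P, f, Q)"
proof (rule category.is_isoI[OF category_pset_cat assms(1)])
  let ?g = "\<lambda>y\<in>fst Q. inv_into (fst P) f y"
  show "(Q, ?g, P) \<in> Hom (pset_cat \<kappa>) Q P"
    using assms inv_into_f_eq[of f "fst P" "snd P" "snd Q"] by (auto simp: Hom_pset bij_betw_def inv_into_into)
  show "Comp (pset_cat \<kappa>) (Q, ?g, P) (P, f, Q) = Ident (pset_cat \<kappa>) P"
    using assms by (auto simp: Hom_pset bij_betw_def compose_def intro!: restrict_ext)
  show "Comp (pset_cat \<kappa>) (P, f, Q) (Q, ?g, P) = Ident (pset_cat \<kappa>) Q"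
    using assms by (auto simp: bij_betw_def compose_def f_inv_into_f intro!: restrict_ext)
qed

text \<open>The limit is the set \<open>L0\<close> of compatible families, based at the family of
  base points. Its elements are functions on \<open>'j\<close>, so a copy \<open>L\<close> in
  \<open>'u\<close> replaces it, and the legs decode with \<open>i\<close> before
  projecting.\<close>

lemma pset_complete:
  fixes \<kappa> :: "'u rel" and \<mu> :: "'j rel"
  assumes U: "universe \<kappa> \<mu>"
  shows "complete \<mu> (pset_cat \<kappa> :: ('u set \<times> 'u, _) cat)"
  unfolding complete_def
proof (intro allI impI)
  fix J :: "('j, 'j) cat" and D :: "('j, 'j, 'u set \<times> 'u, _) cfun"
  assume small: "small_diagram \<mu> J (pset_cat \<kappa>) D"
  then have D: "is_functor J (pset_cat \<kappa>) D" by (simp add: small_diagram_def)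
  interpret D: is_functor J "pset_cat \<kappa>" D by fact
  define S where "S j = fst (fo D j)" for j
  define b where "b j = snd (fo D j)" for j
  define d where "d u = fst (snd (fa D u))" for u
  have Sb: "fo D j = (S j, b j)" "|S j| <o \<kappa>" "b j \<in> S j" if "j \<in> Ob J" for j
    using D.fo_Ob[OF that] by (simp_all add: S_def b_def)
  have d: "fa D u = (fo D j, d u, fo D k)" "d u \<in> S j \<rightarrow>\<^sub>E S k" "d u (b j) = b k" if "u \<in> Hom J j k" for u j k
    using D.fa_Hom[OF that] by (auto simp: Hom_pset d_def S_def b_def)
  define L0 where "L0 = {x \<in> PiE (Ob J) S. \<forall>j k. \<forall>u \<in> Hom J j k. d u (x j) = x k}"
  have "|L0| <o \<kappa>"
    by (rule small_subset[OF small_PiE[OF U, of "Ob J" S]])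
      (use small Sb in \<open>auto simp: L0_def small_diagram_def\<close>)
  then obtain e and L :: "'u set" where e: "bij_betw e L0 L" and L: "|L| <o \<kappa>"
    using small_copy by blast
  define i where "i = inv_into L0 e"
  have ie: "i (e x) = x" if "x \<in> L0" for x using that e by (simp add: i_def bij_betw_def)
  have ei: "e (i y) = y" "i y \<in> L0" if "y \<in> L" for y
    using that e by (auto simp: i_def bij_betw_def f_inv_into_f inv_into_into)
  have eL: "e x \<in> L" if "x \<in> L0" for x using that e by (auto simp: bij_betw_def)
  have L0S: "x j \<in> S j" if "x \<in> L0" "j \<in> Ob J" for x j using that by (auto simp: L0_def)
  \<comment> \<open>This family is compatible because the transition maps are pointed.\<close>
  define x0 where "x0 = restrict b (Ob J)"
  have x0: "x0 \<in> L0"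
    using Sb(3) d(3) D.dom.Hom_Ob by (fastforce simp: x0_def L0_def)
  define X where "X = (L, e x0)"
  have X: "X \<in> Ob (pset_cat \<kappa>)" using L eL x0 by (simp add: X_def)
  define \<pi> where "\<pi> = (\<lambda>j\<in>Ob J. (X, \<lambda>y\<in>L. i y j, fo D j))"
  have \<pi>H: "\<pi> j \<in> Hom (pset_cat \<kappa>) X (fo D j)" if j: "j \<in> Ob J" for j
    using X D.fo_Ob[OF j] L0S[OF ei(2) j] j
    by (auto simp: \<pi>_def Hom_pset X_def eL x0 ie S_def) (simp add: x0_def b_def)
  have "is_limit J (pset_cat \<kappa>) D X \<pi>"
  proof (rule is_limitI)
    show "is_cone J (pset_cat \<kappa>) D X \<pi>"
    proof (rule is_coneI)
      fix u j k assume u: "u \<in> Hom J j k" and jk: "j \<in> Ob J" "k \<in> Ob J"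
      have "d u (i y j) = i y k" if "y \<in> L" for y
        using ei(2)[OF that] u by (auto simp: L0_def)
      then show "Comp (pset_cat \<kappa>) (fa D u) (\<pi> j) = \<pi> k"
        using jk by (auto simp: d(1)[OF u] \<pi>_def X_def compose_def intro!: restrict_ext)
    qed (use X \<pi>H in \<open>auto simp: \<pi>_def D.dom.category_axioms\<close>)
    fix Y h k assume "h \<in> Hom (pset_cat \<kappa>) Y X" "k \<in> Hom (pset_cat \<kappa>) Y X"
      and eq: "\<And>j. j \<in> Ob J \<Longrightarrow> Comp (pset_cat \<kappa>) (\<pi> j) h = Comp (pset_cat \<kappa>) (\<pi> j) k"
    then obtain f g where f: "h = (Y, f, X)" "f \<in> fst Y \<rightarrow>\<^sub>E L" and g: "k = (Y, g, X)" "g \<in> fst Y \<rightarrow>\<^sub>E L"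
      by (auto simp: Hom_pset X_def)
    have "f y = g y" if y: "y \<in> fst Y" for y
    proof -
      have fg: "f y \<in> L" "g y \<in> L" using f(2) g(2) y by auto
      have "i (f y) j = i (g y) j" if "j \<in> Ob J" for j
        using eq[OF that] that fg y by (auto simp: f(1) g(1) \<pi>_def compose_def dest: fun_cong[where x=y])
      then have "i (f y) = i (g y)"
        using ei(2)[OF fg(1)] ei(2)[OF fg(2)] by (auto simp: L0_def intro: PiE_ext)
      then show ?thesis using ei(1)[OF fg(1)] ei(1)[OF fg(2)] by metis
    qed
    then show "h = k" using f g by (auto intro: PiE_ext)
  next
    fix Y \<rho> assume \<rho>: "is_cone J (pset_cat \<kappa>) D Y \<rho>"
    define r where "r j = fst (snd (\<rho> j))" for j
    have Y: "Y \<in> Ob (pset_cat \<kappa>)" using \<rho> by (simp add: is_cone_def)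
    have r: "\<rho> j = (Y, r j, fo D j)" "r j \<in> fst Y \<rightarrow>\<^sub>E S j" "r j (snd Y) = b j" if "j \<in> Ob J" for j
      using is_cone_Hom[OF \<rho> that] by (auto simp: Hom_pset r_def S_def b_def)
    have rL: "(\<lambda>j\<in>Ob J. r j y) \<in> L0" if y: "y \<in> fst Y" for y
    proof -
      have "d u (r j y) = r k y" if u: "u \<in> Hom J j k" for u j k
        using is_cone_commute[OF \<rho> u] D.dom.Hom_Ob[OF u] y
        by (auto simp: d(1)[OF u] r(1) compose_def dest: fun_cong[where x=y])
      then show ?thesis using r(2) y D.dom.Hom_Ob by (fastforce simp: L0_def)
    qed
    let ?h = "\<lambda>y\<in>fst Y. e (\<lambda>j\<in>Ob J. r j y)"
    have "(\<lambda>j\<in>Ob J. r j (snd Y)) = x0" using r(3) by (auto simp: x0_def)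
    then have "(Y, ?h, X) \<in> Hom (pset_cat \<kappa>) Y X"
      using X Y eL rL by (auto simp: Hom_pset X_def)
    moreover have "Comp (pset_cat \<kappa>) (\<pi> j) (Y, ?h, X) = \<rho> j" if j: "j \<in> Ob J" for j
    proof -
      have "compose (fst Y) (\<lambda>y\<in>L. i y j) ?h = r j"
        using r(2)[OF j] eL rL ie j
        by (auto simp: compose_def PiE_def intro!: extensionalityI[where A="fst Y"])
      then show ?thesis using j by (simp add: \<pi>_def r(1))
    qed
    ultimately show "\<exists>h\<in>Hom (pset_cat \<kappa>) Y X. \<forall>j\<in>Ob J. Comp (pset_cat \<kappa>) (\<pi> j) h = \<rho> j" by blast
  qed
  then show "\<exists>X \<pi>. is_limit J (pset_cat \<kappa>) D X \<pi>" by blast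
qed

text \<open>The colimit is the disjoint union of the sets of the diagram and a base point, modulo the
  relation that identifies two elements whenever every cocone does. This relation is automatically
  an equivalence relation, and maps out of the quotient are well defined for free.\<close>

lemma pset_cocomplete:
  fixes \<kappa> :: "'u rel" and \<mu> :: "'j rel"
  assumes U: "universe \<kappa> \<mu>"
  shows "complete \<mu> (op (pset_cat \<kappa> :: ('u set \<times> 'u, _) cat))"
  unfolding complete_def
proof (intro allI impI)
  let ?P = "pset_cat \<kappa> :: ('u set \<times> 'u, _) cat"
  fix J :: "('j, 'j) cat" and D :: "('j, 'j, 'u set \<times> 'u, _) cfun"
  assume small: "small_diagram \<mu> J (op ?P) D"
  then have D: "is_functor J (op ?P) D" by (simp add: small_diagram_def)
  interpret D: is_functor J "op ?P" D by fact
  define S where "S j = fst (fo D j)" for j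
  define b where "b j = snd (fo D j)" for j
  define d where "d u = fst (snd (fa D u))" for u
  have Sb: "fo D j = (S j, b j)" "|S j| <o \<kappa>" "b j \<in> S j" if "j \<in> Ob J" for j
    using D.fo_Ob[OF that] by (simp_all add: S_def b_def)
  \<comment> \<open>The diagram takes values in the opposite category: an arrow from
    \<open>j\<close> to \<open>k\<close> gives a map from \<open>S k\<close> to
    \<open>S j\<close>.\<close>
  have d: "fa D u = (fo D k, d u, fo D j)" "d u \<in> S k \<rightarrow>\<^sub>E S j" "d u (b k) = b j" if "u \<in> Hom J j k" for u j k
    using D.fa_Hom[OF that] by (auto simp: Hom_pset d_def S_def b_def)
  \<comment> \<open>\<open>None\<close> is the added base point. It keeps the quotient pointed even
    for an empty diagram, and \<open>E0\<close> identifies it with every \<open>b j\<close>.\<close>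
  define T where "T = insert None (Some ` Sigma (Ob J) S)"
  define val where "val Y \<rho> t = (case t of None \<Rightarrow> snd Y | Some (j, x) \<Rightarrow> fst (snd (\<rho> j)) x)"
    for Y :: "'u set \<times> 'u" and \<rho> :: "'j \<Rightarrow> ('u set \<times> 'u) \<times> ('u \<Rightarrow> 'u) \<times> 'u set \<times> 'u"
      and t :: "('j \<times> 'u) option"
  define E where "E s t \<longleftrightarrow> (\<forall>Y \<rho>. is_cone J (op ?P) D Y \<rho> \<longrightarrow> val Y \<rho> s = val Y \<rho> t)" for s t
  define cl where "cl t = {s. E s t}" for t
  have cl: "cl s = cl t \<longleftrightarrow> E s t" for s t by (auto simp: cl_def E_def)
  have "|Ob J| <o \<kappa>" using small by (intro small_index[OF U]) (simp add: small_diagram_def)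
  then have "|Some ` Sigma (Ob J) S| <o \<kappa>"
    using small_image small_Sigma[OF U] Sb(2) by blast
  then have "|T| <o \<kappa>"
    using Un_Cinfinite_bound_strict[OF small_finite[OF universe_Cinfinite[OF U], of "{None}"]]
      universe_Cinfinite[OF U] by (simp add: T_def)
  then have "|cl ` T| <o \<kappa>" by (rule small_image)
  then obtain e and Q :: "'u set" where e: "bij_betw e (cl ` T) Q" and Q: "|Q| <o \<kappa>"
    using small_copy by blast
  define q where "q t = e (cl t)" for t
  have qQ: "q t \<in> Q" if "t \<in> T" for t using that e by (auto simp: q_def bij_betw_def)
  have qeq: "q s = q t \<longleftrightarrow> E s t" if "s \<in> T" "t \<in> T" for s t
    using that e by (auto simp: q_def bij_betw_def cl[symmetric] dest: inj_onD)
  have qT: "q ` T = Q" using e by (auto simp: q_def bij_betw_def)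
  have T: "None \<in> T" "\<And>j x. j \<in> Ob J \<Longrightarrow> x \<in> S j \<Longrightarrow> Some (j, x) \<in> T" by (auto simp: T_def)
  have cone: "\<rho> j = (fo D j, fst (snd (\<rho> j)), Y)" "fst (snd (\<rho> j)) \<in> S j \<rightarrow>\<^sub>E fst Y"
    "fst (snd (\<rho> j)) (b j) = snd Y" if "is_cone J (op ?P) D Y \<rho>" "j \<in> Ob J" for Y \<rho> j
    using is_cone_Hom[OF that] by (auto simp: Hom_pset S_def b_def)
  define X where "X = (Q, q None)"
  have X: "X \<in> Ob ?P" using Q qQ T by (simp add: X_def)
  define \<iota> where "\<iota> = (\<lambda>j\<in>Ob J. (fo D j, \<lambda>x\<in>S j. q (Some (j, x)), X))"
  have E0: "E (Some (j, b j)) None" if "j \<in> Ob J" for j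
    using cone(3) that by (auto simp: E_def val_def)
  have \<iota>H: "\<iota> j \<in> Hom (op ?P) X (fo D j)" if j: "j \<in> Ob J" for j
    using X D.fo_Ob[OF j] j qQ T Sb[OF j] qeq[OF T(2) T(1)] E0[OF j]
    by (auto simp: \<iota>_def Hom_pset X_def)
  have "is_limit J (op ?P) D X \<iota>"
  proof (rule is_limitI)
    show "is_cone J (op ?P) D X \<iota>"
    proof (rule is_coneI)
      fix u j k assume u: "u \<in> Hom J j k" and jk: "j \<in> Ob J" "k \<in> Ob J"
      \<comment> \<open>The two elements share a class because the cone equation for
        \<open>u\<close> makes every cone agree on them.\<close>
      have "q (Some (j, d u x)) = q (Some (k, x))" if x: "x \<in> S k" for x
      proof -
        have dx: "d u x \<in> S j" using d(2)[OF u] x by auto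
        have "fst (snd (\<rho> j)) (d u x) = fst (snd (\<rho> k)) x" if \<rho>: "is_cone J (op ?P) D Y \<rho>" for Y \<rho>
        proof -
          have "Comp ?P (\<rho> j) (fa D u) = \<rho> k" using is_cone_commute[OF \<rho> u] by simp
          then have "compose (S k) (fst (snd (\<rho> j))) (d u) = fst (snd (\<rho> k))"
            by (subst (asm) cone(1)[OF \<rho> jk(1)], subst (asm) cone(1)[OF \<rho> jk(2)])
              (simp add: d(1)[OF u] S_def)
          then show ?thesis using compose_eq[OF x] by metis
        qed
        then show ?thesis using qeq[OF T(2)[OF jk(1) dx] T(2)[OF jk(2) x]] by (simp add: E_def val_def)
      qed
      then show "Comp (op ?P) (fa D u) (\<iota> j) = \<iota> k"
        using jk d(2)[OF u]
        by (auto simp: d(1)[OF u] \<iota>_def X_def compose_def S_def[symmetric] intro!: restrict_ext)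
    qed (use X \<iota>H in \<open>auto simp: \<iota>_def D.dom.category_axioms\<close>)
    fix Y h k assume "h \<in> Hom (op ?P) Y X" "k \<in> Hom (op ?P) Y X"
      and eq: "\<And>j. j \<in> Ob J \<Longrightarrow> Comp (op ?P) (\<iota> j) h = Comp (op ?P) (\<iota> j) k"
    then obtain f g where f: "h = (X, f, Y)" "f \<in> Q \<rightarrow>\<^sub>E fst Y" "f (q None) = snd Y"
      and g: "k = (X, g, Y)" "g \<in> Q \<rightarrow>\<^sub>E fst Y" "g (q None) = snd Y"
      by (auto simp: Hom_pset X_def)
    \<comment> \<open>An element of \<open>Q\<close> is the class of the base point, where pointed
      maps agree, or comes from some \<open>S j\<close>, where the leg at \<open>j\<close>
      decides.\<close>
    have "f (q t) = g (q t)" if t: "t \<in> T" for t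
    proof (cases t)
      case (Some a)
      then obtain j x where jx: "t = Some (j, x)" "j \<in> Ob J" "x \<in> S j" using t by (auto simp: T_def)
      show ?thesis
        using eq[OF jx(2)] jx by (auto simp: f(1) g(1) \<iota>_def S_def compose_def dest: fun_cong[where x=x])
    qed (simp add: f g)
    then have "f = g" using f(2) g(2) qT by (intro PiE_ext[OF f(2) g(2)]) auto
    then show "h = k" using f g by simp
  next
    fix Y \<rho> assume \<rho>: "is_cone J (op ?P) D Y \<rho>"
    have Y: "Y \<in> Ob ?P" using \<rho> by (simp add: is_cone_def)
    define h where "h = (\<lambda>y\<in>Q. val Y \<rho> (inv_into T q y))"
    have hq: "h (q t) = val Y \<rho> t" if t: "t \<in> T" for t
    proof -
      have "E (inv_into T q (q t)) t"
        using qeq[of "inv_into T q (q t)" t] t by (simp add: f_inv_into_f inv_into_into)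
      then show ?thesis using qQ[OF t] \<rho> unfolding h_def E_def by (simp del: split_paired_All)
    qed
    have valY: "val Y \<rho> t \<in> fst Y" if "t \<in> T" for t
      using that Y PiE_mem[OF cone(2)[OF \<rho>]] by (auto simp: T_def val_def)
    have "h \<in> Q \<rightarrow>\<^sub>E fst Y" using valY hq qT by (auto simp: h_def inv_into_into)
    moreover have "h (q None) = snd Y" using hq[OF T(1)] by (simp add: val_def)
    ultimately have "(X, h, Y) \<in> Hom (op ?P) Y X" using X Y by (simp add: Hom_pset X_def)
    moreover have "Comp (op ?P) (\<iota> j) (X, h, Y) = \<rho> j" if j: "j \<in> Ob J" for j
    proof -
      have "compose (S j) h (\<lambda>x\<in>S j. q (Some (j, x))) = fst (snd (\<rho> j))"
        using cone(2)[OF \<rho> j] hq[OF T(2)[OF j]]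
        by (auto simp: compose_def PiE_def val_def intro!: extensionalityI[where A="S j"])
      then show ?thesis using j cone(1)[OF \<rho> j] by (simp add: \<iota>_def S_def)
    qed
    ultimately show "\<exists>h\<in>Hom (op ?P) Y X. \<forall>j\<in>Ob J. Comp (op ?P) (\<iota> j) h = \<rho> j" by blast
  qed
  then show "\<exists>X \<pi>. is_limit J (op ?P) D X \<pi>" by blast
qed

section \<open>Equivariant simplicial sets\<close>

lemma Delta_sel [simp]:
  "Ob Delta = UNIV" "Dom Delta = fst" "Cod Delta a = snd (snd a)"
  by (auto simp: Delta_def split: prod.split)

lemma Hom_Delta: "a \<in> Hom Delta m n \<longleftrightarrow> a \<in> Arr Delta \<and> fst a = m \<and> snd (snd a) = n"
  by (simp add: Hom_def)

lemma set_cat_sel [simp]: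
  "Dom (set_cat \<kappa>) = fst" "Cod (set_cat \<kappa>) t = snd (snd t)" "A \<in> Ob (set_cat \<kappa>) \<longleftrightarrow> |A| <o \<kappa>"
  "Ident (set_cat \<kappa>) A = (A, \<lambda>x\<in>A. x, A)"
  "Comp (set_cat \<kappa>) (B', g, C) (A, f, B) = (A, compose A g f, C)"
  by (auto simp: set_cat_def split: prod.split)

lemma Hom_set_cat:
  "t \<in> Hom (set_cat \<kappa>) A B \<longleftrightarrow> |A| <o \<kappa> \<and> |B| <o \<kappa> \<and> (\<exists>f. t = (A, f, B) \<and> f \<in> A \<rightarrow>\<^sub>E B)"
  by (cases t) (auto simp: Hom_def set_cat_def)

lemma category_set_cat: "category (set_cat \<kappa>)"
proof
  fix t :: "'a set \<times> ('a \<Rightarrow> 'a) \<times> 'a set"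
  assume "t \<in> Arr (set_cat \<kappa>)"
  then obtain P f Q where f: "t = (P, f, Q)" and t: "|P| <o \<kappa>" "|Q| <o \<kappa>" "f \<in> P \<rightarrow>\<^sub>E Q"
    by (auto simp: set_cat_def)
  show "Dom (set_cat \<kappa>) t \<in> Ob (set_cat \<kappa>)" "Cod (set_cat \<kappa>) t \<in> Ob (set_cat \<kappa>)"
    using t f by auto
  show "Comp (set_cat \<kappa>) t (Ident (set_cat \<kappa>) (Dom (set_cat \<kappa>) t)) = t"
    "Comp (set_cat \<kappa>) (Ident (set_cat \<kappa>) (Cod (set_cat \<kappa>) t)) t = t"
    using t f by (auto simp: compose_Id Id_compose PiE_def)
  fix s :: "'a set \<times> ('a \<Rightarrow> 'a) \<times> 'a set"
  assume "s \<in> Arr (set_cat \<kappa>)" "Dom (set_cat \<kappa>) s = Cod (set_cat \<kappa>) t"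
  then obtain g R where g: "s = (Q, g, R)" "|R| <o \<kappa>" "g \<in> Q \<rightarrow>\<^sub>E R"
    using f by (auto simp: set_cat_def)
  show "Comp (set_cat \<kappa>) s t \<in> Arr (set_cat \<kappa>)"
    "Dom (set_cat \<kappa>) (Comp (set_cat \<kappa>) s t) = Dom (set_cat \<kappa>) t"
    "Cod (set_cat \<kappa>) (Comp (set_cat \<kappa>) s t) = Cod (set_cat \<kappa>) s"
    using t f g by (auto simp: set_cat_def compose_eq PiE_iff)
  fix r :: "'a set \<times> ('a \<Rightarrow> 'a) \<times> 'a set"
  assume "r \<in> Arr (set_cat \<kappa>)" "Dom (set_cat \<kappa>) r = Cod (set_cat \<kappa>) s"
  then obtain h V where h: "r = (R, h, V)" using g by (cases r) auto
  show "Comp (set_cat \<kappa>) r (Comp (set_cat \<kappa>) s t) = Comp (set_cat \<kappa>) (Comp (set_cat \<kappa>) r s) t"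
    using t f g h by (auto simp: compose_def restrict_def fun_eq_iff PiE_iff)
qed (auto simp: set_cat_def)

text \<open>The joint action of an operator \<open>a\<close> and an element \<open>g\<close> on a simplex, i.e. of a morphism of
  the equivariant simplex category. It determines both the simplicial structure and the action, and
  a graded set with such a joint action is an equivariant simplicial set (\<open>gsset_of\<close>).\<close>

definition move :: "('a, 'g) gsset \<Rightarrow> op_arr \<Rightarrow> 'g \<Rightarrow> 'a \<Rightarrow> 'a" where
  "move Y a g y = act Y (fst a) (smap (sset Y) a y, g)"

definition gsset_of :: "'g smonoid \<Rightarrow> (nat \<Rightarrow> 'a set) \<Rightarrow> (op_arr \<Rightarrow> 'g \<Rightarrow> 'a \<Rightarrow> 'a) \<Rightarrow> ('a, 'g) gsset" where
  "gsset_of G S M =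
     \<lparr>sset = \<lparr>fo = S, fa = \<lambda>a\<in>Arr Delta.
        (S (snd (snd a)), \<lambda>y\<in>S (snd (snd a)). M a \<one>\<^bsub>fo G (fst a)\<^esub> y, S (fst a))\<rparr>,
      act = \<lambda>n. \<lambda>(y, g)\<in>S n \<times> carrier (fo G n). M (Ident Delta n) g y\<rparr>"

section \<open>Structure maps of a simplicial monoid\<close>

locale simplicial_monoid_action =
  fixes \<kappa> :: "'u rel" and G :: "'g smonoid"
  assumes G: "simplicial_monoid \<kappa> G"
begin

sublocale G: is_functor "op Delta" "mon_cat \<kappa>" G
  using G by (simp add: simplicial_monoid_def)

lemma category_Delta: "category Delta"
  using G.dom.category_axioms by simp

sublocale Delta: category Delta
  by (rule category_Delta)

lemma monoid_G: "monoid (fo G n)"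
  using G.fo_Ob[of n] by (simp add: mon_cat_def)

lemmas one_G = monoid.one_closed[OF monoid_G]
  and mult_G = monoid.m_closed[OF monoid_G]
  and assoc_G = monoid.m_assoc[OF monoid_G]
  and unit_G = monoid.l_one[OF monoid_G] monoid.r_one[OF monoid_G]

lemma smap_G:
  assumes "a \<in> Hom Delta m n"
  shows "fa G a = (fo G n, smap G a, fo G m)" "smap G a \<in> hom (fo G n) (fo G m)"
    "smap G a \<one>\<^bsub>fo G n\<^esub> = \<one>\<^bsub>fo G m\<^esub>"
proof -
  have "fa G a \<in> Arr (mon_cat \<kappa>)" "Dom (mon_cat \<kappa>) (fa G a) = fo G n" "Cod (mon_cat \<kappa>) (fa G a) = fo G m"
    using G.fa_Hom[of a n m] assms by (auto simp: Hom_def)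
  then show "fa G a = (fo G n, smap G a, fo G m)" "smap G a \<in> hom (fo G n) (fo G m)"
    "smap G a \<one>\<^bsub>fo G n\<^esub> = \<one>\<^bsub>fo G m\<^esub>"
    by (auto simp: mon_cat_def smap_def)
qed

lemma smap_G_closed: "\<lbrakk>a \<in> Hom Delta m n; g \<in> carrier (fo G n)\<rbrakk> \<Longrightarrow> smap G a g \<in> carrier (fo G m)"
  by (rule hom_in_carrier[OF smap_G(2)])

lemma smap_G_mult:
  "\<lbrakk>a \<in> Hom Delta m n; g \<in> carrier (fo G n); h \<in> carrier (fo G n)\<rbrakk>
    \<Longrightarrow> smap G a (g \<otimes>\<^bsub>fo G n\<^esub> h) = smap G a g \<otimes>\<^bsub>fo G m\<^esub> smap G a h"
  by (rule hom_mult[OF smap_G(2)])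

lemma smap_G_id: "g \<in> carrier (fo G n) \<Longrightarrow> smap G (Ident Delta n) g = g"
  using G.fa_Ident[of n] by (simp add: smap_def mon_cat_def)

lemma smap_G_comp:
  assumes "a \<in> Hom Delta m n" "b \<in> Hom Delta n p" "g \<in> carrier (fo G p)"
  shows "smap G (Comp Delta b a) g = smap G a (smap G b g)"
proof -
  have "fa G (Comp Delta b a) = Comp (mon_cat \<kappa>) (fa G a) (fa G b)"
    using G.fa_Comp_Hom[of b p n a m] assms by simp
  then have "smap G (Comp Delta b a) = compose (carrier (fo G p)) (smap G a) (smap G b)"
    unfolding smap_G(1)[OF assms(1)] smap_G(1)[OF assms(2)]
    by (simp add: smap_def[of G "Comp Delta b a"] mon_cat_def)
  then show ?thesis using assms(3) by (simp add: compose_eq)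
qed

end

section \<open>Equivariant simplicial sets and their moves\<close>

locale equivariant_sset = simplicial_monoid_action \<kappa> G
  for \<kappa> :: "'u rel" and G :: "'g smonoid" and Y :: "('a, 'g) gsset" +
  assumes Y: "G_simplicial_set \<kappa> G Y"
begin

sublocale Y: is_functor "op Delta" "set_cat \<kappa>" "sset Y"
  using Y unfolding G_simplicial_set_def simplicial_set_def by blast

lemma splx_small: "|splx Y n| <o \<kappa>"
  using Y.fo_Ob[of n] by simp

lemma smap_Y:
  assumes "a \<in> Hom Delta m n"
  shows "fa (sset Y) a = (splx Y n, smap (sset Y) a, splx Y m)" "smap (sset Y) a \<in> splx Y n \<rightarrow>\<^sub>E splx Y m"
  using Y.fa_Hom[of a n m] assms by (auto simp: Hom_set_cat smap_def)

lemma smap_in: "\<lbrakk>a \<in> Hom Delta m n; y \<in> splx Y n\<rbrakk> \<Longrightarrow> smap (sset Y) a y \<in> splx Y m"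
  by (rule PiE_mem[OF smap_Y(2)])

lemma smap_id: "y \<in> splx Y n \<Longrightarrow> smap (sset Y) (Ident Delta n) y = y"
  using Y.fa_Ident[of n] by (simp add: smap_def)

lemma smap_comp:
  assumes "a \<in> Hom Delta m n" "b \<in> Hom Delta n p" "y \<in> splx Y p"
  shows "smap (sset Y) (Comp Delta b a) y = smap (sset Y) a (smap (sset Y) b y)"
proof -
  have "fa (sset Y) (Comp Delta b a) = Comp (set_cat \<kappa>) (fa (sset Y) a) (fa (sset Y) b)"
    using Y.fa_Comp_Hom[of b p n a m] assms by simp
  then have "smap (sset Y) (Comp Delta b a) = compose (splx Y p) (smap (sset Y) a) (smap (sset Y) b)"
    unfolding smap_Y(1)[OF assms(1)] smap_Y(1)[OF assms(2)]
    by (simp add: smap_def[of "sset Y" "Comp Delta b a"])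
  then show ?thesis using assms(3) by (simp add: compose_eq)
qed

lemma act_in: "\<lbrakk>y \<in> splx Y n; g \<in> carrier (fo G n)\<rbrakk> \<Longrightarrow> act Y n (y, g) \<in> splx Y n"
  using Y by (auto simp: G_simplicial_set_def)

lemma act_one: "y \<in> splx Y n \<Longrightarrow> act Y n (y, \<one>\<^bsub>fo G n\<^esub>) = y"
  using Y by (auto simp: G_simplicial_set_def)

lemma act_act: "\<lbrakk>y \<in> splx Y n; g \<in> carrier (fo G n); h \<in> carrier (fo G n)\<rbrakk>
    \<Longrightarrow> act Y n (act Y n (y, g), h) = act Y n (y, g \<otimes>\<^bsub>fo G n\<^esub> h)"
  using Y by (auto simp: G_simplicial_set_def)

lemma smap_act: "\<lbrakk>a \<in> Hom Delta m n; y \<in> splx Y n; g \<in> carrier (fo G n)\<rbrakk>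
    \<Longrightarrow> smap (sset Y) a (act Y n (y, g)) = act Y m (smap (sset Y) a y, smap G a g)"
  using Y by (cases a) (auto simp: G_simplicial_set_def Hom_Delta)

lemma move_in: "\<lbrakk>a \<in> Hom Delta m n; g \<in> carrier (fo G m); y \<in> splx Y n\<rbrakk> \<Longrightarrow> move Y a g y \<in> splx Y m"
  using smap_in[of a m n y] act_in[of _ m g] by (auto simp: move_def Hom_Delta)

lemma move_id_act: "y \<in> splx Y n \<Longrightarrow> move Y (Ident Delta n) g y = act Y n (y, g)"
  using Delta.id_Hom[of n] by (simp add: move_def smap_id Hom_Delta)

lemma move_id: "y \<in> splx Y n \<Longrightarrow> move Y (Ident Delta n) \<one>\<^bsub>fo G n\<^esub> y = y"
  by (simp add: move_id_act act_one)

lemma move_one: "\<lbrakk>a \<in> Hom Delta m n; y \<in> splx Y n\<rbrakk> \<Longrightarrow> move Y a \<one>\<^bsub>fo G m\<^esub> y = smap (sset Y) a y"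
  using smap_in[of a m n y] act_one by (simp add: move_def Hom_Delta)

text \<open>An operator \<open>a\<close> passes an action by \<open>h\<close> at the price of
  replacing \<open>h\<close> by its image under \<open>a\<close> in \<open>G\<close>. This is the
  origin of the composition law of the equivariant simplex category and of the order of its two
  factors.\<close>

lemma move_comp:
  assumes a: "a \<in> Hom Delta m n" and b: "b \<in> Hom Delta n p"
    and g: "g \<in> carrier (fo G m)" and h: "h \<in> carrier (fo G n)" and y: "y \<in> splx Y p"
  shows "move Y (Comp Delta b a) (smap G a h \<otimes>\<^bsub>fo G m\<^esub> g) y = move Y a g (move Y b h y)"
proof -
  have sb: "smap (sset Y) b y \<in> splx Y n" using smap_in[OF b y] .
  have "move Y a g (move Y b h y) = act Y m (act Y m (smap (sset Y) a (smap (sset Y) b y), smap G a h), g)"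
    using a b smap_act[OF a sb h] by (simp add: move_def Hom_Delta)
  also have "\<dots> = act Y m (smap (sset Y) (Comp Delta b a) y, smap G a h \<otimes>\<^bsub>fo G m\<^esub> g)"
    by (simp add: act_act smap_in[OF a sb] smap_G_closed[OF a h] g smap_comp[OF a b y])
  finally show ?thesis using Delta.comp_Hom[OF a b] by (simp add: move_def Hom_Delta)
qed

end

text \<open>Operators are \<open>M\<close> at the unit, the action is \<open>M\<close> at the
  identity operator. The functor and action laws are instances of \<open>M_comp\<close> in which
  some of the operators and monoid elements are trivial.\<close>

lemma (in simplicial_monoid_action) gsset_of:
  assumes S: "\<And>n. |S n| <o \<kappa>"
    and M: "\<And>a m n g y. \<lbrakk>a \<in> Hom Delta m n; g \<in> carrier (fo G m); y \<in> S n\<rbrakk> \<Longrightarrow> M a g y \<in> S m"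
    and M_id: "\<And>n y. y \<in> S n \<Longrightarrow> M (Ident Delta n) \<one>\<^bsub>fo G n\<^esub> y = y"
    and M_comp: "\<And>a b m n p g h y. \<lbrakk>a \<in> Hom Delta m n; b \<in> Hom Delta n p; g \<in> carrier (fo G m);
      h \<in> carrier (fo G n); y \<in> S p\<rbrakk>
      \<Longrightarrow> M (Comp Delta b a) (smap G a h \<otimes>\<^bsub>fo G m\<^esub> g) y = M a g (M b h y)"
  shows "G_simplicial_set \<kappa> G (gsset_of G S M)"
    and "\<lbrakk>a \<in> Hom Delta m n; g \<in> carrier (fo G m); y \<in> S n\<rbrakk> \<Longrightarrow> move (gsset_of G S M) a g y = M a g y"
proof -
  let ?Y = "gsset_of G S M"
  note Id = Delta.id_Hom[simplified]
  have smap: "smap (sset ?Y) a y = M a \<one>\<^bsub>fo G m\<^esub> y" if "a \<in> Hom Delta m n" "y \<in> S n" for a m n y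
    using that by (simp add: smap_def gsset_of_def Hom_Delta)
  have act: "act ?Y n (y, g) = M (Ident Delta n) g y" if "y \<in> S n" "g \<in> carrier (fo G n)" for n y g
    using that by (simp add: gsset_of_def)
  \<comment> \<open>The arrow (a, g) factors as (a, 1) after (Id, g); contravariantly this is the
    operator first and the action by \<open>g\<close> second.\<close>
  have actM: "M (Ident Delta m) g (M a \<one>\<^bsub>fo G m\<^esub> y) = M a g y"
    if a: "a \<in> Hom Delta m n" and g: "g \<in> carrier (fo G m)" and y: "y \<in> S n" for a m n g y
    using M_comp[OF Id a g one_G y] Delta.id_right[OF a] by (simp add: smap_G_id one_G unit_G g)
  have is_functor: "is_functor (op Delta) (set_cat \<kappa>) (sset ?Y)"
  proof (intro is_functor.intro is_functor_axioms.intro)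
    show "category (op Delta)" "category (set_cat \<kappa>)" by (simp_all add: category_Delta category_set_cat)
    show "fo (sset ?Y) \<in> Ob (op Delta) \<rightarrow>\<^sub>E Ob (set_cat \<kappa>)" using S by (auto simp: gsset_of_def)
    show "fa (sset ?Y) \<in> extensional (Arr (op Delta))" by (simp add: gsset_of_def)
    show "fa (sset ?Y) a \<in> Hom (set_cat \<kappa>) (fo (sset ?Y) (Dom (op Delta) a)) (fo (sset ?Y) (Cod (op Delta) a))"
      if "a \<in> Arr (op Delta)" for a
      using that S M[OF Arr_Hom one_G] by (auto simp: gsset_of_def Hom_set_cat)
    show "fa (sset ?Y) (Ident (op Delta) n) = Ident (set_cat \<kappa>) (fo (sset ?Y) n)" for n
      using Id[of n] M_id by (auto simp: gsset_of_def Hom_Delta intro!: restrict_ext)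
    fix b a assume "b \<in> Arr (op Delta)" "a \<in> Arr (op Delta)" "Dom (op Delta) a = Cod (op Delta) b"
    then obtain m n p where a: "a \<in> Hom Delta m n" and b: "b \<in> Hom Delta n p" by (simp add: Hom_Delta)
    have "M (Comp Delta b a) \<one>\<^bsub>fo G m\<^esub> y = M a \<one>\<^bsub>fo G m\<^esub> (M b \<one>\<^bsub>fo G n\<^esub> y)" if "y \<in> S p" for y
      using M_comp[OF a b one_G one_G that] by (simp add: smap_G(3)[OF a] unit_G one_G)
    then show "fa (sset ?Y) (Comp (op Delta) a b) = Comp (set_cat \<kappa>) (fa (sset ?Y) a) (fa (sset ?Y) b)"
      using Delta.comp_Hom[OF a b] a b M[OF b one_G]
      by (auto simp: gsset_of_def Hom_Delta compose_def intro!: restrict_ext)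
  qed
  \<comment> \<open>Both sides are the move along (a, G(a)(g)): the left because this arrow is (Id,
    g) after (a, 1), the right by the factorization \<open>actM\<close>.\<close>
  have act_smap: "smap (sset ?Y) a (act ?Y n (y, g)) = act ?Y m (smap (sset ?Y) a y, smap G a g)"
    if a: "a \<in> Hom Delta m n" and y: "y \<in> S n" and g: "g \<in> carrier (fo G n)" for a m n y g
  proof -
    have "smap (sset ?Y) a (act ?Y n (y, g)) = M a \<one>\<^bsub>fo G m\<^esub> (M (Ident Delta n) g y)"
      using M[OF Id g y] by (simp add: act[OF y g] smap[OF a])
    also have "\<dots> = M a (smap G a g) y"
      using M_comp[OF a Id one_G g y] Delta.id_left[OF a] smap_G_closed[OF a g] by (simp add: unit_G)
    also have "\<dots> = act ?Y m (smap (sset ?Y) a y, smap G a g)"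
      using actM[OF a smap_G_closed[OF a g] y] by (simp add: smap[OF a y] act M[OF a one_G y] smap_G_closed[OF a g])
    finally show ?thesis .
  qed
  have splx: "splx ?Y n = S n" for n by (simp add: gsset_of_def)
  show "G_simplicial_set \<kappa> G ?Y"
    unfolding G_simplicial_set_def simplicial_set_def splx
  proof (intro conjI allI ballI is_functor)
    show "act ?Y n \<in> S n \<times> carrier (fo G n) \<rightarrow>\<^sub>E S n" for n
      using M[OF Id] by (auto simp: gsset_of_def)
    fix n y assume y: "y \<in> S n"
    show "act ?Y n (y, \<one>\<^bsub>fo G n\<^esub>) = y" by (simp add: act[OF y one_G] M_id[OF y])
    fix g h assume g: "g \<in> carrier (fo G n)" and h: "h \<in> carrier (fo G n)"
    show "act ?Y n (act ?Y n (y, g), h) = act ?Y n (y, g \<otimes>\<^bsub>fo G n\<^esub> h)"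
      using M_comp[OF Id Id h g y] Delta.id_left[OF Id] M[OF Id g y]
      by (simp add: act y g h mult_G smap_G_id)
  next
    fix t assume "t \<in> Arr Delta"
    then show "case t of (m, \<alpha>, n) \<Rightarrow> \<forall>y\<in>S n. \<forall>g\<in>carrier (fo G n).
        smap (sset ?Y) (m, \<alpha>, n) (act ?Y n (y, g)) =
        act ?Y m (smap (sset ?Y) (m, \<alpha>, n) y, smap G (m, \<alpha>, n) g)"
      by (auto intro!: act_smap simp: Hom_Delta)
  qed
  show "move (gsset_of G S M) a g y = M a g y"
    if a: "a \<in> Hom Delta m n" and g: "g \<in> carrier (fo G m)" and y: "y \<in> S n"
    using a act[OF M[OF a one_G y] g] actM[OF a g y] by (simp add: move_def smap[OF a y] Hom_Delta)
qed

lemma gsset_of_splx [simp]: "splx (gsset_of G S M) n = S n"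
  by (simp add: gsset_of_def)

lemma G_map_move:
  assumes f: "G_map G Y Z f" and Y: "equivariant_sset \<kappa> G Y"
    and a: "a \<in> Hom Delta m n" and g: "g \<in> carrier (fo G m)" and y: "y \<in> splx Y n"
  shows "f m (move Y a g y) = move Z a g (f n y)"
proof -
  interpret Y: equivariant_sset \<kappa> G Y by fact
  have "f m (smap (sset Y) a y) = smap (sset Z) a (f n y)"
    using f a y by (cases a) (auto simp: G_map_def Hom_Delta)
  then show ?thesis
    using f Y.smap_in[OF a y] g a by (simp add: G_map_def move_def Hom_Delta)
qed

text \<open>Commuting with moves is the whole condition: at the unit it is simpliciality, at the
  identity operator it is equivariance.\<close>

lemma G_mapI:
  assumes "equivariant_sset \<kappa> G Y" "equivariant_sset \<kappa> G Z"
    and f: "\<And>n. f n \<in> splx Y n \<rightarrow>\<^sub>E splx Z n"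
    and move: "\<And>a m n g y. \<lbrakk>a \<in> Hom Delta m n; g \<in> carrier (fo G m); y \<in> splx Y n\<rbrakk>
      \<Longrightarrow> f m (move Y a g y) = move Z a g (f n y)"
  shows "G_map G Y Z f"
proof -
  interpret Y: equivariant_sset \<kappa> G Y by fact
  interpret Z: equivariant_sset \<kappa> G Z by fact
  have fZ: "f n y \<in> splx Z n" if "y \<in> splx Y n" for n y using f[of n] that by auto
  have "f m (smap (sset Y) a y) = smap (sset Z) a (f n y)" if a: "a \<in> Hom Delta m n" and y: "y \<in> splx Y n"
    for a m n y
    using move[OF a Y.one_G y] by (simp add: Y.move_one[OF a y] Z.move_one[OF a fZ[OF y]])
  moreover have "f n (act Y n (y, g)) = act Z n (f n y, g)" if y: "y \<in> splx Y n" and g: "g \<in> carrier (fo G n)"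
    for n y g
    using move[OF Y.Delta.id_Hom g y] by (simp add: Y.move_id_act y Z.move_id_act fZ)
  ultimately show ?thesis
    using f by (auto simp: G_map_def Hom_Delta)
qed

section \<open>The equivariant simplex category\<close>

text \<open>The source of an arrow is forced by the operator, the monoid element and the target, so
  arrows are parametrized freely by these three.\<close>

definition simp_arr :: "('w, 'g) gsset \<Rightarrow> op_arr \<Rightarrow> 'g \<Rightarrow> 'w \<Rightarrow> ('w, 'g) simp_arr" where
  "simp_arr W a g w = ((fst a, move W a g w), (fst (snd a), g), (snd (snd a), w))"

lemma Simp_cat_sel [simp]:
  "(n, w) \<in> Ob (Simp_cat G W) \<longleftrightarrow> w \<in> splx W n"
  "Dom (Simp_cat G W) = fst" "Cod (Simp_cat G W) t = snd (snd t)"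
  by (auto simp: Simp_cat_def split: prod.split)

context equivariant_sset
begin

lemma Hom_Simp_cat:
  "t \<in> Hom (Simp_cat G Y) (m, v) (n, w) \<longleftrightarrow> w \<in> splx Y n \<and>
     (\<exists>a \<in> Hom Delta m n. \<exists>g \<in> carrier (fo G m). t = simp_arr Y a g w \<and> v = move Y a g w)"
proof
  assume "t \<in> Hom (Simp_cat G Y) (m, v) (n, w)"
  then obtain \<alpha> g where t: "t = ((m, v), (\<alpha>, g), (n, w))" "w \<in> splx Y n" "(m, \<alpha>, n) \<in> Arr Delta"
      "g \<in> carrier (fo G m)" "v = act Y m (smap (sset Y) (m, \<alpha>, n) w, g)"
    by (auto simp: Hom_def Simp_cat_def)
  then show "w \<in> splx Y n \<and>
     (\<exists>a \<in> Hom Delta m n. \<exists>g \<in> carrier (fo G m). t = simp_arr Y a g w \<and> v = move Y a g w)"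
    by (intro conjI bexI[of _ "(m, \<alpha>, n)"] bexI[of _ g]) (auto simp: simp_arr_def move_def Hom_Delta)
next
  assume "w \<in> splx Y n \<and>
     (\<exists>a \<in> Hom Delta m n. \<exists>g \<in> carrier (fo G m). t = simp_arr Y a g w \<and> v = move Y a g w)"
  then show "t \<in> Hom (Simp_cat G Y) (m, v) (n, w)"
    using move_in unfolding Hom_def[of "Simp_cat G Y"]
    by (auto simp: Simp_cat_def simp_arr_def Hom_Delta move_def)
qed

lemma simp_arr_Hom:
  "\<lbrakk>a \<in> Hom Delta m n; g \<in> carrier (fo G m); w \<in> splx Y n\<rbrakk>
    \<Longrightarrow> simp_arr Y a g w \<in> Hom (Simp_cat G Y) (m, move Y a g w) (n, w)"
  by (auto simp: Hom_Simp_cat)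

lemma Arr_Simp_cat:
  assumes "t \<in> Arr (Simp_cat G Y)"
  obtains a m n g w where "a \<in> Hom Delta m n" "g \<in> carrier (fo G m)" "w \<in> splx Y n" "t = simp_arr Y a g w"
  using assms Hom_Simp_cat[of t "fst (fst t)" "snd (fst t)" "fst (snd (snd t))" "snd (snd (snd t))"]
  by (auto simp: Hom_def[of "Simp_cat G Y"])

lemma Ident_Simp_cat: "w \<in> splx Y n \<Longrightarrow> Ident (Simp_cat G Y) (n, w) = simp_arr Y (Ident Delta n) \<one>\<^bsub>fo G n\<^esub> w"
  by (simp add: simp_arr_def move_id) (simp add: Simp_cat_def Delta_def)

lemma Comp_Simp_cat:
  assumes "a \<in> Hom Delta m n" "b \<in> Hom Delta n p" "g \<in> carrier (fo G m)" "h \<in> carrier (fo G n)"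
    "w \<in> splx Y p"
  shows "Comp (Simp_cat G Y) (simp_arr Y b h w) (simp_arr Y a g (move Y b h w)) =
    simp_arr Y (Comp Delta b a) (smap G a h \<otimes>\<^bsub>fo G m\<^esub> g) w"
proof -
  obtain \<alpha> \<beta> where "a = (m, \<alpha>, n)" "b = (n, \<beta>, p)" using assms(1,2) by (cases a, cases b) (auto simp: Hom_Delta)
  then show ?thesis
    using move_comp[OF assms] by (simp add: simp_arr_def) (simp add: Simp_cat_def Delta_def)
qed

text \<open>Composability forces the target of the inner arrow to be the source
  \<open>move Y b h x\<close> of the outer one. The laws then become identities of operators and of
  monoid elements; associativity of the latter uses that the structure maps of \<open>G\<close> are
  multiplicative and functorial.\<close>

lemma category_Simp_cat: "category (Simp_cat G Y)"
proof
  let ?S = "Simp_cat G Y"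
  note Id = Delta.id_Hom[simplified]
  fix t assume "t \<in> Arr ?S"
  then obtain a m n g w where a: "a \<in> Hom Delta m n" and g: "g \<in> carrier (fo G m)" and w: "w \<in> splx Y n"
    and t: "t = simp_arr Y a g w" by (rule Arr_Simp_cat)
  have dc: "Dom ?S t = (m, move Y a g w)" "Cod ?S t = (n, w)"
    using a by (simp_all add: t simp_arr_def Hom_Delta)
  note aw = move_in[OF a g w]
  show "Dom ?S t \<in> Ob ?S" "Cod ?S t \<in> Ob ?S"
    using aw w by (simp_all only: dc Simp_cat_sel(1))
  have "Comp ?S (simp_arr Y a g w) (simp_arr Y (Ident Delta m) \<one>\<^bsub>fo G m\<^esub> (move Y a g w)) = simp_arr Y a g w"
    using Comp_Simp_cat[OF Id a one_G g w] by (simp add: smap_G_id[OF g] Delta.id_right[OF a] unit_G g)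
  then show "Comp ?S t (Ident ?S (Dom ?S t)) = t"
    unfolding dc Ident_Simp_cat[OF aw] unfolding t .
  have "Comp ?S (simp_arr Y (Ident Delta n) \<one>\<^bsub>fo G n\<^esub> w) (simp_arr Y a g w) = simp_arr Y a g w"
    using Comp_Simp_cat[OF a Id g one_G w] by (simp add: smap_G(3)[OF a] Delta.id_left[OF a] unit_G g move_id[OF w])
  then show "Comp ?S (Ident ?S (Cod ?S t)) t = t"
    unfolding dc Ident_Simp_cat[OF w] unfolding t .
  fix s assume "s \<in> Arr ?S" and st: "Dom ?S s = Cod ?S t"
  then obtain b n' p h x where "b \<in> Hom Delta n' p" "h \<in> carrier (fo G n')" and x: "x \<in> splx Y p"
    and s: "s = simp_arr Y b h x" by (metis Arr_Simp_cat)
  with st dc have b: "b \<in> Hom Delta n p" and h: "h \<in> carrier (fo G n)" and w': "w = move Y b h x"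
    by (auto simp: simp_arr_def Hom_Delta)
  let ?ba = "Comp Delta b a" and ?hg = "smap G a h \<otimes>\<^bsub>fo G m\<^esub> g"
  have ba: "?ba \<in> Hom Delta m p" and hg: "?hg \<in> carrier (fo G m)"
    using Delta.comp_Hom[OF a b] mult_G smap_G_closed[OF a h] g by auto
  have c: "Comp ?S s t = simp_arr Y ?ba ?hg x"
    using Comp_Simp_cat[OF a b g h x] by (simp only: s t w')
  have H: "Comp ?S s t \<in> Hom ?S (m, move Y a g w) (p, x)"
    using simp_arr_Hom[OF ba hg x] move_comp[OF a b g h x] by (simp only: c w')
  have "Cod ?S s = (p, x)" using b by (simp add: s simp_arr_def Hom_Delta)
  then show "Comp ?S s t \<in> Arr ?S" "Dom ?S (Comp ?S s t) = Dom ?S t" "Cod ?S (Comp ?S s t) = Cod ?S s"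
    using H unfolding dc by (simp_all add: Hom_def)
  fix r assume "r \<in> Arr ?S" and rs: "Dom ?S r = Cod ?S s"
  then obtain d p' q k y where "d \<in> Hom Delta p' q" "k \<in> carrier (fo G p')" and y: "y \<in> splx Y q"
    and r: "r = simp_arr Y d k y" by (metis Arr_Simp_cat)
  with rs \<open>Cod ?S s = (p, x)\<close> have d: "d \<in> Hom Delta p q" and k: "k \<in> carrier (fo G p)" and x': "x = move Y d k y"
    by (auto simp: simp_arr_def Hom_Delta)
  let ?db = "Comp Delta d b" and ?kh = "smap G b k \<otimes>\<^bsub>fo G n\<^esub> h"
  have db: "?db \<in> Hom Delta n q" and kh: "?kh \<in> carrier (fo G n)"
    using Delta.comp_Hom[OF b d] mult_G smap_G_closed[OF b k] h by auto
  have "Comp ?S r (Comp ?S s t) = simp_arr Y (Comp Delta d ?ba) (smap G ?ba k \<otimes>\<^bsub>fo G m\<^esub> ?hg) y"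
    using Comp_Simp_cat[OF ba d hg k y] by (simp only: c r x')
  also have "Comp Delta d ?ba = Comp Delta ?db a" by (rule Delta.assoc_Hom[OF a b d])
  also have "smap G ?ba k \<otimes>\<^bsub>fo G m\<^esub> ?hg = smap G a ?kh \<otimes>\<^bsub>fo G m\<^esub> g"
    by (simp add: smap_G_comp[OF a b k] smap_G_mult[OF a] smap_G_closed[OF b k] h assoc_G
        smap_G_closed[OF a] g)
  also have "simp_arr Y (Comp Delta ?db a) (smap G a ?kh \<otimes>\<^bsub>fo G m\<^esub> g) y =
      Comp ?S (simp_arr Y ?db ?kh y) (simp_arr Y a g (move Y ?db ?kh y))"
    using Comp_Simp_cat[OF a db g kh y] by simp
  also have "\<dots> = Comp ?S (Comp ?S r s) t"
    using Comp_Simp_cat[OF b d h k y] move_comp[OF b d h k y] by (simp only: r s t w' x')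
  finally show "Comp ?S r (Comp ?S s t) = Comp ?S (Comp ?S r s) t" .
next
  let ?S = "Simp_cat G Y"
  fix c assume c: "c \<in> Ob ?S"
  obtain n w where nw: "c = (n, w)" by (cases c)
  then have w: "w \<in> splx Y n" using c by simp
  have "Ident ?S c \<in> Hom ?S c c"
    using simp_arr_Hom[OF Delta.id_Hom one_G w] by (simp add: nw Ident_Simp_cat[OF w] move_id[OF w])
  then show "Ident ?S c \<in> Arr ?S" "Dom ?S (Ident ?S c) = c" "Cod ?S (Ident ?S c) = c"
    by (auto simp: Hom_def)
qed

end

section \<open>Retractive spaces\<close>

lemma retr_cat_sel [simp]:
  "X \<in> Ob (retr_cat \<kappa> G W) \<longleftrightarrow> retractive_space \<kappa> G W X"
  "(X, f, Z) \<in> Arr (retr_cat \<kappa> G W) \<longleftrightarrow>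
    retractive_space \<kappa> G W X \<and> retractive_space \<kappa> G W Z \<and> retractive_map G W X f Z"
  "Dom (retr_cat \<kappa> G W) = fst" "Cod (retr_cat \<kappa> G W) t = snd (snd t)"
  "Ident (retr_cat \<kappa> G W) X = (X, \<lambda>n. \<lambda>y\<in>splx (tot X) n. y, X)"
  "Comp (retr_cat \<kappa> G W) (Z', f', V) (X, f, Z) = (X, \<lambda>n. compose (splx (tot X) n) (f' n) (f n), V)"
  by (auto simp: retr_cat_def split: prod.split)

lemma Hom_retr_cat:
  "t \<in> Hom (retr_cat \<kappa> G W) X Z \<longleftrightarrow> retractive_space \<kappa> G W X \<and> retractive_space \<kappa> G W Z \<and>
    (\<exists>f. t = (X, f, Z) \<and> retractive_map G W X f Z)"
  by (cases t) (auto simp: Hom_def)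

locale retractive_base = W: equivariant_sset \<kappa> G W
  for \<kappa> :: "'u rel" and G :: "'g smonoid" and W :: "('w, 'g) gsset"
begin

abbreviation "R \<equiv> retr_cat \<kappa> G W :: (('u, 'g, 'w) retr, _) cat"
abbreviation "S \<equiv> Simp_cat G W"
abbreviation "P \<equiv> pset_cat \<kappa> :: ('u set \<times> 'u, _) cat"

lemma retr:
  assumes "retractive_space \<kappa> G W (X :: ('u, 'g, 'w) retr)"
  shows "equivariant_sset \<kappa> G (tot X)"
    and "G_map G (tot X) W (ret X)" "G_map G W (tot X) (sec X)"
    and "y \<in> splx (tot X) n \<Longrightarrow> ret X n y \<in> splx W n"
    and "w \<in> splx W n \<Longrightarrow> sec X n w \<in> splx (tot X) n"
    and "w \<in> splx W n \<Longrightarrow> ret X n (sec X n w) = w"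
  using assms W.simplicial_monoid_action_axioms
  by (auto simp: retractive_space_def equivariant_sset_def equivariant_sset_axioms_def G_map_def)

lemma retr_move:
  assumes X: "retractive_space \<kappa> G W (X :: ('u, 'g, 'w) retr)"
    and a: "a \<in> Hom Delta m n" and g: "g \<in> carrier (fo G m)"
  shows "y \<in> splx (tot X) n \<Longrightarrow> ret X m (move (tot X) a g y) = move W a g (ret X n y)"
    and "w \<in> splx W n \<Longrightarrow> sec X m (move W a g w) = move (tot X) a g (sec X n w)"
  using G_map_move[OF retr(2)[OF X] retr(1)[OF X] a g]
    G_map_move[OF retr(3)[OF X] W.equivariant_sset_axioms a g] by auto

lemma retractive_mapD:
  assumes "retractive_map G W X f Z"
  shows "f n \<in> splx (tot X) n \<rightarrow>\<^sub>E splx (tot Z) n"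
    and "y \<in> splx (tot X) n \<Longrightarrow> f n y \<in> splx (tot Z) n"
    and "y \<in> splx (tot X) n \<Longrightarrow> ret Z n (f n y) = ret X n y"
    and "w \<in> splx W n \<Longrightarrow> f n (sec X n w) = sec Z n w"
    and "G_map G (tot X) (tot Z) f"
  using assms by (auto simp: retractive_map_def G_map_def)

lemma retractive_map_comp:
  assumes X: "retractive_space \<kappa> G W (X :: ('u, 'g, 'w) retr)" and Z: "retractive_space \<kappa> G W Z"
    and V: "retractive_space \<kappa> G W V"
    and f: "retractive_map G W X f Z" and f': "retractive_map G W Z f' V"
  shows "retractive_map G W X (\<lambda>n. compose (splx (tot X) n) (f' n) (f n)) V"
proof -
  interpret X: equivariant_sset \<kappa> G "tot X" by (rule retr(1)[OF X])
  note fD = retractive_mapD[OF f] and f'D = retractive_mapD[OF f']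
  have "G_map G (tot X) (tot V) (\<lambda>n. compose (splx (tot X) n) (f' n) (f n))"
  proof (rule G_mapI[OF retr(1)[OF X] retr(1)[OF V]])
    show "compose (splx (tot X) n) (f' n) (f n) \<in> splx (tot X) n \<rightarrow>\<^sub>E splx (tot V) n" for n
      using fD(2) f'D(2) by (auto simp: compose_def)
    fix a m n g y assume a: "a \<in> Hom Delta m n" and g: "g \<in> carrier (fo G m)" and y: "y \<in> splx (tot X) n"
    show "compose (splx (tot X) m) (f' m) (f m) (move (tot X) a g y) =
        move (tot V) a g (compose (splx (tot X) n) (f' n) (f n) y)"
      by (simp add: compose_eq X.move_in[OF a g y] y G_map_move[OF fD(5) retr(1)[OF X] a g y]
          G_map_move[OF f'D(5) retr(1)[OF Z] a g fD(2)[OF y]])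
  qed
  then show ?thesis
    using fD f'D retr(5)[OF X] by (simp add: retractive_map_def compose_eq)
qed

lemma retractive_map_id:
  assumes X: "retractive_space \<kappa> G W (X :: ('u, 'g, 'w) retr)"
  shows "retractive_map G W X (\<lambda>n. \<lambda>y\<in>splx (tot X) n. y) X"
proof -
  interpret X: equivariant_sset \<kappa> G "tot X" by (rule retr(1)[OF X])
  have "G_map G (tot X) (tot X) (\<lambda>n. \<lambda>y\<in>splx (tot X) n. y)"
    by (rule G_mapI[OF retr(1)[OF X] retr(1)[OF X]]) (auto simp: X.move_in)
  then show ?thesis using retr(5)[OF X] by (simp add: retractive_map_def)
qed

lemma category_retr_cat: "category R"
proof
  fix t :: "('u, 'g, 'w) retr \<times> (nat \<Rightarrow> 'u \<Rightarrow> 'u) \<times> ('u, 'g, 'w) retr"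
  assume "t \<in> Arr R"
  then obtain X f Z where t: "t = (X, f, Z)" and X: "retractive_space \<kappa> G W X"
    and Z: "retractive_space \<kappa> G W Z" and f: "retractive_map G W X f Z" by (cases t) auto
  show "Dom R t \<in> Ob R" "Cod R t \<in> Ob R" using X Z by (auto simp: t)
  note fD = retractive_mapD[OF f]
  show "Comp R t (Ident R (Dom R t)) = t" "Comp R (Ident R (Cod R t)) t = t"
    using fD(1) by (auto simp: t fun_eq_iff compose_def restrict_def PiE_def extensional_def)
  fix s :: "('u, 'g, 'w) retr \<times> (nat \<Rightarrow> 'u \<Rightarrow> 'u) \<times> ('u, 'g, 'w) retr"
  assume "s \<in> Arr R" "Dom R s = Cod R t"
  then obtain f' V where s: "s = (Z, f', V)" and V: "retractive_space \<kappa> G W V"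
    and f': "retractive_map G W Z f' V" by (cases s) (auto simp: t)
  show "Comp R s t \<in> Arr R" "Dom R (Comp R s t) = Dom R t" "Cod R (Comp R s t) = Cod R s"
    using X V retractive_map_comp[OF X Z V f f'] by (auto simp: s t)
  fix r :: "('u, 'g, 'w) retr \<times> (nat \<Rightarrow> 'u \<Rightarrow> 'u) \<times> ('u, 'g, 'w) retr"
  assume "r \<in> Arr R" "Dom R r = Cod R s"
  then obtain f'' V' where r: "r = (V, f'', V')" by (cases r) (auto simp: s)
  show "Comp R r (Comp R s t) = Comp R (Comp R r s) t"
    using fD(2) by (auto simp: r s t compose_def restrict_def fun_eq_iff)
qed (auto simp: retractive_map_id)

subsection \<open>The fibre functor\<close>

lemma fibre_sel [simp]:
  "fst (fibre X (n, w)) = {y \<in> splx (tot X) n. ret X n y = w}" "snd (fibre X (n, w)) = sec X n w"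
  by (simp_all add: fibre_def)

lemma fibre_Ob:
  assumes "retractive_space \<kappa> G W (X :: ('u, 'g, 'w) retr)" "w \<in> splx W n"
  shows "fibre X (n, w) \<in> Ob P"
proof -
  interpret X: equivariant_sset \<kappa> G "tot X" by (rule retr(1)[OF assms(1)])
  show ?thesis
    using small_subset[OF X.splx_small, of "{y \<in> splx (tot X) n. ret X n y = w}" n]
      retr(5,6)[OF assms(1,2)] by auto
qed

lemma fibre_presheaf_fo: "w \<in> splx W n \<Longrightarrow> fo (fibre_presheaf G W X) (n, w) = fibre X (n, w)"
  by (simp add: fibre_presheaf_def)

lemma fibre_presheaf_fa:
  assumes "a \<in> Hom Delta m n" "g \<in> carrier (fo G m)" "w \<in> splx W n"
  shows "fa (fibre_presheaf G W X) (simp_arr W a g w) =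
    (fibre X (n, w), \<lambda>y\<in>fst (fibre X (n, w)). move (tot X) a g y, fibre X (m, move W a g w))"
proof -
  have "simp_arr W a g w \<in> Arr S" using W.simp_arr_Hom[OF assms] by (simp add: Hom_def)
  then show ?thesis
    using assms(1) by (cases a) (simp add: fibre_presheaf_def simp_arr_def move_def Hom_Delta)
qed

text \<open>Moves commute with the retraction, so they carry the fibre over \<open>w\<close> to the
  fibre over the moved simplex; they commute with the section, so they preserve base points.\<close>

lemma fibre_presheaf_Hom:
  assumes X: "retractive_space \<kappa> G W (X :: ('u, 'g, 'w) retr)"
    and a: "a \<in> Hom Delta m n" and g: "g \<in> carrier (fo G m)" and w: "w \<in> splx W n"
  shows "fa (fibre_presheaf G W X) (simp_arr W a g w) \<in> Hom P (fibre X (n, w)) (fibre X (m, move W a g w))"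
proof -
  interpret X: equivariant_sset \<kappa> G "tot X" by (rule retr(1)[OF X])
  show ?thesis
    using fibre_Ob[OF X w] fibre_Ob[OF X W.move_in[OF a g w]] X.move_in[OF a g] retr_move[OF X a g]
      retr(5,6)[OF X w] w
    by (auto simp: fibre_presheaf_fa[OF a g w] Hom_pset)
qed

text \<open>Contravariant functoriality is \<open>move_comp\<close> in the total space, read on
  fibres.\<close>

lemma is_functor_fibre_presheaf:
  assumes X: "retractive_space \<kappa> G W (X :: ('u, 'g, 'w) retr)"
  shows "is_functor (op S) P (fibre_presheaf G W X)"
proof (intro is_functor.intro is_functor_axioms.intro)
  interpret X: equivariant_sset \<kappa> G "tot X" by (rule retr(1)[OF X])
  let ?F = "fibre_presheaf G W X"
  show "category (op S)" "category P" using W.category_Simp_cat category_pset_cat by simp_all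
  show "fo ?F \<in> Ob (op S) \<rightarrow>\<^sub>E Ob P"
    using fibre_Ob[OF X] by (auto simp: fibre_presheaf_def)
  show "fa ?F \<in> extensional (Arr (op S))" by (simp add: fibre_presheaf_def)
  show "fa ?F t \<in> Hom P (fo ?F (Dom (op S) t)) (fo ?F (Cod (op S) t))" if "t \<in> Arr (op S)" for t
  proof -
    have "t \<in> Arr S" using that by simp
    then obtain a m n g w where a: "a \<in> Hom Delta m n" and g: "g \<in> carrier (fo G m)"
      and w: "w \<in> splx W n" and t: "t = simp_arr W a g w" by (rule W.Arr_Simp_cat)
    have "Dom S t = (m, move W a g w)" "Cod S t = (n, w)" using a by (simp_all add: t simp_arr_def Hom_Delta)
    then show ?thesis
      using fibre_presheaf_Hom[OF X a g w]
      by (simp add: fibre_presheaf_fo[OF w] fibre_presheaf_fo[OF W.move_in[OF a g w]] t del: Simp_cat_sel)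
  qed
  show "fa ?F (Ident (op S) c) = Ident P (fo ?F c)" if "c \<in> Ob (op S)" for c
  proof -
    obtain n w where c: "c = (n, w)" "w \<in> splx W n" using \<open>c \<in> Ob (op S)\<close> by (cases c) simp
    have "fa ?F (simp_arr W (Ident Delta n) \<one>\<^bsub>fo G n\<^esub> w) = (fibre X (n, w), \<lambda>y\<in>fst (fibre X (n, w)). y, fibre X (n, w))"
      using fibre_presheaf_fa[OF W.Delta.id_Hom W.one_G c(2), of X]
      by (auto simp: W.move_id[OF c(2)] X.move_id intro!: restrict_ext)
    then show ?thesis
      by (simp add: c W.Ident_Simp_cat[OF c(2)] fibre_presheaf_fo[OF c(2)])
  qed
  fix s t assume "s \<in> Arr (op S)" "t \<in> Arr (op S)" and st: "Dom (op S) t = Cod (op S) s"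
  then have "s \<in> Arr S" "t \<in> Arr S" by simp_all
  obtain b n p h x where b: "b \<in> Hom Delta n p" and h: "h \<in> carrier (fo G n)"
    and x: "x \<in> splx W p" and s: "s = simp_arr W b h x" using W.Arr_Simp_cat[OF \<open>s \<in> Arr S\<close>] .
  obtain a m n' g w where "a \<in> Hom Delta m n'" and g: "g \<in> carrier (fo G m)"
    and "w \<in> splx W n'" and t': "t = simp_arr W a g w" using W.Arr_Simp_cat[OF \<open>t \<in> Arr S\<close>] .
  with st have a: "a \<in> Hom Delta m n" and t: "t = simp_arr W a g (move W b h x)"
    using b by (auto simp: t' s simp_arr_def Hom_Delta)
  let ?ba = "Comp Delta b a" and ?hg = "smap G a h \<otimes>\<^bsub>fo G m\<^esub> g"
  have ba: "?ba \<in> Hom Delta m p" and hg: "?hg \<in> carrier (fo G m)"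
    using W.Delta.comp_Hom[OF a b] W.mult_G W.smap_G_closed[OF a h] g by auto
  have "Comp (op S) t s = simp_arr W ?ba ?hg x"
    using W.Comp_Simp_cat[OF a b g h x] by (simp add: s t)
  then show "fa ?F (Comp (op S) t s) = Comp P (fa ?F t) (fa ?F s)"
    using X.move_in[OF b h] retr_move[OF X b h]
    by (auto simp: t s fibre_presheaf_fa[OF ba hg x] fibre_presheaf_fa[OF a g W.move_in[OF b h x]]
        fibre_presheaf_fa[OF b h x] compose_def W.move_comp[OF a b g h x] X.move_comp[OF a b g h] intro!: restrict_ext)
qed

section \<open>Maps of retractive spaces as natural transformations\<close>

definition fibre_trans ::
  "('u, 'g, 'w) retr \<Rightarrow> (nat \<Rightarrow> 'u \<Rightarrow> 'u) \<Rightarrow> ('u, 'g, 'w) retr \<Rightarrow> nat \<times> 'w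
    \<Rightarrow> ('u set \<times> 'u) \<times> ('u \<Rightarrow> 'u) \<times> ('u set \<times> 'u)" where
  "fibre_trans X f Z =
     (\<lambda>(n, w)\<in>Ob S. (fibre X (n, w), \<lambda>y\<in>fst (fibre X (n, w)). f n y, fibre Z (n, w)))"

lemma fibre_functor_sel [simp]:
  "retractive_space \<kappa> G W X \<Longrightarrow> fo (fibre_functor \<kappa> G W) X = fibre_presheaf G W X"
  "\<lbrakk>retractive_space \<kappa> G W X; retractive_space \<kappa> G W Z; retractive_map G W X f Z\<rbrakk>
    \<Longrightarrow> fa (fibre_functor \<kappa> G W) (X, f, Z) = (fibre_presheaf G W X, fibre_trans X f Z, fibre_presheaf G W Z)"
  by (simp_all add: fibre_functor_def fibre_trans_def)

lemma fibre_trans_eq: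
  "w \<in> splx W n \<Longrightarrow> fibre_trans X f Z (n, w) = (fibre X (n, w), \<lambda>y\<in>fst (fibre X (n, w)). f n y, fibre Z (n, w))"
  by (simp add: fibre_trans_def)

text \<open>Every simplex lies in exactly one fibre, so the conditions match: components are pointed
  maps between fibres exactly when \<open>f\<close> respects retraction and section, and naturality
  is commutation with moves. One direction makes the fibre functor well defined on arrows, the other
  serves fullness; for the latter \<open>f\<close> has to be an arbitrary extensional
  family.\<close>

lemma nat_trans_fibre_presheaf_iff:
  fixes X Z :: "('u, 'g, 'w) retr"
  assumes X: "retractive_space \<kappa> G W X" and Z: "retractive_space \<kappa> G W Z"
    and f: "\<And>n. f n \<in> extensional (splx (tot X) n)"
  shows "nat_trans (op S) P (fibre_presheaf G W X) (fibre_presheaf G W Z) (fibre_trans X f Z) \<longleftrightarrow>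
    retractive_map G W X f Z"
proof
  interpret X: equivariant_sset \<kappa> G "tot X" by (rule retr(1)[OF X])
  assume f: "retractive_map G W X f Z"
  note fD = retractive_mapD[OF f]
  show "nat_trans (op S) P (fibre_presheaf G W X) (fibre_presheaf G W Z) (fibre_trans X f Z)"
  proof (rule nat_transI)
    show "is_functor (op S) P (fibre_presheaf G W X)" "is_functor (op S) P (fibre_presheaf G W Z)"
      using is_functor_fibre_presheaf X Z by auto
    show "fibre_trans X f Z \<in> extensional (Ob (op S))" by (simp add: fibre_trans_def)
    fix c assume "c \<in> Ob (op S)"
    then obtain n w where c: "c = (n, w)" "w \<in> splx W n" by (cases c) simp
    show "fibre_trans X f Z c \<in> Hom P (fo (fibre_presheaf G W X) c) (fo (fibre_presheaf G W Z) c)"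
      using fibre_Ob[OF X c(2)] fibre_Ob[OF Z c(2)] fD(2-4) retr(5,6)[OF X c(2)] c(2)
      by (auto simp: c fibre_presheaf_fo fibre_trans_eq Hom_pset)
  next
    fix t c c' assume t: "t \<in> Hom (op S) c c'"
    obtain n w m v where c: "c = (n, w)" "c' = (m, v)" by (cases c, cases c')
    with t obtain a g where a: "a \<in> Hom Delta m n" and g: "g \<in> carrier (fo G m)" and w: "w \<in> splx W n"
      and t: "t = simp_arr W a g w" and v: "v = move W a g w"
      by (auto simp: W.Hom_Simp_cat)
    show "Comp P (fibre_trans X f Z c') (fa (fibre_presheaf G W X) t) =
        Comp P (fa (fibre_presheaf G W Z) t) (fibre_trans X f Z c)"
      using X.move_in[OF a g] retr_move[OF X a g] fD(2,3) G_map_move[OF fD(5) retr(1)[OF X] a g]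
      by (auto simp: c v t fibre_trans_eq W.move_in[OF a g w] w fibre_presheaf_fa[OF a g w] compose_def
          intro!: restrict_ext)
  qed
next
  interpret X: equivariant_sset \<kappa> G "tot X" by (rule retr(1)[OF X])
  assume nt: "nat_trans (op S) P (fibre_presheaf G W X) (fibre_presheaf G W Z) (fibre_trans X f Z)"
  have hom: "fibre_trans X f Z (n, w) \<in> Hom P (fibre X (n, w)) (fibre Z (n, w))" if "w \<in> splx W n" for n w
    using nat_trans_Hom[OF nt, of "(n, w)"] that by (simp add: fibre_presheaf_fo)
  have f_in: "f n y \<in> splx (tot Z) n \<and> ret Z n (f n y) = ret X n y" if "y \<in> splx (tot X) n" for n y
    using hom[OF retr(4)[OF X that]] that retr(4)[OF X that] by (auto simp: fibre_trans_eq Hom_pset)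
  have f_sec: "f n (sec X n w) = sec Z n w" if "w \<in> splx W n" for n w
    using hom[OF that] that retr(5,6)[OF X that] by (auto simp: fibre_trans_eq Hom_pset)
  have "G_map G (tot X) (tot Z) f"
  proof (rule G_mapI[OF retr(1)[OF X] retr(1)[OF Z]])
    show "f n \<in> splx (tot X) n \<rightarrow>\<^sub>E splx (tot Z) n" for n using f_in f by (simp add: PiE_iff)
    fix a m n g y assume a: "a \<in> Hom Delta m n" and g: "g \<in> carrier (fo G m)" and y: "y \<in> splx (tot X) n"
    \<comment> \<open>The naturality square is taken at the fibre that contains \<open>y\<close> and
      evaluated at \<open>y\<close>.\<close>
    define w where "w = ret X n y"
    have w: "w \<in> splx W n" using retr(4)[OF X y] by (simp add: w_def)
    have "Comp P (fibre_trans X f Z (m, move W a g w)) (fa (fibre_presheaf G W X) (simp_arr W a g w)) =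
        Comp P (fa (fibre_presheaf G W Z) (simp_arr W a g w)) (fibre_trans X f Z (n, w))"
      by (rule nat_trans_nat[OF nt]) (use W.simp_arr_Hom[OF a g w] in simp)
    then have "compose (fst (fibre X (n, w))) (\<lambda>y\<in>fst (fibre X (m, move W a g w)). f m y)
          (\<lambda>y\<in>fst (fibre X (n, w)). move (tot X) a g y) =
        compose (fst (fibre X (n, w))) (\<lambda>y\<in>fst (fibre Z (n, w)). move (tot Z) a g y)
          (\<lambda>y\<in>fst (fibre X (n, w)). f n y)"
      by (simp add: fibre_trans_eq W.move_in[OF a g w] w fibre_presheaf_fa[OF a g w] del: fibre_sel)
    from fun_cong[OF this, of y] show "f m (move (tot X) a g y) = move (tot Z) a g (f n y)"
      using X.move_in[OF a g y] retr_move(1)[OF X a g y] f_in[OF y] y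
      by (simp add: compose_eq w_def)
  qed
  then show "retractive_map G W X f Z" using f_in f_sec by (simp add: retractive_map_def)
qed

lemma is_functor_fibre_functor: "is_functor R (fun_cat (op S) P) (fibre_functor \<kappa> G W)"
proof (intro is_functor.intro is_functor_axioms.intro)
  let ?F = "fibre_functor \<kappa> G W :: (('u, 'g, 'w) retr, _, _, _) cfun" and ?C = "fun_cat (op S) P"
  show "category R" by (rule category_retr_cat)
  show "category ?C" by (rule category_fun_cat[OF category_pset_cat])
  show "fo ?F \<in> Ob R \<rightarrow>\<^sub>E Ob ?C"
    using is_functor_fibre_presheaf by (auto simp: fibre_functor_def)
  show "fa ?F \<in> extensional (Arr R)" by (simp add: fibre_functor_def)
  have ext: "f n \<in> extensional (splx (tot X) n)" if "retractive_map G W X f Z"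
    for X Z :: "('u, 'g, 'w) retr" and f n using retractive_mapD(1)[OF that, of n] by (simp add: PiE_def)
  show "fa ?F (Ident R X) = Ident ?C (fo ?F X)" if X: "X \<in> Ob R" for X
    using X retractive_map_id[of X] fibre_presheaf_fo[of _ _ X]
    by (auto simp: fibre_trans_def intro!: restrict_ext)
  fix t assume "t \<in> Arr R"
  then obtain X f Z where t: "t = (X, f, Z)" and X: "retractive_space \<kappa> G W X"
    and Z: "retractive_space \<kappa> G W Z" and f: "retractive_map G W X f Z" by (cases t) auto
  show "fa ?F t \<in> Hom ?C (fo ?F (Dom R t)) (fo ?F (Cod R t))"
    using X Z f nat_trans_fibre_presheaf_iff[OF X Z ext[OF f]] by (simp add: t Hom_fun_cat)
  fix s assume "s \<in> Arr R" "Dom R s = Cod R t"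
  then obtain f' V where s: "s = (Z, f', V)" and V: "retractive_space \<kappa> G W V"
    and f': "retractive_map G W Z f' V" by (cases s) (auto simp: t)
  show "fa ?F (Comp R s t) = Comp ?C (fa ?F s) (fa ?F t)"
    using X V Z f f' retractive_map_comp[OF X Z V f f'] retractive_mapD(2,3)[OF f]
    by (auto simp: s t fibre_trans_def compose_def intro!: restrict_ext)
qed

text \<open>The fibres cover the total space, so a map is determined by its restrictions to them;
  they are disjoint, so any natural family of fibre maps glues.\<close>

lemma fully_faithful_fibre_functor: "fully_faithful R (fun_cat (op S) P) (fibre_functor \<kappa> G W)"
  unfolding fully_faithful_def
proof (intro ballI)
  let ?F = "fibre_functor \<kappa> G W :: (('u, 'g, 'w) retr, _, _, _) cfun" and ?C = "fun_cat (op S) P"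
  fix X Z assume "X \<in> Ob R" "Z \<in> Ob R"
  then have X: "retractive_space \<kappa> G W X" and Z: "retractive_space \<kappa> G W Z" by simp_all
  have fext: "f n \<in> extensional (splx (tot X) n)" if "retractive_map G W X f Z"
    for f n using retractive_mapD(1)[OF that, of n] by (simp add: PiE_def)
  have "inj_on (fa ?F) (Hom R X Z)"
  proof (rule inj_onI)
    fix s t assume st: "s \<in> Hom R X Z" "t \<in> Hom R X Z" "fa ?F s = fa ?F t"
    obtain f f' where s: "s = (X, f, Z)" and f: "retractive_map G W X f Z"
      and t: "t = (X, f', Z)" and f': "retractive_map G W X f' Z"
      using st(1,2) by (auto simp: Hom_retr_cat)
    have tr: "fibre_trans X f Z = fibre_trans X f' Z" using st(3) X Z f f' by (simp add: s t)
    have "f n y = f' n y" if y: "y \<in> splx (tot X) n" for n y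
      using fun_cong[OF tr, of "(n, ret X n y)"] y
      by (auto simp: fibre_trans_eq retr(4)[OF X y] dest: fun_cong[where x=y])
    then have "f n = f' n" for n by (intro extensionalityI[OF fext[OF f] fext[OF f']])
    then have "f = f'" by blast
    then show "s = t" by (simp add: s t)
  qed
  moreover have "fa ?F ` Hom R X Z \<subseteq> Hom ?C (fo ?F X) (fo ?F Z)"
    using is_functor.fa_Hom[OF is_functor_fibre_functor] by blast
  moreover have "\<exists>t \<in> Hom R X Z. fa ?F t = s" if "s \<in> Hom ?C (fo ?F X) (fo ?F Z)" for s
  proof -
    from that X Z obtain \<tau> where s: "s = (fibre_presheaf G W X, \<tau>, fibre_presheaf G W Z)"
      and \<tau>: "nat_trans (op S) P (fibre_presheaf G W X) (fibre_presheaf G W Z) \<tau>"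
      by (auto simp: Hom_fun_cat)
    \<comment> \<open>A simplex is sent by the component at its own fibre. Restricting to simplices
      supplies the extensionality demanded by \<open>nat_trans_fibre_presheaf_iff\<close>.\<close>
    define f where "f n = (\<lambda>y\<in>splx (tot X) n. fst (snd (\<tau> (n, ret X n y))) y)" for n
    have "\<tau> c = fibre_trans X f Z c" if c: "c \<in> Ob S" for c
    proof -
      obtain n w where c': "c = (n, w)" "w \<in> splx W n" using c by (cases c) simp
      have "\<tau> c \<in> Hom P (fibre X (n, w)) (fibre Z (n, w))"
        using nat_trans_Hom[OF \<tau>, of c] c' by (simp add: fibre_presheaf_fo)
      then obtain h where h: "\<tau> c = (fibre X (n, w), h, fibre Z (n, w))" "h \<in> extensional (fst (fibre X (n, w)))"
        by (auto simp: Hom_pset PiE_def simp del: fibre_sel)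
      then have "h = (\<lambda>y\<in>fst (fibre X (n, w)). f n y)"
        using c' by (intro extensionalityI[OF h(2)]) (auto simp: f_def)
      then show ?thesis using h(1) c' by (simp add: fibre_trans_eq)
    qed
    then have \<tau>f: "\<tau> = fibre_trans X f Z"
      using \<tau> by (intro extensionalityI[where A="Ob S"]) (auto simp: nat_trans_def fibre_trans_def)
    have "retractive_map G W X f Z"
      using \<tau> nat_trans_fibre_presheaf_iff[OF X Z, of f] unfolding \<tau>f by (simp add: f_def)
    then show ?thesis
      using X Z by (intro bexI[of _ "(X, f, Z)"]) (simp_all add: s \<tau>f Hom_retr_cat)
  qed
  ultimately show "bij_betw (fa ?F) (Hom R X Z) (Hom ?C (fo ?F X) (fo ?F Z))"
    unfolding bij_betw_def by blast
qed

text \<open>The n-simplices of the total space are codes of pairs (w, x) with x in F(n, w). An arrow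
  (a, g) moves w in \<open>W\<close> and x by the presheaf, so the laws of both combine to those of
  a joint action; the base points of \<open>F\<close> form the section.\<close>

lemma ess_surjective_fibre_functor:
  assumes U: "universe \<kappa> \<mu>"
  shows "ess_surjective R (fun_cat (op S) P) (fibre_functor \<kappa> G W)"
  unfolding ess_surjective_def
proof
  fix F assume "F \<in> Ob (fun_cat (op S) P)"
  then have F: "is_functor (op S) P F" by simp
  interpret F: is_functor "op S" P F by fact
  note Id = W.Delta.id_Hom[simplified]
  define A where "A n w = fst (fo F (n, w))" for n w
  define b where "b n w = snd (fo F (n, w))" for n w
  define \<phi> where "\<phi> t = fst (snd (fa F t))" for t
  have A: "fo F (n, w) = (A n w, b n w)" "|A n w| <o \<kappa>" "b n w \<in> A n w" if "w \<in> splx W n" for n w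
    using F.fo_Ob[of "(n, w)"] that by (simp_all add: A_def b_def)
  have \<phi>: "fa F (simp_arr W a g w) = (fo F (n, w), \<phi> (simp_arr W a g w), fo F (m, move W a g w))"
    "\<phi> (simp_arr W a g w) \<in> A n w \<rightarrow>\<^sub>E A m (move W a g w)"
    "\<phi> (simp_arr W a g w) (b n w) = b m (move W a g w)"
    if "a \<in> Hom Delta m n" "g \<in> carrier (fo G m)" "w \<in> splx W n" for a m n g w
    using F.fa_Hom[of "simp_arr W a g w" "(n, w)" "(m, move W a g w)"] W.simp_arr_Hom[OF that]
    by (auto simp: Hom_pset \<phi>_def A_def b_def)
  have \<phi>_id: "\<phi> (simp_arr W (Ident Delta n) \<one>\<^bsub>fo G n\<^esub> w) x = x" if "w \<in> splx W n" "x \<in> A n w" for n w x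
    using F.fa_Ident[of "(n, w)"] that by (simp add: W.Ident_Simp_cat \<phi>_def A_def)
  \<comment> \<open>\<open>F\<close> is contravariant, so the outer arrow, given by \<open>d\<close>
    and \<open>h\<close>, acts first.\<close>
  have \<phi>_comp: "\<phi> (simp_arr W (Comp Delta d a) (smap G a h \<otimes>\<^bsub>fo G m\<^esub> g) w) x =
      \<phi> (simp_arr W a g (move W d h w)) (\<phi> (simp_arr W d h w) x)"
    if a: "a \<in> Hom Delta m n" and d: "d \<in> Hom Delta n p" and g: "g \<in> carrier (fo G m)"
      and h: "h \<in> carrier (fo G n)" and w: "w \<in> splx W p" and x: "x \<in> A p w" for a d m n p g h w x
  proof -
    note dw = W.move_in[OF d h w]
    have da: "Comp Delta d a \<in> Hom Delta m p" and hg: "smap G a h \<otimes>\<^bsub>fo G m\<^esub> g \<in> carrier (fo G m)"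
      using W.Delta.comp_Hom[OF a d] W.mult_G W.smap_G_closed[OF a h] g by auto
    have "fa F (Comp (op S) (simp_arr W a g (move W d h w)) (simp_arr W d h w)) =
        Comp P (fa F (simp_arr W a g (move W d h w))) (fa F (simp_arr W d h w))"
      by (rule F.fa_Comp_Hom[of _ "(p, w)" "(n, move W d h w)" _ "(m, move W a g (move W d h w))"])
        (use W.simp_arr_Hom[OF d h w] W.simp_arr_Hom[OF a g dw] in simp_all)
    then have "\<phi> (simp_arr W (Comp Delta d a) (smap G a h \<otimes>\<^bsub>fo G m\<^esub> g) w) =
        compose (A p w) (\<phi> (simp_arr W a g (move W d h w))) (\<phi> (simp_arr W d h w))"
      by (simp add: W.Comp_Simp_cat[OF a d g h w] \<phi>(1)[OF d h w] \<phi>(1)[OF a g dw] \<phi>(1)[OF da hg w] A_def)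
    then show ?thesis using x by (simp add: compose_eq)
  qed
  \<comment> \<open>The copies are chosen degree by degree and may overlap, since simplices of
    different degrees are never compared.\<close>
  have "\<forall>n. \<exists>t. bij_betw (fst t) (Sigma (splx W n) (A n)) (snd t :: 'u set) \<and> |snd t| <o \<kappa>"
  proof
    fix n
    have "|Sigma (splx W n) (A n)| <o \<kappa>" by (rule small_Sigma[OF U W.splx_small A(2)])
    then obtain e and B :: "'u set" where "bij_betw e (Sigma (splx W n) (A n)) B" "|B| <o \<kappa>"
      by (rule small_copy)
    then show "\<exists>t. bij_betw (fst t) (Sigma (splx W n) (A n)) (snd t :: 'u set) \<and> |snd t| <o \<kappa>"
      by (intro exI[of _ "(e, B)"]) simp
  qed
  then obtain t where t: "\<forall>n. bij_betw (fst (t n)) (Sigma (splx W n) (A n)) (snd (t n) :: 'u set) \<and> |snd (t n)| <o \<kappa>"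
    by (rule choice[THEN exE])
  define e where "e n = fst (t n)" for n
  define B where "B n = snd (t n)" for n
  have e: "bij_betw (e n) (Sigma (splx W n) (A n)) (B n)" and B: "|B n| <o \<kappa>" for n
    using t by (simp_all add: e_def B_def)
  define i where "i n = inv_into (Sigma (splx W n) (A n)) (e n)" for n
  have ie: "i n (e n (w, x)) = (w, x)" if "w \<in> splx W n" "x \<in> A n w" for n w x
    using that e[of n] by (simp add: i_def bij_betw_def)
  have eB: "e n (w, x) \<in> B n" if "w \<in> splx W n" "x \<in> A n w" for n w x
    using that e[of n] by (auto simp: bij_betw_def)
  have BE: "\<exists>w x. w \<in> splx W n \<and> x \<in> A n w \<and> y = e n (w, x)" if "y \<in> B n" for n y
    using that bij_betw_imp_surj_on[OF e[of n]] by force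
  \<comment> \<open>Decode \<open>y\<close> to (w, x), move both entries along the same arrow, and
    encode the result in the new degree.\<close>
  define M where "M a g y = (case i (snd (snd a)) y of (w, x) \<Rightarrow>
    e (fst a) (move W a g w, \<phi> (simp_arr W a g w) x))" for a g y
  have M: "M a g (e n (w, x)) = e m (move W a g w, \<phi> (simp_arr W a g w) x)"
    if "a \<in> Hom Delta m n" "w \<in> splx W n" "x \<in> A n w" for a m n g w x
    using that ie by (simp add: M_def Hom_Delta)
  have \<phi>A: "\<phi> (simp_arr W a g w) x \<in> A m (move W a g w)"
    if "a \<in> Hom Delta m n" "g \<in> carrier (fo G m)" "w \<in> splx W n" "x \<in> A n w" for a m n g w x
    using PiE_mem[OF \<phi>(2)] that by blast
  define X where "X = \<lparr>tot = gsset_of G B M, ret = \<lambda>n. \<lambda>y\<in>B n. fst (i n y),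
    sec = \<lambda>n. \<lambda>w\<in>splx W n. e n (w, b n w)\<rparr>"
  have MB: "M a g y \<in> B m" if "a \<in> Hom Delta m n" "g \<in> carrier (fo G m)" "y \<in> B n" for a m n g y
    using BE[OF that(3)] that(1,2) by (auto simp: M intro!: eB \<phi>A W.move_in)
  have M_id: "M (Ident Delta n) \<one>\<^bsub>fo G n\<^esub> y = y" if "y \<in> B n" for n y
    using BE[OF that] by (auto simp: M[OF Id] W.move_id \<phi>_id)
  have M_comp: "M (Comp Delta d a) (smap G a h \<otimes>\<^bsub>fo G m\<^esub> g) y = M a g (M d h y)"
    if a: "a \<in> Hom Delta m n" and d: "d \<in> Hom Delta n p" and g: "g \<in> carrier (fo G m)"
      and h: "h \<in> carrier (fo G n)" and y: "y \<in> B p" for a d m n p g h y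
    using BE[OF y] by (auto simp: M[OF W.Delta.comp_Hom[OF a d]] M[OF d] M[OF a] W.move_in[OF d h]
        \<phi>A[OF d h] W.move_comp[OF a d g h] \<phi>_comp[OF a d g h])
  note Y = W.gsset_of[of B M, OF B MB M_id M_comp]
  have moveY: "move (gsset_of G B M) a g y = M a g y"
    if "a \<in> Hom Delta m n" "g \<in> carrier (fo G m)" "y \<in> B n" for a m n g y
    by (rule Y(2)) (use that in auto)
  have "G_simplicial_set \<kappa> G (gsset_of G B M)" by (rule Y(1))
  then have Y: "equivariant_sset \<kappa> G (gsset_of G B M)"
    using W.simplicial_monoid_action_axioms
    by (simp add: equivariant_sset_def equivariant_sset_axioms_def)
  have ret: "ret X n (e n (w, x)) = w" if "w \<in> splx W n" "x \<in> A n w" for n w x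
    using that by (simp add: X_def eB ie)
  have sec: "sec X n w = e n (w, b n w)" if "w \<in> splx W n" for n w using that by (simp add: X_def)
  have tot: "tot X = gsset_of G B M" by (simp add: X_def)
  have "G_map G (tot X) W (ret X)"
    unfolding tot
  proof (rule G_mapI[OF Y W.equivariant_sset_axioms])
    show "ret X n \<in> splx (gsset_of G B M) n \<rightarrow>\<^sub>E splx W n" for n
      using BE ret by (fastforce simp: X_def)
    fix a m n g y assume a: "a \<in> Hom Delta m n" and g: "g \<in> carrier (fo G m)"
      and "y \<in> splx (gsset_of G B M) n"
    then have y: "y \<in> B n" by simp
    show "ret X m (move (gsset_of G B M) a g y) = move W a g (ret X n y)"
      using BE[OF y] by (auto simp: moveY[OF a g y] M[OF a] ret W.move_in[OF a g] \<phi>A[OF a g])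
  qed
  moreover have "G_map G W (tot X) (sec X)"
    unfolding tot
  proof (rule G_mapI[OF W.equivariant_sset_axioms Y])
    show "sec X n \<in> splx W n \<rightarrow>\<^sub>E splx (gsset_of G B M) n" for n
      using eB A(3) by (auto simp: X_def)
    fix a m n g w assume a: "a \<in> Hom Delta m n" and g: "g \<in> carrier (fo G m)" and w: "w \<in> splx W n"
    show "sec X m (move W a g w) = move (gsset_of G B M) a g (sec X n w)"
      using moveY[OF a g eB[OF w A(3)[OF w]]] M[OF a w A(3)[OF w], of g] \<phi>(3)[OF a g w]
      by (simp add: sec w W.move_in[OF a g w])
  qed
  ultimately have X: "retractive_space \<kappa> G W X"
    using Y A(3) ret sec by (simp add: retractive_space_def tot equivariant_sset_def equivariant_sset_axioms_def)
  have fibre_iff: "y \<in> fst (fibre X (n, w)) \<longleftrightarrow> (\<exists>x \<in> A n w. y = e n (w, x))" if "w \<in> splx W n" for n w y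
    unfolding fibre_sel tot gsset_of_splx mem_Collect_eq using that BE[of y n] eB ret by metis
  \<comment> \<open>The fibre over \<open>w\<close> consists of the codes of pairs with first entry
    \<open>w\<close>; dropping that entry compares it with the value of \<open>F\<close>.\<close>
  define \<tau> where "\<tau> = (\<lambda>(n, w)\<in>Ob S. (fibre X (n, w), \<lambda>y\<in>fst (fibre X (n, w)). snd (i n y), fo F (n, w)))"
  have \<tau>: "\<tau> (n, w) = (fibre X (n, w), \<lambda>y\<in>fst (fibre X (n, w)). snd (i n y), fo F (n, w))"
    if "w \<in> splx W n" for n w using that by (simp add: \<tau>_def)
  have \<tau>H: "\<tau> (n, w) \<in> Hom P (fibre X (n, w)) (fo F (n, w))" if w: "w \<in> splx W n" for n w
    using fibre_Ob[OF X w] F.fo_Ob[of "(n, w)"] w A(3)[OF w] fibre_iff[OF w] ie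
    by (auto simp: \<tau> Hom_pset A(1) sec simp del: fibre_sel(1)) 
  have "nat_iso (op S) P (fibre_presheaf G W X) F \<tau>"
    unfolding nat_iso_def
  proof (intro conjI ballI nat_transI)
    show "is_functor (op S) P (fibre_presheaf G W X)" by (rule is_functor_fibre_presheaf[OF X])
    show "is_functor (op S) P F" by fact
    show "\<tau> \<in> extensional (Ob (op S))" by (simp add: \<tau>_def)
    show "\<tau> c \<in> Hom P (fo (fibre_presheaf G W X) c) (fo F c)" if "c \<in> Ob (op S)" for c
      using that \<tau>H by (cases c) (simp add: fibre_presheaf_fo)
    show "is_iso P (\<tau> c)" if "c \<in> Ob (op S)" for c
    proof -
      obtain n w where c: "c = (n, w)" and w: "w \<in> splx W n" using \<open>c \<in> Ob (op S)\<close> by (cases c) simp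
      have "bij_betw (\<lambda>y\<in>fst (fibre X (n, w)). snd (i n y)) (fst (fibre X (n, w))) (A n w)"
        by (rule bij_betwI[where g="\<lambda>x. e n (w, x)"])
          (use fibre_iff[OF w] ie[OF w] in \<open>auto simp del: fibre_sel\<close>)
      then show ?thesis
        using \<tau>H[OF w] unfolding c \<tau>[OF w] A(1)[OF w] by (intro pset_isoI) simp_all
    qed
    fix t c c' assume t': "t \<in> Hom (op S) c c'"
    obtain n w m v where c: "c = (n, w)" "c' = (m, v)" by (cases c, cases c')
    with t' obtain a g where a: "a \<in> Hom Delta m n" and g: "g \<in> carrier (fo G m)" and w: "w \<in> splx W n"
      and t: "t = simp_arr W a g w" and v: "v = move W a g w"
      by (auto simp: W.Hom_Simp_cat)
    note aw = W.move_in[OF a g w]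
    \<comment> \<open>Both composites send the code of (w, x) to
      \<open>\<phi> (simp_arr W a g w) x\<close>.\<close>
    have "compose (fst (fibre X (n, w))) (\<lambda>y\<in>fst (fibre X (m, move W a g w)). snd (i m y))
        (\<lambda>y\<in>fst (fibre X (n, w)). move (tot X) a g y) =
      compose (fst (fibre X (n, w))) (\<phi> (simp_arr W a g w)) (\<lambda>y\<in>fst (fibre X (n, w)). snd (i n y))"
      unfolding compose_def
    proof (rule restrict_ext)
      fix y assume y: "y \<in> fst (fibre X (n, w))"
      then obtain x where x: "x \<in> A n w" "y = e n (w, x)" using fibre_iff[OF w] by blast
      have "move (tot X) a g y = e m (move W a g w, \<phi> (simp_arr W a g w) x)"
        using moveY[OF a g eB[OF w x(1)]] M[OF a w x(1)] by (simp add: tot x(2))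
      moreover have "e m (move W a g w, \<phi> (simp_arr W a g w) x) \<in> fst (fibre X (m, move W a g w))"
        using fibre_iff[OF aw] \<phi>A[OF a g w x(1)] by blast
      ultimately show "(\<lambda>y\<in>fst (fibre X (m, move W a g w)). snd (i m y))
          ((\<lambda>y\<in>fst (fibre X (n, w)). move (tot X) a g y) y) =
          \<phi> (simp_arr W a g w) ((\<lambda>y\<in>fst (fibre X (n, w)). snd (i n y)) y)"
        using y ie[OF aw \<phi>A[OF a g w x(1)]] ie[OF w x(1)] by (simp add: x(2) del: fibre_sel)
    qed
    then show "Comp P (\<tau> c') (fa (fibre_presheaf G W X) t) = Comp P (fa F t) (\<tau> c)"
      by (simp add: c v t \<tau> w aw fibre_presheaf_fa[OF a g w] \<phi>(1)[OF a g w] del: fibre_sel)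
  qed
  then have "is_iso (fun_cat (op S) P) (fibre_presheaf G W X, \<tau>, F)"
    and "(fibre_presheaf G W X, \<tau>, F) \<in> Hom (fun_cat (op S) P) (fo (fibre_functor \<kappa> G W) X) F"
    using X by (auto simp: Hom_fun_cat nat_iso_def intro!: nat_iso_is_iso)
  then show "\<exists>c\<in>Ob R. \<exists>u\<in>Hom (fun_cat (op S) P) (fo (fibre_functor \<kappa> G W) c) F. is_iso (fun_cat (op S) P) u"
    using X by auto
qed

end

section \<open>The fibre equivalence and the limits and colimits transported along it\<close>

theorem proposition1p1p3:
  fixes \<kappa> :: "'u rel" and \<mu> :: "'j rel"
    and G :: "'g smonoid" and W :: "('w, 'g) gsset"
  assumes "universe \<kappa> \<mu>"
    and "simplicial_monoid \<kappa> G"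
    and "G_simplicial_set \<kappa> G W"
  shows "is_equivalence (retr_cat \<kappa> G W) (fun_cat (op (Simp_cat G W)) (pset_cat \<kappa>))
           (fibre_functor \<kappa> G W) \<and>
         complete \<mu> (retr_cat \<kappa> G W) \<and>
         cocomplete \<mu> (retr_cat \<kappa> G W) \<and>
         limits_computed_by \<mu> (retr_cat \<kappa> G W) (pset_cat \<kappa>) (Ob (Simp_cat G W)) (fibre_at \<kappa> G W) \<and>
         colimits_computed_by \<mu> (retr_cat \<kappa> G W) (pset_cat \<kappa>) (Ob (Simp_cat G W)) (fibre_at \<kappa> G W)"
proof -
  interpret retractive_base \<kappa> G W
    using assms(2,3) by unfold_locales
  interpret F: ff_eso_functor R "fun_cat (op S) P" "fibre_functor \<kappa> G W"
    using is_functor_fibre_functor fully_faithful_fibre_functor ess_surjective_fibre_functor[OF assms(1)]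
    by (simp add: ff_eso_functor_def ff_eso_functor_axioms_def)
  \<comment> \<open>Joint creation of limits for the opposite categories is joint creation of
    colimits, so the same fibre functor is used between the opposites.\<close>
  interpret opF: ff_eso_functor "op R" "op (fun_cat (op S) P)" "fibre_functor \<kappa> G W"
    by (rule ff_eso_functor_op) (rule F.ff_eso_functor_axioms)
  have opS: "category (op S)" using W.category_Simp_cat by simp
  have "jointly_create_limits \<mu> R P (Ob (op S))
      (\<lambda>c. comp_functor R (eval_functor (op S) P c) (fibre_functor \<kappa> G W))"
    by (rule F.jointly_create_limits[OF fun_cat_creates_limits[OF opS category_pset_cat pset_complete[OF assms(1)]]])
  \<comment> \<open>\<open>fibre_at\<close> is evaluation after the fibre functor, so the
    transported family is the family of fibres.\<close>
  then have lim: "jointly_create_limits \<mu> R P (Ob S) (fibre_at \<kappa> G W)"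
    by (simp add: fibre_at_def[abs_def])
  have "jointly_create_limits \<mu> (op R) (op P) (Ob (op S))
      (\<lambda>c. comp_functor (op R) (eval_functor (op S) P c) (fibre_functor \<kappa> G W))"
    by (rule opF.jointly_create_limits[OF fun_cat_creates_colimits[OF opS category_pset_cat pset_cocomplete[OF assms(1)]]])
  then have colim: "jointly_create_limits \<mu> (op R) (op P) (Ob S) (fibre_at \<kappa> G W)"
    by (simp add: fibre_at_def[abs_def])
  show ?thesis
    using F.equivalence jointly_create_limits_complete[OF lim] jointly_create_limits_computed[OF lim]
      complete_op[OF jointly_create_limits_complete[OF colim]]
      limits_computed_by_op[OF jointly_create_limits_computed[OF colim]] by blast
qed

end
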